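(* Let $\mathcal{G}=([p],E)$ be a DAG with linear extension $\pi=\pi_1\cdots\pi_p$, and let $\mathcal{M}_{\mathcal{I}}(\mathcal{G})$ be a (discrete) interventional DAG model, where $\mathcal{I}$ is a collection of intervention targets with $\emptyset\in\mathcal{I}$. Let $\mathcal{F}_{\mathcal{G},\mathcal{I}}$ be the $\mathcal{I}$-factorization ideal and $I_{\mathcal{G},\mathcal{I}}$ the $\mathcal{I}$-conditional independence ideal, both in $\mathbb{R}[D_{\mathcal{I}}]$. (1) There is a containment of ideals $I_{\mathcal{G},\mathcal{I}}\subset \mathcal{F}_{\mathcal{G},\mathcal{I}}$. Moreover, if $$\mathbf{p}=\prod_{I\in\mathcal{I}}\ \prod_{\mathbf{x}\in\bigcup_{k\in[p]}\mathcal{R}_{\{\pi_1,\ldots,\pi_k\}}}p^{(I)}_{\mathbf{x}+},$$ then $(I_{\mathcal{G},\mathcal{I}}:(\mathbf{p})^{\infty})=\mathcal{F}_{\mathcal{G},\mathcal{I}}$. (2) The ideal $\mathcal{F}_{\mathcal{G},\mathcal{I}}$ is a minimal prime of the ideal $I_{\mathcal{G},\mathcal{I}}$. (3) The following equality of subsets of the product of open probability simplices $\prod_{I\in\mathcal{I}}\Delta^{\circ}_{|\mathcal{R}|-1}$ (one simplex for each $I\in\mathcal{I}$) holds: $$V_{\ge}(I_{\mathcal{G},\mathcal{I}}+\langle\sigma-1\rangle)=V_{\ge}(\mathcal{F}_{\mathcal{G},\mathcal{I}})=\mathrm{image}_{\ge}(\phi_{\mathcal{I}})=\mathcal{M}_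{\mathcal{I}}(\mathcal{G}).$$
   Context: **Setting.** $\mathcal{G}=([p],E)$ is a directed acyclic graph on $[p]=\{1,\ldots,p\}$; $\mathrm{pa}_{\mathcal{G}}(j)$ is the set of parents of $j$. A linear extension of $\mathcal{G}$ is a permutation $\pi_1\cdots\pi_p$ of $[p]$ in which $i$ appears before $j$ whenever $i\to j\in E$. $(X_1,\ldots,X_p)$ is a vector of discrete random variables, $X_k$ having state space $[d_k]=\{1,\ldots,d_k\}$. For $S\subset[p]$, $\mathcal{R}_S=\prod_{i\in S}[d_i]$ and $\mathcal{R}=\mathcal{R}_{[p]}$; for $\mathbf{x}\in\mathcal{R}$, $\mathbf{x}_S\in\mathcal{R}_S$ is the restriction to $S$; concatenation $\mathbf{x}_A\mathbf{x}_B$ denotes the joint outcome of $X_{A\cup B}$. $\Delta^\circ_{n}$ is the set of vectors in $\mathbb{R}^{n+1}$ with coordinates in $(0,1)$ summing to $1$. A positive probability mass function $f\in\Delta^{\circ}_{|\mathcal{R}|-1}$ is Markov to $\mathcal{G}$ if $f(\mathbf{x})=\prod_{j}f(x_j\mid\mathbf{x}_{\mathrm{pa}_{\mathcal{G}}(j)})$ for all $\mathbf{x}\in\mathcal{R}$; $\mathcal{M}(\mathcal{G})$ is the set of such $f$. **Interventional model.** $\mathcal{I}=\{I_0=\emptyset,I_1,\ldots,I_K\}$ is a collection of subsets of $[p]$ (intervention targets). $\mathcal{M}_{\mathcal{I}}(\mathcal{G})$ is the set of sequences $(f^{(I)})_{I\in\mathcal{I}}$ such that for all $I,J\in\mathcal{I}$: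 $f^{(I)}\in\mathcal{M}(\mathcal{G})$ and $f^{(I)}(x_j\mid\mathbf{x}_{\mathrm{pa}_{\mathcal{G}}(j)})=f^{(J)}(x_j\mid\mathbf{x}_{\mathrm{pa}_{\mathcal{G}}(j)})$ for all $j\notin I\cup J$. The $\mathcal{I}$-DAG $\mathcal{G}^{\mathcal{I}}$ is obtained from $\mathcal{G}$ by adding a node $w_I$ for each $I\in\mathcal{I}\setminus\{\emptyset\}$ and the edges $w_I\to j$ for all $j\in I$. For a subcollection $\mathcal{J}\subset\mathcal{I}$, $W_{\mathcal{J}}=\{w_J: J\in\mathcal{J}\setminus\{\emptyset\}\}$. **Rings.** $D_{\mathcal{I}}=\{p^{(I)}_{\mathbf{x}}:\mathbf{x}\in\mathcal{R},I\in\mathcal{I}\}$ are indeterminates. For $A\subset[p]$ and $\mathbf{x}_A\in\mathcal{R}_A$, $p^{(I)}_{\mathbf{x}_A+}=\sum_{\mathbf{y}\in\mathcal{R},\,\mathbf{y}_A=\mathbf{x}_A}p^{(I)}_{\mathbf{y}}$; for $A=\emptyset$ write $p^{(I)}_+$. $\langle\sigma-1\rangle$ is the ideal generated by $p^{(I)}_+-1$, $I\in\mathcal{I}$. For an ideal $J\subset\mathbb{R}[D_{\mathcal{I}}]$, $V_{\ge}(J)$ is the set of points of $\mathbb{R}^{|D_{\mathcal{I}}|}$ with nonnegative coordinates at which all elements of $J$ vanish. $(J:(\mathbf{p})^\infty)$ is the saturation of $J$ by $\mathbf{p}$. **Factorization ideal.** $U_{\mathcal{G},\mathcal{I}}$ is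 the set of indeterminates $q^{(I)}_{j;x;\mathbf{y}}$ with $I\in\mathcal{I}$, $j\in[p]$, $x\in[d_j]$, $\mathbf{y}\in\mathcal{R}_{\mathrm{pa}_{\mathcal{G}}(j)}$. $\mathfrak{q}_{\mathcal{I}}$ is the ideal of $\mathbb{R}[U_{\mathcal{G},\mathcal{I}}]$ generated by all $\sum_{x\in[d_j]}q^{(I)}_{j;x;\mathbf{y}}-1$ and all $q^{(I)}_{j;x;\mathbf{y}}-q^{(J)}_{j;x;\mathbf{y}}$ with $j\notin I\cup J$. Then $\mathcal{F}_{\mathcal{G},\mathcal{I}}$ is the kernel of the ring map $$\Phi_{\mathcal{G},\mathcal{I}}:\mathbb{R}[D_{\mathcal{I}}]\to\mathbb{R}[U_{\mathcal{G},\mathcal{I}}]/\mathfrak{q}_{\mathcal{I}},\qquad p^{(I)}_{\mathbf{x}}\mapsto \prod_{j\in I}q^{(I)}_{j;x_j;\mathbf{x}_{\mathrm{pa}_{\mathcal{G}}(j)}}\prod_{j\notin I}q^{(\emptyset)}_{j;x_j;\mathbf{x}_{\mathrm{pa}_{\mathcal{G}}(j)}}.$$ The map $\phi_{\mathcal{I}}:\mathbb{R}^{|U_{\mathcal{G},\mathcal{I}}|}\to\mathbb{R}^{|D_{\mathcal{I}}|}$ sends $q$ to the point with coordinates $p^{(I)}_{\mathbf{x}}=\prod_{j\in I}q^{(I)}_{j;x_j;\mathbf{x}_{\mathrm{pa}_{\mathcal{G}}(j)}}\prod_{j\notin I}q^{(\emptyset)}_{j;x_j;\mathbf{x}_{\mathrm{pa}_{\mathcal{G}}(j)}}$,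 and $\mathrm{image}_{\ge}(\phi_{\mathcal{I}})$ is the image under $\phi_{\mathcal{I}}$ of the set of tuples $q$ with positive coordinates satisfying all equations given by the generators of $\mathfrak{q}_{\mathcal{I}}$. **Conditional independence ideal.** For fixed $I\in\mathcal{I}$, $I_{\mathrm{global}(\mathcal{G},I)}$ is the ideal generated by all polynomials $p^{(I)}_{\mathbf{x}_A\mathbf{x}_B\mathbf{x}_C+}p^{(I)}_{\mathbf{x}'_A\mathbf{x}'_B\mathbf{x}_C+}-p^{(I)}_{\mathbf{x}_A\mathbf{x}'_B\mathbf{x}_C+}p^{(I)}_{\mathbf{x}'_A\mathbf{x}_B\mathbf{x}_C+}$ for all disjoint $A,B,C\subset[p]$ with $A,B\neq\emptyset$ such that $C$ d-separates $A$ and $B$ in $\mathcal{G}$, and all $\mathbf{x}_A,\mathbf{x}'_A\in\mathcal{R}_A$, $\mathbf{x}_B,\mathbf{x}'_B\in\mathcal{R}_B$, $\mathbf{x}_C\in\mathcal{R}_C$. $\mathrm{Inv}_{\mathcal{G},\mathcal{I}}$ is the ideal generated by all $p^{(I)}_{\mathbf{x}_A\mathbf{x}_C+}p^{(\emptyset)}_{\mathbf{x}_C+}-p^{(\emptyset)}_{\mathbf{x}_A\mathbf{x}_C+}p^{(I)}_{\mathbf{x}_C+}$ with $I\in\mathcal{I}$ (only $I\neq\emptyset$ contributes), $\mathbf{x}\in\mathcal{R}$, and disjoint $A,C\subset[p]$ such that $C\cup W_{\mathcal{I}\setminus\{I\}}$ d-separates $A$ and $w_I$ in $\mathcal{G}^{\mathcal{I}}$.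 Finally $I_{\mathcal{G},\mathcal{I}}=\mathrm{Inv}_{\mathcal{G},\mathcal{I}}+\bigoplus_{I\in\mathcal{I}}I_{\mathrm{global}(\mathcal{G},I)}$, the sum being the ideal of $\mathbb{R}[D_{\mathcal{I}}]$ generated by all these generators (the ideals $I_{\mathrm{global}(\mathcal{G},I)}$ involve disjoint sets of indeterminates).
   Formalization: The saturation in (1) and the minimal prime in (2) are for I_{G,I}+⟨σ−1⟩, not I_{G,I}: F contains p_+−1, while I_{G,I} and p are homogeneous, so the printed claims always fail. In (3) each V_≥ and the image is intersected with the product of open simplices. *)

theory Defs
  imports
    Complex_Main
    "HOL-Library.Poly_Mapping"
    "HOL-Library.FuncSet"
    "HOL-Combinatorics.Permutations"
    "HOL-Algebra.QuotRing"
begin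

section \<open>Polynomial rings over the reals with a set of indeterminates\<close>

text \<open>
  Monomials are finitely supported exponent functions, polynomials are finitely supported
  coefficient functions on monomials.  The type contains the polynomials in all indeterminates
  of type \<open>'v\<close>; the ring with indeterminates \<open>V\<close> is cut out as the carrier of a ring record, so
  that ideals, quotients and kernels are those of HOL-Algebra.
\<close>

type_synonym 'v mpoly = "('v \<Rightarrow>\<^sub>0 nat) \<Rightarrow>\<^sub>0 real"

definition Var :: "'v \<Rightarrow> 'v mpoly" where
  "Var v = Poly_Mapping.single (Poly_Mapping.single v 1) 1"

definition Const :: "real \<Rightarrow> 'v mpoly" where
  "Const c = Poly_Mapping.single 0 c"

definition vars :: "'v mpoly \<Rightarrow> 'v set" where
  "vars P = (\<Union>m\<in>Poly_Mapping.keys P. Poly_Mapping.keys m)"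

definition poly_ring :: "'v set \<Rightarrow> 'v mpoly ring" where
  "poly_ring V = \<lparr>carrier = {P. vars P \<subseteq> V}, monoid.mult = (*), one = 1, zero = 0, add = (+)\<rparr>"

text \<open>The value of \<open>P\<close> after \<open>c\<close> is applied to the coefficients and \<open>v\<close> is replaced by \<open>f v\<close>.\<close>

definition poly_subst :: "(real \<Rightarrow> 'b::comm_semiring_1) \<Rightarrow> ('v \<Rightarrow> 'b) \<Rightarrow> 'v mpoly \<Rightarrow> 'b" where
  "poly_subst c f P =
     (\<Sum>m\<in>Poly_Mapping.keys P. c (Poly_Mapping.lookup P m) *
        (\<Prod>v\<in>Poly_Mapping.keys m. f v ^ Poly_Mapping.lookup m v))"

definition eval_at :: "('v \<Rightarrow> real) \<Rightarrow> 'v mpoly \<Rightarrow> real" where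
  "eval_at = poly_subst (\<lambda>c. c)"

definition V_nonneg :: "'v set \<Rightarrow> 'v mpoly set \<Rightarrow> ('v \<Rightarrow> real) set" where
  "V_nonneg V J = {a \<in> V \<rightarrow>\<^sub>E {0..}. \<forall>g\<in>J. eval_at a g = 0}"

definition saturation :: "('a, 'm) ring_scheme \<Rightarrow> 'a set \<Rightarrow> 'a \<Rightarrow> 'a set" where
  "saturation R J s = {f \<in> carrier R. \<exists>n::nat. (s [^]\<^bsub>R\<^esub> n) \<otimes>\<^bsub>R\<^esub> f \<in> J}"

definition minimal_prime :: "('a, 'm) ring_scheme \<Rightarrow> 'a set \<Rightarrow> 'a set \<Rightarrow> bool" where
  "minimal_prime R J P \<longleftrightarrow>
     primeideal P R \<and> J \<subseteq> P \<and> (\<forall>Q. primeideal Q R \<and> J \<subseteq> Q \<and> Q \<subseteq> P \<longrightarrow> Q = P)"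

lemma keys_times_mpoly:
  fixes P Q :: "'v mpoly"
  assumes "m \<in> Poly_Mapping.keys (P * Q)"
  obtains a b where "a \<in> Poly_Mapping.keys P" "b \<in> Poly_Mapping.keys Q" "m = a + b"
  using assms Poly_Mapping.keys_mult[of P Q] by blast

lemma vars_plus: "vars (P + Q) \<subseteq> vars P \<union> vars Q"
  using Poly_Mapping.keys_add[of P Q] by (fastforce simp: vars_def)

lemma vars_uminus: "vars (- P) = vars P"
  by (simp add: vars_def)

lemma vars_times: "vars (P * Q) \<subseteq> vars P \<union> vars Q"
proof
  fix v assume "v \<in> vars (P * Q)"
  then obtain m where m: "m \<in> Poly_Mapping.keys (P * Q)" "v \<in> Poly_Mapping.keys m"
    by (auto simp: vars_def)
  from m(1) obtain a b where "a \<in> Poly_Mapping.keys P" "b \<in> Poly_Mapping.keys Q" "m = a + b"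
    by (rule keys_times_mpoly)
  with m(2) Poly_Mapping.keys_add[of a b] show "v \<in> vars P \<union> vars Q"
    by (auto simp: vars_def)
qed

lemma cring_poly_ring:
  fixes V :: "'v set"
  shows "cring (poly_ring V)"
proof (rule cringI)
  have vars01: "vars (0 :: 'v mpoly) = {}" "vars (1 :: 'v mpoly) = {}"
    by (simp_all add: vars_def)
  have c: "P + Q \<in> {P. vars P \<subseteq> V}" "P * Q \<in> {P. vars P \<subseteq> V}"
    if "P \<in> {P. vars P \<subseteq> V}" "Q \<in> {P. vars P \<subseteq> V}" for P Q :: "'v mpoly"
    using that vars_plus[of P Q] vars_times[of P Q] by blast+
  show "abelian_group (poly_ring V)"
  proof (rule abelian_groupI)
    fix x assume "x \<in> carrier (poly_ring V)"
    then show "\<exists>y\<in>carrier (poly_ring V). y \<oplus>\<^bsub>poly_ring V\<^esub> x = \<zero>\<^bsub>poly_ring V\<^esub>"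
      by (intro bexI[of _ "- x"]) (simp_all add: poly_ring_def vars_uminus)
  qed (use c vars01 in \<open>simp_all add: poly_ring_def add.assoc add.commute\<close>)
  show "comm_monoid (poly_ring V)"
    by (rule comm_monoidI)
      (use c vars01 in \<open>simp_all add: poly_ring_def mult.assoc mult.commute\<close>)
qed (simp add: poly_ring_def distrib_right)


section \<open>d-separation\<close>

definition parents :: "('v \<times> 'v) set \<Rightarrow> 'v \<Rightarrow> 'v set" where
  "parents E j = {i. (i, j) \<in> E}"

definition is_path :: "('v \<times> 'v) set \<Rightarrow> 'v list \<Rightarrow> bool" where
  "is_path E vs \<longleftrightarrow> vs \<noteq> [] \<and> distinct vs \<and>
     (\<forall>i. Suc i < length vs \<longrightarrow> (vs ! i, vs ! Suc i) \<in> E \<union> E\<inverse>)"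

text \<open>
  A path is blocked by \<open>C\<close> if one of its inner nodes is a collider none of whose descendants
  (the node itself included) lies in \<open>C\<close>, or is not a collider and lies in \<open>C\<close>.
\<close>

definition blocked :: "('v \<times> 'v) set \<Rightarrow> 'v set \<Rightarrow> 'v list \<Rightarrow> bool" where
  "blocked E C vs \<longleftrightarrow> (\<exists>i. Suc (Suc i) < length vs \<and>
     (if (vs ! i, vs ! Suc i) \<in> E \<and> (vs ! Suc (Suc i), vs ! Suc i) \<in> E
      then \<forall>c\<in>C. (vs ! Suc i, c) \<notin> E\<^sup>*
      else vs ! Suc i \<in> C))"

definition d_separates :: "('v \<times> 'v) set \<Rightarrow> 'v set \<Rightarrow> 'v set \<Rightarrow> 'v set \<Rightarrow> bool" where
  "d_separates E C A B \<longleftrightarrow>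
     (\<forall>vs. is_path E vs \<and> hd vs \<in> A \<and> last vs \<in> B \<longrightarrow> blocked E C vs)"

definition linear_extension :: "nat \<Rightarrow> (nat \<times> nat) set \<Rightarrow> (nat \<Rightarrow> nat) \<Rightarrow> bool" where
  "linear_extension p E \<pi> \<longleftrightarrow>
     \<pi> permutes {1..p} \<and> (\<forall>(i, j)\<in>E. inv_into UNIV \<pi> i < inv_into UNIV \<pi> j)"

text \<open>The \<open>\<I>\<close>-DAG; \<open>Obs j\<close> is the node \<open>j\<close> of the original graph and \<open>Interv I\<close> is \<open>w\<^sub>I\<close>.\<close>

datatype inode = Obs nat | Interv "nat set"

definition idag :: "(nat \<times> nat) set \<Rightarrow> nat set set \<Rightarrow> (inode \<times> inode) set" where
  "idag E \<I> = {(Obs i, Obs j) |i j. (i, j) \<in> E} \<union>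
               {(Interv I, Obs j) |I j. I \<in> \<I> - {{}} \<and> j \<in> I}"

definition W :: "nat set set \<Rightarrow> inode set" where
  "W \<J> = Interv ` (\<J> - {{}})"


section \<open>Outcomes and interventional models\<close>

text \<open>
  An outcome of \<open>X\<^sub>S\<close> is a partial map with domain \<open>S\<close>.  Restriction to \<open>A\<close> is \<open>x |` A\<close>, and
  concatenation of outcomes with disjoint domains is \<open>++\<close>.
\<close>

type_synonym outcome = "nat \<rightharpoonup> nat"

definition outcomes :: "(nat \<Rightarrow> nat) \<Rightarrow> nat set \<Rightarrow> outcome set" where
  "outcomes d S = {x. dom x = S \<and> (\<forall>i\<in>S. the (x i) \<in> {1..d i})}"

definition extending :: "nat \<Rightarrow> (nat \<Rightarrow> nat) \<Rightarrow> outcome \<Rightarrow> outcome set" where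
  "extending p d u = {y \<in> outcomes d {1..p}. y |` dom u = u}"

definition open_simplex :: "'a set \<Rightarrow> ('a \<Rightarrow> real) set" where
  "open_simplex X = {f \<in> X \<rightarrow>\<^sub>E {0<..<1}. (\<Sum>x\<in>X. f x) = 1}"

definition marginal :: "nat \<Rightarrow> (nat \<Rightarrow> nat) \<Rightarrow> (outcome \<Rightarrow> real) \<Rightarrow> outcome \<Rightarrow> real" where
  "marginal p d f u = (\<Sum>y\<in>extending p d u. f y)"

definition cond_prob :: "nat \<Rightarrow> (nat \<Rightarrow> nat) \<Rightarrow> (outcome \<Rightarrow> real) \<Rightarrow> outcome \<Rightarrow> outcome \<Rightarrow> real" where
  "cond_prob p d f u v = marginal p d f (u ++ v) / marginal p d f v"

definition dag_model :: "nat \<Rightarrow> (nat \<Rightarrow> nat) \<Rightarrow> (nat \<times> nat) set \<Rightarrow> (outcome \<Rightarrow> real) set" where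
  "dag_model p d E = {f \<in> open_simplex (outcomes d {1..p}).
     \<forall>x\<in>outcomes d {1..p}. f x = (\<Prod>j\<in>{1..p}. cond_prob p d f (x |` {j}) (x |` parents E j))}"

text \<open>
  The indeterminate \<open>p\<^sub>x\<close> for the intervention target \<open>I\<close> is indexed by the pair \<open>(I, x)\<close>.
  Points of the real space with these coordinates are extensional functions of such pairs, so a
  family of functions indexed by \<open>\<I>\<close> is such a point, and \<open>component\<close> selects its members.
\<close>

type_synonym pindex = "nat set \<times> outcome"

definition D :: "nat \<Rightarrow> (nat \<Rightarrow> nat) \<Rightarrow> nat set set \<Rightarrow> pindex set" where
  "D p d \<I> = \<I> \<times> outcomes d {1..p}"

definition component :: "nat \<Rightarrow> (nat \<Rightarrow> nat) \<Rightarrow> (pindex \<Rightarrow> real) \<Rightarrow> nat set \<Rightarrow> outcome \<Rightarrow> real" where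
  "component p d a I = (\<lambda>x\<in>outcomes d {1..p}. a (I, x))"

definition simplex_product :: "nat \<Rightarrow> (nat \<Rightarrow> nat) \<Rightarrow> nat set set \<Rightarrow> (pindex \<Rightarrow> real) set" where
  "simplex_product p d \<I> = {a \<in> D p d \<I> \<rightarrow>\<^sub>E UNIV.
     \<forall>I\<in>\<I>. component p d a I \<in> open_simplex (outcomes d {1..p})}"

definition interventional_model ::
  "nat \<Rightarrow> (nat \<Rightarrow> nat) \<Rightarrow> (nat \<times> nat) set \<Rightarrow> nat set set \<Rightarrow> (pindex \<Rightarrow> real) set" where
  "interventional_model p d E \<I> = {a \<in> D p d \<I> \<rightarrow>\<^sub>E UNIV. \<forall>I\<in>\<I>. \<forall>J\<in>\<I>.
     component p d a I \<in> dag_model p d E \<and>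
     (\<forall>j\<in>{1..p} - (I \<union> J). \<forall>x\<in>outcomes d {1..p}.
        cond_prob p d (component p d a I) (x |` {j}) (x |` parents E j) =
        cond_prob p d (component p d a J) (x |` {j}) (x |` parents E j))}"


section \<open>The factorization ideal\<close>

text \<open>\<open>(I, j, x, y)\<close> is the index of the indeterminate \<open>q\<^sub>j\<^sub>;\<^sub>x\<^sub>;\<^sub>y\<close> for the intervention target \<open>I\<close>.\<close>

type_synonym qindex = "nat set \<times> nat \<times> nat \<times> outcome"

definition U :: "nat \<Rightarrow> (nat \<Rightarrow> nat) \<Rightarrow> (nat \<times> nat) set \<Rightarrow> nat set set \<Rightarrow> qindex set" where
  "U p d E \<I> = {(I, j, x, y). I \<in> \<I> \<and> j \<in> {1..p} \<and> x \<in> {1..d j} \<and> y \<in> outcomes d (parents E j)}"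

definition q_gens ::
  "nat \<Rightarrow> (nat \<Rightarrow> nat) \<Rightarrow> (nat \<times> nat) set \<Rightarrow> nat set set \<Rightarrow> qindex mpoly set" where
  "q_gens p d E \<I> =
     {(\<Sum>x\<in>{1..d j}. Var (I, j, x, y)) - 1 |I j y.
        I \<in> \<I> \<and> j \<in> {1..p} \<and> y \<in> outcomes d (parents E j)} \<union>
     {Var (I, j, x, y) - Var (J, j, x, y) |I J j x y.
        I \<in> \<I> \<and> J \<in> \<I> \<and> j \<in> {1..p} - (I \<union> J) \<and> x \<in> {1..d j} \<and> y \<in> outcomes d (parents E j)}"

definition q_ideal ::
  "nat \<Rightarrow> (nat \<Rightarrow> nat) \<Rightarrow> (nat \<times> nat) set \<Rightarrow> nat set set \<Rightarrow> qindex mpoly set" where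
  "q_ideal p d E \<I> = Idl\<^bsub>poly_ring (U p d E \<I>)\<^esub> (q_gens p d E \<I>)"

text \<open>
  The common right-hand side of the ring map (\<open>q = Var\<close>) and of the parametrization
  (\<open>q\<close> a real point).
\<close>

definition factorization ::
  "nat \<Rightarrow> (nat \<times> nat) set \<Rightarrow> (qindex \<Rightarrow> 'b::comm_monoid_mult) \<Rightarrow> pindex \<Rightarrow> 'b" where
  "factorization p E q = (\<lambda>(I, x).
     (\<Prod>j\<in>I. q (I, j, the (x j), x |` parents E j)) *
     (\<Prod>j\<in>{1..p} - I. q ({}, j, the (x j), x |` parents E j)))"

definition Phi ::
  "nat \<Rightarrow> (nat \<Rightarrow> nat) \<Rightarrow> (nat \<times> nat) set \<Rightarrow> nat set set \<Rightarrow> pindex mpoly \<Rightarrow> qindex mpoly set" where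
  "Phi p d E \<I> P =
     q_ideal p d E \<I> +>\<^bsub>poly_ring (U p d E \<I>)\<^esub> poly_subst Const (factorization p E Var) P"

definition factorization_ideal ::
  "nat \<Rightarrow> (nat \<Rightarrow> nat) \<Rightarrow> (nat \<times> nat) set \<Rightarrow> nat set set \<Rightarrow> pindex mpoly set" where
  "factorization_ideal p d E \<I> =
     a_kernel (poly_ring (D p d \<I>)) (poly_ring (U p d E \<I>) Quot q_ideal p d E \<I>) (Phi p d E \<I>)"

definition phi ::
  "nat \<Rightarrow> (nat \<Rightarrow> nat) \<Rightarrow> (nat \<times> nat) set \<Rightarrow> nat set set \<Rightarrow> (qindex \<Rightarrow> real) \<Rightarrow> pindex \<Rightarrow> real" where
  "phi p d E \<I> q = restrict (factorization p E q) (D p d \<I>)"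

definition image_phi ::
  "nat \<Rightarrow> (nat \<Rightarrow> nat) \<Rightarrow> (nat \<times> nat) set \<Rightarrow> nat set set \<Rightarrow> (pindex \<Rightarrow> real) set" where
  "image_phi p d E \<I> =
     phi p d E \<I> ` {q \<in> U p d E \<I> \<rightarrow>\<^sub>E {0<..}. \<forall>g\<in>q_gens p d E \<I>. eval_at q g = 0}"


section \<open>The conditional independence ideal\<close>

definition p_plus :: "nat \<Rightarrow> (nat \<Rightarrow> nat) \<Rightarrow> nat set \<Rightarrow> outcome \<Rightarrow> pindex mpoly" where
  "p_plus p d I u = (\<Sum>y\<in>extending p d u. Var (I, y))"

definition sigma_ideal :: "nat \<Rightarrow> (nat \<Rightarrow> nat) \<Rightarrow> nat set set \<Rightarrow> pindex mpoly set" where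
  "sigma_ideal p d \<I> = Idl\<^bsub>poly_ring (D p d \<I>)\<^esub> {p_plus p d I Map.empty - 1 |I. I \<in> \<I>}"

definition global_ideal ::
  "nat \<Rightarrow> (nat \<Rightarrow> nat) \<Rightarrow> (nat \<times> nat) set \<Rightarrow> nat set set \<Rightarrow> nat set \<Rightarrow> pindex mpoly set" where
  "global_ideal p d E \<I> I = Idl\<^bsub>poly_ring (D p d \<I>)\<^esub>
     {p_plus p d I (xA ++ xB ++ xC) * p_plus p d I (xA' ++ xB' ++ xC)
        - p_plus p d I (xA ++ xB' ++ xC) * p_plus p d I (xA' ++ xB ++ xC) |A B C xA xA' xB xB' xC.
      A \<subseteq> {1..p} \<and> B \<subseteq> {1..p} \<and> C \<subseteq> {1..p} \<and>
      A \<inter> B = {} \<and> A \<inter> C = {} \<and> B \<inter> C = {} \<and> A \<noteq> {} \<and> B \<noteq> {} \<and> d_separates E C A B \<and>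
      xA \<in> outcomes d A \<and> xA' \<in> outcomes d A \<and> xB \<in> outcomes d B \<and> xB' \<in> outcomes d B \<and>
      xC \<in> outcomes d C}"

definition inv_ideal ::
  "nat \<Rightarrow> (nat \<Rightarrow> nat) \<Rightarrow> (nat \<times> nat) set \<Rightarrow> nat set set \<Rightarrow> pindex mpoly set" where
  "inv_ideal p d E \<I> = Idl\<^bsub>poly_ring (D p d \<I>)\<^esub>
     {p_plus p d I (x |` A ++ x |` C) * p_plus p d {} (x |` C)
        - p_plus p d {} (x |` A ++ x |` C) * p_plus p d I (x |` C) |I A C x.
      I \<in> \<I> - {{}} \<and> A \<subseteq> {1..p} \<and> C \<subseteq> {1..p} \<and> A \<inter> C = {} \<and>
      d_separates (idag E \<I>) (Obs ` C \<union> W (\<I> - {I})) (Obs ` A) {Interv I} \<and>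
      x \<in> outcomes d {1..p}}"

definition ci_ideal ::
  "nat \<Rightarrow> (nat \<Rightarrow> nat) \<Rightarrow> (nat \<times> nat) set \<Rightarrow> nat set set \<Rightarrow> pindex mpoly set" where
  "ci_ideal p d E \<I> =
     Idl\<^bsub>poly_ring (D p d \<I>)\<^esub> (inv_ideal p d E \<I> \<union> (\<Union>I\<in>\<I>. global_ideal p d E \<I> I))"

definition bold_p ::
  "nat \<Rightarrow> (nat \<Rightarrow> nat) \<Rightarrow> nat set set \<Rightarrow> (nat \<Rightarrow> nat) \<Rightarrow> pindex mpoly" where
  "bold_p p d \<I> \<pi> = (\<Prod>I\<in>\<I>. \<Prod>x\<in>(\<Union>k\<in>{1..p}. outcomes d (\<pi> ` {1..k})). p_plus p d I x)"

end

theory Submission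
  imports Defs "HOL-Computational_Algebra.Polynomial"
begin

text \<open>
  The factorization ideal \<open>F\<close> is the kernel of a ring map into a polynomial ring: modulo
  \<open>q_ideal\<close> the indeterminates \<open>q\<close> with \<open>x = d j\<close>, and those with \<open>j \<notin> I \<noteq> {}\<close>, are polynomials
  in the others.  Hence \<open>F\<close> is prime.  It contains the conditional independence relations because
  d-separation is sound for every product of kernels, with values in any commutative ring.

  Conversely, let \<open>K\<close> be the ideal of all relations.  Among them are the independence of \<open>j\<close> from
  its non-parents before \<open>j\<close> given \<open>pa j\<close>, and the invariance of \<open>j\<close> given all of its predecessors
  when \<open>j \<notin> I\<close>.  After inverting the product \<open>bp\<close> of the prefix marginals, the quotients
  \<open>p\<^sub>z\<^sub>x / p\<^sub>z\<close>, with \<open>z\<close> an outcome of the predecessors of \<open>j\<close>, therefore depend modulo \<open>K\<close> only on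
  the restriction of \<open>z\<close> to \<open>pa j\<close>; they satisfy the relations between the \<open>q\<close>, and the product
  along \<open>\<pi>\<close> telescopes to \<open>p\<^sub>x\<close>.  So \<open>q \<mapsto> p\<^sub>z\<^sub>x / p\<^sub>z\<close> inverts the parametrization over the
  localization of \<open>K\<close> at \<open>bp\<close>, which gives \<open>F = (K : bp\<^sup>\<infinity>)\<close>; minimality of \<open>F\<close> follows as
  \<open>bp \<notin> F\<close>.  Evaluated at a positive point, the same formula shows that every positive zero of \<open>K\<close>
  is in the image of the parametrization.
\<close>

section \<open>Polynomials and their ideals\<close>

text \<open>Homogeneity decides which ideal is saturated: the conditional independence relations and
  \<open>bp\<close> are homogeneous, while the factorization ideal contains every
  \<open>p_plus p d I Map.empty - 1\<close>. No saturation of the former by \<open>bp\<close> alone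
  can produce an inhomogeneous prime, so the ideal of all relations includes
  \<open>sigma_ideal\<close>. Kernels take values in an arbitrary commutative ring because they are
  used both with polynomial values, at a generic point of the model, and with real values. Nothing
  may be divided there, so independence and invariance are proved as cross-product identities. The
  localization at \<open>bp\<close> is not constructed either. A quotient by a prefix marginal
  becomes a numerator over the common denominator \<open>bp\<close>, and \<open>1 / bp\<close> is
  the variable of a univariate polynomial whose coefficients are the polynomials in the coordinates.
  Clearing denominators leads back to powers of \<open>bp\<close>, hence to the saturation.\<close>

lemma mpoly_induct [consumes 1, case_names Const Var add mult]:
  fixes P :: "'v mpoly"
  assumes "vars P \<subseteq> V"
    and Const: "\<And>c. Q (Const c)" and Var: "\<And>v. v \<in> V \<Longrightarrow> Q (Var v)"
    and add: "\<And>P P'. vars P \<subseteq> V \<Longrightarrow> vars P' \<subseteq> V \<Longrightarrow> Q P \<Longrightarrow> Q P' \<Longrightarrow> Q (P + P')"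
    and mult: "\<And>P P'. vars P \<subseteq> V \<Longrightarrow> vars P' \<subseteq> V \<Longrightarrow> Q P \<Longrightarrow> Q P' \<Longrightarrow> Q (P * P')"
  shows "Q P"
proof -
  have vC: "vars (Const c) \<subseteq> V" for c by (simp add: vars_def Const_def)
  have vV: "v \<in> V \<Longrightarrow> vars (Var v) \<subseteq> V" for v by (simp add: vars_def Var_def)
  have vm: "vars (Poly_Mapping.single m 1 :: 'v mpoly) \<subseteq> V" if "Poly_Mapping.keys m \<subseteq> V" for m
    using that by (simp add: vars_def)
  have pow: "Q (Poly_Mapping.single (Poly_Mapping.single v n) 1) "
    if "v \<in> V" for v n
  proof (induction n)
    case 0
    show ?case using Const[of 1] by (simp add: Const_def)
  next
    case (Suc n)
    have "Q (Var v * Poly_Mapping.single (Poly_Mapping.single v n) 1)"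
      by (rule mult) (use that Suc in \<open>auto intro!: Var vV vm split: if_splits\<close>)
    then show ?case by (simp add: Var_def mult_single single_add[symmetric])
  qed
  have mon: "Q (Poly_Mapping.single m 1)" if "Poly_Mapping.keys m \<subseteq> V" for m
    using that
  proof (induction m rule: update_induct)
    case const
    show ?case using Const[of 1] by (simp add: Const_def)
  next
    case (update m v n)
    have k: "Poly_Mapping.keys (Poly_Mapping.update v n m) = insert v (Poly_Mapping.keys m)"
      using update by (simp add: keys_update)
    have "Poly_Mapping.update v n m = Poly_Mapping.single v n + m"
      using update
      by (intro poly_mapping_eqI) (auto simp: lookup_update lookup_add lookup_single when_def in_keys_iff)
    moreover have "Q (Poly_Mapping.single (Poly_Mapping.single v n) 1 * Poly_Mapping.single m 1)"
      by (rule mult) (use update k in \<open>auto intro!: pow vm split: if_splits\<close>)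
    ultimately show ?case by (simp add: mult_single)
  qed
  \<comment> \<open>Each update adds a monomial with a fresh key, so nothing cancels and both
    summands keep their indeterminates in \<open>V\<close>.\<close>
  show ?thesis using assms(1)
  proof (induction P rule: update_induct)
    case const
    show ?case using Const[of 0] by (simp add: Const_def)
  next
    case (update P m c)
    have k: "Poly_Mapping.keys (Poly_Mapping.update m c P) = insert m (Poly_Mapping.keys P)"
      using update by (simp add: keys_update)
    then have V: "vars P \<subseteq> V" "Poly_Mapping.keys m \<subseteq> V"
      using update.prems by (auto simp: vars_def)
    have "Poly_Mapping.update m c P = Const c * Poly_Mapping.single m 1 + P"
      using update
      by (intro poly_mapping_eqI)
        (auto simp: Const_def mult_single lookup_update lookup_add lookup_single when_def in_keys_iff)
    moreover have "Q (Const c * Poly_Mapping.single m 1 + P)"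
      by (rule add, rule order_trans[OF vars_times])
        (use V update.IH in \<open>auto intro!: mult mon Const vC simp: vC vm subsetD[OF vC] subsetD[OF vm]\<close>)
    ultimately show ?case by simp
  qed
qed

text \<open>Three coefficient maps occur: the identity for evaluation at real points,
  \<open>Const\<close> for substituting polynomials, and \<open>[:Const c:]\<close> for passing to
  polynomials in one more variable. Each makes \<open>poly_subst\<close> a ring
  homomorphism.\<close>

locale coeff_hom =
  fixes c :: "real \<Rightarrow> 'b::comm_ring_1"
  assumes c_0: "c 0 = 0" and c_1: "c 1 = 1"
    and c_add: "c (a + b) = c a + c b" and c_mult: "c (a * b) = c a * c b"
begin

lemma poly_subst_superset:
  assumes "finite K" "Poly_Mapping.keys P \<subseteq> K"
  shows "poly_subst c f P = (\<Sum>m\<in>K. c (Poly_Mapping.lookup P m) *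
        (\<Prod>v\<in>Poly_Mapping.keys m. f v ^ Poly_Mapping.lookup m v))"
  unfolding poly_subst_def
  by (rule sum.mono_neutral_left) (use assms in \<open>auto simp: in_keys_iff c_0\<close>)

lemma poly_subst_add: "poly_subst c f (P + Q) = poly_subst c f P + poly_subst c f Q"
proof -
  let ?K = "Poly_Mapping.keys P \<union> Poly_Mapping.keys Q"
  have "finite ?K" by simp
  from poly_subst_superset[OF this] show ?thesis
    using Poly_Mapping.keys_add[of P Q] by (simp add: lookup_add c_add algebra_simps sum.distrib)
qed

lemma poly_subst_single:
  "poly_subst c f (Poly_Mapping.single m a) =
     c a * (\<Prod>v\<in>Poly_Mapping.keys m. f v ^ Poly_Mapping.lookup m v)"
  by (simp add: poly_subst_def c_0)

lemma poly_subst_Const [simp]: "poly_subst c f (Const a) = c a"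
  by (simp add: Const_def poly_subst_single)

lemma poly_subst_0 [simp]: "poly_subst c f 0 = 0"
  by (simp add: poly_subst_def)

lemma poly_subst_1 [simp]: "poly_subst c f 1 = 1"
  using poly_subst_Const[of f 1] by (simp add: Const_def c_1)

lemma poly_subst_Var [simp]: "poly_subst c f (Var v) = f v"
  by (simp add: Var_def poly_subst_single c_1)

lemma poly_subst_single_mult_single:
  "poly_subst c f (Poly_Mapping.single m a * Poly_Mapping.single n b) =
     poly_subst c f (Poly_Mapping.single m a) * poly_subst c f (Poly_Mapping.single n b)"
proof -
  have *: "(\<Prod>v\<in>Poly_Mapping.keys m. f v ^ Poly_Mapping.lookup m v) =
    (\<Prod>v\<in>K. f v ^ Poly_Mapping.lookup m v)" if "finite K" "Poly_Mapping.keys m \<subseteq> K" for m K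
    by (rule prod.mono_neutral_left) (use that in \<open>auto simp: in_keys_iff\<close>)
  let ?K = "Poly_Mapping.keys m \<union> Poly_Mapping.keys n"
  have "finite ?K" by simp
  note K = *[OF this Un_upper1] *[OF this Un_upper2]
  have "Poly_Mapping.keys (m + n) = ?K"
    by (auto simp: in_keys_iff lookup_add)
  then show ?thesis
    by (simp add: mult_single poly_subst_single K c_mult lookup_add power_add prod.distrib
        mult_ac)
qed

lemma poly_subst_single_mult:
  "poly_subst c f (Poly_Mapping.single m a * Q) =
     poly_subst c f (Poly_Mapping.single m a) * poly_subst c f Q"
proof (induction Q rule: update_induct)
  case (update Q n b)
  have "Poly_Mapping.update n b Q = Poly_Mapping.single n b + Q"
    using update
    by (intro poly_mapping_eqI) (auto simp: lookup_update lookup_add lookup_single when_def in_keys_iff)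
  then show ?case
    by (simp add: distrib_left poly_subst_add poly_subst_single_mult_single update)
qed simp

lemma poly_subst_mult: "poly_subst c f (P * Q) = poly_subst c f P * poly_subst c f Q"
proof (induction P rule: update_induct)
  case (update P n b)
  have "Poly_Mapping.update n b P = Poly_Mapping.single n b + P"
    using update
    by (intro poly_mapping_eqI) (auto simp: lookup_update lookup_add lookup_single when_def in_keys_iff)
  then show ?case
    by (simp add: distrib_right poly_subst_add poly_subst_single_mult update)
qed simp

lemma poly_subst_uminus: "poly_subst c f (- P) = - poly_subst c f P"
  using poly_subst_add[of f P "- P"] by (simp add: add_eq_0_iff)

lemma poly_subst_diff: "poly_subst c f (P - Q) = poly_subst c f P - poly_subst c f Q"
  using poly_subst_add[of f P "- Q"] by (simp add: poly_subst_uminus)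

lemma poly_subst_sum: "poly_subst c f (\<Sum>i\<in>I. g i) = (\<Sum>i\<in>I. poly_subst c f (g i))"
  by (induction I rule: infinite_finite_induct) (simp_all add: poly_subst_add)

lemma poly_subst_prod: "poly_subst c f (\<Prod>i\<in>I. g i) = (\<Prod>i\<in>I. poly_subst c f (g i))"
  by (induction I rule: infinite_finite_induct) (simp_all add: poly_subst_mult)

lemma poly_subst_power: "poly_subst c f (P ^ n) = poly_subst c f P ^ n"
  by (induction n) (simp_all add: poly_subst_mult)

lemmas poly_subst_hom = poly_subst_add poly_subst_diff poly_subst_uminus poly_subst_mult
  poly_subst_sum poly_subst_prod poly_subst_power

end

lemma coeff_hom_id: "coeff_hom (\<lambda>c::real. c)"
  by standard auto

lemma coeff_hom_Const: "coeff_hom Const"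
  by standard (simp_all add: Const_def single_add mult_single)

lemma vars_simps [simp]:
  "vars (Const c) = {}" "vars (Var v) = {v}" "vars 0 = {}" "vars 1 = {}"
  by (simp_all add: vars_def Const_def Var_def)

lemma vars_add_subset: "vars P \<subseteq> V \<Longrightarrow> vars Q \<subseteq> V \<Longrightarrow> vars (P + Q) \<subseteq> V"
  using vars_plus[of P Q] by blast

lemma vars_mult_subset: "vars P \<subseteq> V \<Longrightarrow> vars Q \<subseteq> V \<Longrightarrow> vars (P * Q) \<subseteq> V"
  using vars_times[of P Q] by blast

lemma vars_diff_subset: "vars P \<subseteq> V \<Longrightarrow> vars Q \<subseteq> V \<Longrightarrow> vars (P - Q) \<subseteq> V"
  using vars_plus[of P "- Q"] by (auto simp: vars_uminus)

lemma vars_sum_subset: "(\<And>i. i \<in> I \<Longrightarrow> vars (g i) \<subseteq> V) \<Longrightarrow> vars (\<Sum>i\<in>I. g i) \<subseteq> V"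
  by (induction I rule: infinite_finite_induct) (auto simp: vars_add_subset)

lemma vars_prod_subset: "(\<And>i. i \<in> I \<Longrightarrow> vars (g i) \<subseteq> V) \<Longrightarrow> vars (\<Prod>i\<in>I. g i) \<subseteq> V"
  by (induction I rule: infinite_finite_induct) (auto simp: vars_mult_subset)

lemma vars_power_subset: "vars P \<subseteq> V \<Longrightarrow> vars (P ^ n) \<subseteq> V"
  by (induction n) (auto simp: vars_mult_subset)

lemmas vars_subset = vars_add_subset vars_mult_subset vars_diff_subset vars_sum_subset
  vars_prod_subset vars_power_subset

lemma poly_subst_poly_subst:
  assumes "coeff_hom c"
  shows "poly_subst c f (poly_subst Const g P) = poly_subst c (\<lambda>v. poly_subst c f (g v)) P"
proof -
  interpret c: coeff_hom c by fact
  interpret C: coeff_hom Const by (rule coeff_hom_Const)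
  have "vars P \<subseteq> UNIV" by simp
  then show ?thesis
    by (induction P rule: mpoly_induct) (simp_all add: c.poly_subst_hom C.poly_subst_hom)
qed

lemma poly_subst_cong:
  assumes "coeff_hom c" "vars P \<subseteq> V" "\<And>v. v \<in> V \<Longrightarrow> f v = g v"
  shows "poly_subst c f P = poly_subst c g P"
proof -
  interpret c: coeff_hom c by fact
  from assms(2) show ?thesis
    by (induction P rule: mpoly_induct) (simp_all add: c.poly_subst_hom assms(3))
qed

lemma poly_subst_Const_Var [simp]: "poly_subst Const Var P = P"
proof -
  interpret C: coeff_hom Const by (rule coeff_hom_Const)
  have "vars P \<subseteq> UNIV" by simp
  then show ?thesis
    by (induction P rule: mpoly_induct) (simp_all add: C.poly_subst_hom)
qed

lemma vars_poly_subst: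
  assumes "vars P \<subseteq> V" "\<And>v. v \<in> V \<Longrightarrow> vars (f v) \<subseteq> V'"
  shows "vars (poly_subst Const f P) \<subseteq> V'"
proof -
  interpret C: coeff_hom Const by (rule coeff_hom_Const)
  from assms(1) show ?thesis
    by (induction P rule: mpoly_induct)
      (simp_all add: C.poly_subst_hom assms(2) vars_add_subset vars_mult_subset)
qed

lemma finite_vars: "finite (vars P)"
  by (simp add: vars_def)

text \<open>The library proves this only for linearly ordered indeterminates; finitely many
  indeterminates can be renamed to natural numbers.\<close>

lemma mpoly_mult_eq_0_iff:
  fixes P Q :: "'v mpoly"
  shows "P * Q = 0 \<longleftrightarrow> P = 0 \<or> Q = 0"
proof
  interpret C: coeff_hom "Const :: _ \<Rightarrow> nat mpoly" by (rule coeff_hom_Const)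
  interpret C': coeff_hom "Const :: _ \<Rightarrow> 'v mpoly" by (rule coeff_hom_Const)
  assume "P * Q = 0"
  obtain f :: "'v \<Rightarrow> nat" where f: "inj_on f (vars P \<union> vars Q)"
    using finite_imp_inj_to_nat_seg[of "vars P \<union> vars Q"] finite_vars by blast
  define r :: "'v mpoly \<Rightarrow> nat mpoly" where "r = poly_subst Const (\<lambda>v. Var (f v))"
  define g where "g = inv_into (vars P \<union> vars Q) f"
  have inv: "poly_subst Const (\<lambda>n. Var (g n)) (r X) = X" if "vars X \<subseteq> vars P \<union> vars Q" for X
  proof -
    have "poly_subst Const (\<lambda>n. Var (g n)) (r X) = poly_subst Const (\<lambda>v. Var (g (f v))) X"
      by (simp add: r_def poly_subst_poly_subst[OF coeff_hom_Const])
    also have "\<dots> = poly_subst Const Var X"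
      by (rule poly_subst_cong[OF coeff_hom_Const that]) (simp add: g_def inv_into_f_f[OF f])
    finally show ?thesis by simp
  qed
  have "r P * r Q = 0"
    unfolding r_def by (simp add: C.poly_subst_mult[symmetric] \<open>P * Q = 0\<close>)
  then have "r P = 0 \<or> r Q = 0" by simp
  then show "P = 0 \<or> Q = 0"
    using inv[of P] inv[of Q] by auto
qed auto

section \<open>Ideals of the rings with a fixed set of indeterminates\<close>

lemma carrier_poly_ring [simp]: "carrier (poly_ring V) = {P. vars P \<subseteq> V}"
  and mult_poly_ring [simp]: "P \<otimes>\<^bsub>poly_ring V\<^esub> Q = P * Q"
  and add_poly_ring [simp]: "P \<oplus>\<^bsub>poly_ring V\<^esub> Q = P + Q"
  and one_poly_ring [simp]: "\<one>\<^bsub>poly_ring V\<^esub> = 1"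
  and zero_poly_ring [simp]: "\<zero>\<^bsub>poly_ring V\<^esub> = 0"
  by (simp_all add: poly_ring_def)

lemma pow_poly_ring [simp]: "P [^]\<^bsub>poly_ring V\<^esub> (n::nat) = P ^ n"
  by (induction n) (simp_all add: mult.commute)

lemma ideal_poly_ringI:
  assumes "\<And>P. P \<in> J \<Longrightarrow> vars P \<subseteq> V" "0 \<in> J" "\<And>P Q. P \<in> J \<Longrightarrow> Q \<in> J \<Longrightarrow> P + Q \<in> J"
    and mult: "\<And>P Q. P \<in> J \<Longrightarrow> vars Q \<subseteq> V \<Longrightarrow> Q * P \<in> J"
  shows "ideal J (poly_ring V)"
proof -
  interpret cring "poly_ring V" by (rule cring_poly_ring)
  show ?thesis
  proof (rule idealI)
    show "ring (poly_ring V)" by (rule ring_axioms)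
    have "inv\<^bsub>add_monoid (poly_ring V)\<^esub> a \<in> J" if a: "a \<in> J" for a
    proof -
      have "\<ominus>\<^bsub>poly_ring V\<^esub> a = - a"
        by (rule minus_equality) (use assms(1)[OF a] in \<open>auto simp: vars_uminus\<close>)
      moreover have "(- 1) * a \<in> J" by (rule mult[OF a]) (simp add: vars_uminus)
      ultimately show ?thesis by (simp add: a_inv_def)
    qed
    then show "subgroup J (add_monoid (poly_ring V))"
      by (intro group.subgroupI add.is_group) (use assms in auto)
    show "x \<otimes>\<^bsub>poly_ring V\<^esub> a \<in> J" "a \<otimes>\<^bsub>poly_ring V\<^esub> x \<in> J"
      if "a \<in> J" "x \<in> carrier (poly_ring V)" for a x
      using mult[OF that(1), of x] that(2) by (simp_all add: mult.commute)
  qed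
qed

lemma ideal_poly_ringD:
  assumes "ideal J (poly_ring V)"
  shows "P \<in> J \<Longrightarrow> vars P \<subseteq> V" "0 \<in> J" "P \<in> J \<Longrightarrow> Q \<in> J \<Longrightarrow> P + Q \<in> J"
    "P \<in> J \<Longrightarrow> vars Q \<subseteq> V \<Longrightarrow> Q * P \<in> J" "P \<in> J \<Longrightarrow> vars Q \<subseteq> V \<Longrightarrow> P * Q \<in> J"
    "P \<in> J \<Longrightarrow> - P \<in> J" "P \<in> J \<Longrightarrow> Q \<in> J \<Longrightarrow> P - Q \<in> J"
proof -
  interpret ideal J "poly_ring V" by fact
  show "P \<in> J \<Longrightarrow> vars P \<subseteq> V" using a_subset by auto
  show "0 \<in> J" using additive_subgroup.zero_closed[OF is_additive_subgroup] by simp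
  show *: "P \<in> J \<Longrightarrow> Q \<in> J \<Longrightarrow> P + Q \<in> J" for P Q
    using additive_subgroup.a_closed[OF is_additive_subgroup, of P Q] by simp
  show m: "P \<in> J \<Longrightarrow> vars Q \<subseteq> V \<Longrightarrow> Q * P \<in> J" for P Q using I_l_closed[of P Q] by simp
  show "P \<in> J \<Longrightarrow> vars Q \<subseteq> V \<Longrightarrow> P * Q \<in> J" using I_r_closed[of P Q] by simp
  show u: "P \<in> J \<Longrightarrow> - P \<in> J" for P using m[of P "- 1"] by (simp add: vars_uminus)
  show "P \<in> J \<Longrightarrow> Q \<in> J \<Longrightarrow> P - Q \<in> J" using *[of P "- Q"] u[of Q] by simp
qed

lemma genideal_poly_ring:
  assumes "\<And>P. P \<in> X \<Longrightarrow> vars P \<subseteq> V"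
  shows "ideal (Idl\<^bsub>poly_ring V\<^esub> X) (poly_ring V)" "X \<subseteq> Idl\<^bsub>poly_ring V\<^esub> X"
    "ideal J (poly_ring V) \<Longrightarrow> X \<subseteq> J \<Longrightarrow> Idl\<^bsub>poly_ring V\<^esub> X \<subseteq> J"
proof -
  interpret cring "poly_ring V" by (rule cring_poly_ring)
  have X: "X \<subseteq> carrier (poly_ring V)" using assms by auto
  show "ideal (Idl\<^bsub>poly_ring V\<^esub> X) (poly_ring V)" by (rule genideal_ideal[OF X])
  show "X \<subseteq> Idl\<^bsub>poly_ring V\<^esub> X" by (rule genideal_self[OF X])
  show "ideal J (poly_ring V) \<Longrightarrow> X \<subseteq> J \<Longrightarrow> Idl\<^bsub>poly_ring V\<^esub> X \<subseteq> J" by (rule genideal_minimal)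
qed

lemma ideal_poly_subst_kernel:
  assumes "coeff_hom c"
  shows "ideal {P. vars P \<subseteq> V \<and> poly_subst c f P = 0} (poly_ring V)"
proof -
  interpret c: coeff_hom c by fact
  show ?thesis by (rule ideal_poly_ringI) (auto simp: c.poly_subst_hom vars_subset)
qed

lemma ideal_poly_ring_sum:
  assumes "ideal J (poly_ring V)" "\<And>i. i \<in> S \<Longrightarrow> f i \<in> J"
  shows "sum f S \<in> J"
  using assms(2)
  by (induction S rule: infinite_finite_induct) (simp_all add: ideal_poly_ringD(2,3)[OF assms(1)])

lemma ideal_poly_ring_prod_cong:
  assumes J: "ideal J (poly_ring V)"
    and f: "\<And>i. i \<in> S \<Longrightarrow> vars (f i) \<subseteq> V" and g: "\<And>i. i \<in> S \<Longrightarrow> vars (g i) \<subseteq> V"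
    and fg: "\<And>i. i \<in> S \<Longrightarrow> f i - g i \<in> J"
  shows "prod f S - prod g S \<in> J"
  using f g fg
proof (induction S rule: infinite_finite_induct)
  case (insert x F)
  have "(f x - g x) * prod f F + g x * (prod f F - prod g F) \<in> J"
    by (intro ideal_poly_ringD(3-5)[OF J] vars_prod_subset) (use insert in auto)
  then show ?case using insert(1,2) by (simp add: algebra_simps)
qed (simp_all add: ideal_poly_ringD(2)[OF J])

lemma coeff_hom_poly_Const: "coeff_hom (\<lambda>c. [:Const c:])"
  by standard (simp_all add: coeff_hom.c_0[OF coeff_hom_Const] coeff_hom.c_1[OF coeff_hom_Const]
      coeff_hom.c_add[OF coeff_hom_Const] coeff_hom.c_mult[OF coeff_hom_Const] one_pCons)

lemma sum_linear_poly: "(\<Sum>x\<in>A. [:0, f x:]) = [:0, \<Sum>x\<in>A. f x:]"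
  by (induction A rule: infinite_finite_induct) simp_all

text \<open>The variable will stand for \<open>1 / bp\<close>, so the degree counts how many
  denominators a product of quotients carries.\<close>

lemma prod_linear_poly:
  "finite A \<Longrightarrow> (\<Prod>x\<in>A. [:0, f x:]) = monom (\<Prod>x\<in>A. f x) (card A)"
  for f :: "'a \<Rightarrow> 'b::comm_ring_1"
proof (induction A rule: finite_induct)
  case (insert x F)
  have "[:0, f x:] = monom (f x) 1" by (simp add: monom_Suc monom_0)
  then show ?case using insert by (simp add: mult_monom)
qed simp

section \<open>Soundness of d-separation\<close>

definition ancestors :: "('v \<times> 'v) set \<Rightarrow> 'v set \<Rightarrow> 'v set" where
  "ancestors E C = {v. \<exists>c\<in>C. (v, c) \<in> E\<^sup>*}"

lemma ancestors_self: "v \<in> C \<Longrightarrow> v \<in> ancestors E C"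
  by (auto simp: ancestors_def)

lemma ancestors_step: "(u, v) \<in> E \<Longrightarrow> v \<in> ancestors E C \<Longrightarrow> u \<in> ancestors E C"
  by (auto simp: ancestors_def intro: converse_rtrancl_into_rtrancl)

text \<open>Reachability from \<open>A\<close> along walks that are open given \<open>C\<close>.  The flag records
  whether the walk enters its last node along an edge pointing into it.\<close>

inductive bayes_ball :: "('v \<times> 'v) set \<Rightarrow> 'v set \<Rightarrow> 'v set \<Rightarrow> 'v \<Rightarrow> bool \<Rightarrow> bool"
  for E C A where
  start: "a \<in> A \<Longrightarrow> bayes_ball E C A a False"
| down: "bayes_ball E C A v b \<Longrightarrow> v \<notin> C \<Longrightarrow> (v, w) \<in> E \<Longrightarrow> bayes_ball E C A w True"
| up: "bayes_ball E C A v False \<Longrightarrow> v \<notin> C \<Longrightarrow> (u, v) \<in> E \<Longrightarrow> bayes_ball E C A u False"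
| bounce: "bayes_ball E C A v True \<Longrightarrow> v \<in> ancestors E C \<Longrightarrow> (u, v) \<in> E \<Longrightarrow> bayes_ball E C A u False"

lemma acyclic_asym: "acyclic E \<Longrightarrow> (u, v) \<in> E \<Longrightarrow> (v, u) \<notin> E"
  by (meson acyclic_def trancl.simps)

text \<open>The counterpart for paths of the flag of \<open>bayes_ball\<close>; a path with a single
  node does not enter it.\<close>

definition enters :: "('v \<times> 'v) set \<Rightarrow> 'v list \<Rightarrow> bool" where
  "enters E vs \<longleftrightarrow> (\<exists>n. length vs = Suc (Suc n) \<and> (vs ! n, vs ! Suc n) \<in> E)"

lemma is_path_append:
  assumes "is_path E vs" "w \<notin> set vs" "(last vs, w) \<in> E \<union> E\<inverse>"
  shows "is_path E (vs @ [w])"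
  using assms unfolding is_path_def
  by (auto simp: nth_append last_conv_nth less_Suc_eq) (metis One_nat_def diff_Suc_1)+

lemma is_path_take:
  assumes "is_path E vs" "0 < k"
  shows "is_path E (take k vs)"
  using assms unfolding is_path_def by auto

lemma not_blocked_take: "\<not> blocked E C vs \<Longrightarrow> \<not> blocked E C (take k vs)"
  unfolding blocked_def by auto

text \<open>The only new inner node is the old end of the path. Since \<open>E\<close> is
  asymmetric, it is a collider exactly when the path enters it and \<open>w\<close> is its parent;
  \<open>down\<close> and \<open>up\<close> are the opening conditions for the two
  directions.\<close>

lemma not_blocked_append:
  assumes "\<not> blocked E C vs" "acyclic E" "vs \<noteq> []"
    and path: "(last vs, w) \<in> E \<union> E\<inverse>"
    and down: "(last vs, w) \<in> E \<Longrightarrow> last vs \<notin> C"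
    and up: "(w, last vs) \<in> E \<Longrightarrow> if enters E vs then last vs \<in> ancestors E C else last vs \<notin> C"
  shows "\<not> blocked E C (vs @ [w])"
proof
  assume "blocked E C (vs @ [w])"
  then obtain i where i: "Suc (Suc i) < length (vs @ [w])" and
    b: "if ((vs @ [w]) ! i, (vs @ [w]) ! Suc i) \<in> E \<and> ((vs @ [w]) ! Suc (Suc i), (vs @ [w]) ! Suc i) \<in> E
      then \<forall>c\<in>C. ((vs @ [w]) ! Suc i, c) \<notin> E\<^sup>* else (vs @ [w]) ! Suc i \<in> C"
    unfolding blocked_def by blast
  show False
  proof (cases "Suc (Suc i) < length vs")
    case True
    then have "blocked E C vs"
      unfolding blocked_def using b by (intro exI[of _ i]) (auto simp: nth_append)
    with assms(1) show False by contradiction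
  next
    case False
    with i have l: "length vs = Suc (Suc i)" by simp
    then have lst: "last vs = vs ! Suc i" by (simp add: last_conv_nth assms(3))
    have en: "enters E vs \<longleftrightarrow> (vs ! i, vs ! Suc i) \<in> E"
      using l by (auto simp: enters_def)
    from b l have b': "if (vs ! i, vs ! Suc i) \<in> E \<and> (w, vs ! Suc i) \<in> E
      then \<forall>c\<in>C. (vs ! Suc i, c) \<notin> E\<^sup>* else vs ! Suc i \<in> C"
      by (simp add: nth_append cong: if_cong)
    show False
      using b' down up path en acyclic_asym[OF assms(2)]
      by (auto simp: lst ancestors_def split: if_splits)
  qed
qed

text \<open>A walk may revisit nodes while a path may not, so the path follows the walk and is cut
  back whenever the next node already lies on it. Afterwards its last arrow may differ from that of
  the walk. The last two conjuncts provide what the next step then needs: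
  \<open>v \<notin> C\<close> if only the walk enters \<open>v\<close>, and an ancestor of
  \<open>C\<close> if only the path does.\<close>

lemma bayes_ball_imp_path:
  assumes "bayes_ball E C A v b" and acyc: "acyclic E" and AC: "A \<inter> C = {}"
  shows "\<exists>vs. is_path E vs \<and> hd vs \<in> A \<and> last vs = v \<and> \<not> blocked E C vs \<and>
    (b \<and> \<not> enters E vs \<longrightarrow> v \<notin> C) \<and> (\<not> b \<and> enters E vs \<longrightarrow> v \<in> ancestors E C)"
  (is "\<exists>vs. ?Q vs v b")
proof -
  have step: "\<exists>ws. ?Q ws w (\<not> up)"
    if vs: "is_path E vs" "hd vs \<in> A" "last vs = v" "\<not> blocked E C vs"
      and down: "\<not> up \<Longrightarrow> (v, w) \<in> E \<and> v \<notin> C"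
      and up: "up \<Longrightarrow> (w, v) \<in> E \<and> (if enters E vs then v \<in> ancestors E C else v \<notin> C)"
    for vs v w up
  proof (cases "w \<in> set vs")
    case False
    have ne: "vs \<noteq> []" using vs(1) by (simp add: is_path_def)
    have adj: "(last vs, w) \<in> E \<union> E\<inverse>"
      using vs(3) down up by blast
    have "is_path E (vs @ [w])"
      by (rule is_path_append) (use vs(1) False adj in auto)
    moreover have "\<not> blocked E C (vs @ [w])"
      using not_blocked_append[OF vs(4) acyc ne adj] down up acyclic_asym[OF acyc] vs(3) by blast
    moreover have "enters E (vs @ [w]) \<longleftrightarrow> \<not> up"
    proof -
      obtain n where n: "length vs = Suc n" using ne by (cases vs) auto
      then have "vs ! n = v" using vs(3) ne by (simp add: last_conv_nth)
      then have "enters E (vs @ [w]) \<longleftrightarrow> (v, w) \<in> E"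
        using n by (auto simp: enters_def nth_append)
      then show ?thesis using down up acyclic_asym[OF acyc] by blast
    qed
    ultimately show ?thesis
      using vs(2) ne by (intro exI[of _ "vs @ [w]"]) simp
  next
    case True
    then obtain k where k: "k < length vs" "vs ! k = w" by (auto simp: in_set_conv_nth)
    define n where "n = length vs - 1"
    have ne: "vs \<noteq> []" using vs(1) by (simp add: is_path_def)
    have n: "length vs = Suc n" "vs ! n = v"
      using vs(3) ne by (simp_all add: n_def last_conv_nth)
    have "v \<noteq> w" using down up acyclic_asym[OF acyc] by blast
    then have kn: "k < n" using k n by (metis less_antisym)
    have edge: "(vs ! i, vs ! Suc i) \<in> E \<union> E\<inverse>" if "i < n" for i
      using vs(1) that n by (simp add: is_path_def)
    define ws where "ws = take (Suc k) vs"
    have lw: "length ws = Suc k" using k by (simp add: ws_def)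
    have en: "enters E ws \<longleftrightarrow> (\<exists>m. k = Suc m \<and> (vs ! m, w) \<in> E)"
      using lw k by (auto simp: enters_def ws_def)
    \<comment> \<open>Either \<open>w\<close> is the start, in \<open>A\<close> and so outside
      \<open>C\<close>, or it is an inner non-collider of an open path.\<close>
    have 1: "w \<notin> C" if "\<not> enters E ws"
    proof (cases k)
      case 0
      then have "w = hd vs" using k ne by (simp add: hd_conv_nth)
      then show ?thesis using vs(2) AC by auto
    next
      case (Suc m)
      with that en have "(vs ! m, vs ! Suc m) \<notin> E" using k by auto
      then show ?thesis using vs(4) kn n Suc k unfolding blocked_def by fastforce
    qed
    \<comment> \<open>Otherwise \<open>w\<close> is no collider of the open path, which therefore
      leaves \<open>w\<close> downwards. Descendants of \<open>w\<close> are no ancestors of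
      \<open>C\<close> either, so no later node is a collider and all arrows point on to
      \<open>v\<close>. The path then enters \<open>v\<close> outside the ancestors of
      \<open>C\<close>, which contradicts \<open>up\<close>.\<close>
    have 2: "w \<in> ancestors E C" if u: "up" and "enters E ws"
    proof (rule ccontr)
      assume nan: "w \<notin> ancestors E C"
      from that en obtain m where m: "k = Suc m" "(vs ! m, w) \<in> E" by blast
      have fwd: "(vs ! (k + i), vs ! Suc (k + i)) \<in> E \<and> vs ! Suc (k + i) \<notin> ancestors E C \<and>
          (w, vs ! Suc (k + i)) \<in> E\<^sup>*" if "k + i < n" for i
        using that
      proof (induction i)
        case 0
        have "(vs ! Suc k, w) \<notin> E"
        proof
          assume "(vs ! Suc k, w) \<in> E"
          then have "\<exists>c\<in>C. (w, c) \<in> E\<^sup>*"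
            using vs(4) kn n m k unfolding blocked_def by fastforce
          then show False using nan by (auto simp: ancestors_def)
        qed
        then have e: "(w, vs ! Suc k) \<in> E" using edge[OF kn] k by auto
        then show ?case using k nan by (auto simp: ancestors_def dest: r_into_rtrancl intro: rtrancl_trans)
      next
        case (Suc i)
        then have IH: "(vs ! (k + i), vs ! Suc (k + i)) \<in> E" "vs ! Suc (k + i) \<notin> ancestors E C"
          "(w, vs ! Suc (k + i)) \<in> E\<^sup>*" by auto
        have "(vs ! Suc (Suc (k + i)), vs ! Suc (k + i)) \<notin> E"
        proof
          assume "(vs ! Suc (Suc (k + i)), vs ! Suc (k + i)) \<in> E"
          then have "\<exists>c\<in>C. (vs ! Suc (k + i), c) \<in> E\<^sup>*"
            using vs(4) Suc.prems n IH(1) unfolding blocked_def by fastforce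
          then show False using IH(2) by (auto simp: ancestors_def)
        qed
        then have e: "(vs ! Suc (k + i), vs ! Suc (Suc (k + i))) \<in> E"
          using edge[of "Suc (k + i)"] Suc.prems by auto
        with IH(3) have "(w, vs ! Suc (Suc (k + i))) \<in> E\<^sup>*" by (rule rtrancl_into_rtrancl)
        with e nan show ?case by (auto simp: ancestors_def intro: rtrancl_trans)
      qed
      have "(vs ! (n - 1), v) \<in> E" "v \<notin> ancestors E C"
        using fwd[of "n - 1 - k"] kn n by auto
      moreover have "enters E vs"
        unfolding enters_def using n kn \<open>(vs ! (n - 1), v) \<in> E\<close>
        by (intro exI[of _ "n - 1"]) auto
      ultimately show False using up[OF u] by simp
    qed
    have "is_path E ws" "\<not> blocked E C ws" "hd ws = hd vs" "last ws = w"
      using vs k ne lw by (auto simp: ws_def is_path_take not_blocked_take hd_conv_nth last_conv_nth min_def)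
    then show ?thesis using 1 2 vs(2) by (intro exI[of _ ws]) auto
  qed
  from assms(1) show ?thesis
  proof induction
    case (start a)
    then show ?case using AC
      by (intro exI[of _ "[a]"]) (auto simp: is_path_def blocked_def enters_def)
  next
    case (down v b w)
    then obtain vs where "?Q vs v b" by blast
    then show ?case using step[of vs v False w] down by auto
  next
    case (up v u)
    then obtain vs where "?Q vs v False" by blast
    then show ?case using step[of vs v True u] up by auto
  next
    case (bounce v u)
    then obtain vs where "?Q vs v True" by blast
    then show ?case using step[of vs v True u] bounce by auto
  qed
qed

text \<open>This is soundness of d-separation without probabilities: a product of functions of the
  families \<open>insert j (parents E j)\<close> splits into a function on \<open>S \<union> C\<close> and one on the complement of \<open>S\<close>.\<close>

lemma d_separates_partition:
  assumes sep: "d_separates E C A B" and acyc: "acyclic E"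
    and AC: "A \<inter> C = {}" and BC: "B \<inter> C = {}"
  obtains S where "A \<subseteq> S" "S \<inter> B = {}" "S \<inter> C = {}"
    "\<And>j. j \<in> ancestors E (A \<union> B \<union> C) \<Longrightarrow>
       insert j (parents E j) \<subseteq> S \<union> C \<or> insert j (parents E j) \<inter> S = {}"
proof -
  define S where "S = {v. v \<notin> C \<and> (\<exists>b. bayes_ball E C A v b)}"
  have S: "v \<in> S" if "bayes_ball E C A v b" "v \<notin> C" for v b
    using that by (auto simp: S_def)
  have noB: "\<not> bayes_ball E C A v b" if "v \<in> B" for v b
    using bayes_ball_imp_path[OF _ acyc AC, of v b] sep that by (auto simp: d_separates_def)
  have up: "u \<in> S" if jN: "j \<in> ancestors E (A \<union> B \<union> C)" and jS: "j \<in> S" and u: "(u, j) \<in> E" "u \<notin> C"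
    for j u
  proof -
    from jS obtain b where b: "bayes_ball E C A j b" "j \<notin> C" by (auto simp: S_def)
    show ?thesis
    proof (cases "b = False \<or> j \<in> ancestors E C")
      case True
      then have "bayes_ball E C A u False"
        using b u by (cases b) (auto intro: bayes_ball.up bayes_ball.bounce)
      then show ?thesis using S u by blast
    next
      case False
      then have b: "bayes_ball E C A j True" "j \<notin> ancestors E C" "j \<notin> C" using b by auto
      from jN this(2) obtain t where t: "t \<in> A \<union> B" "(j, t) \<in> E\<^sup>*"
        by (auto simp: ancestors_def)
      \<comment> \<open>The walk can run down from \<open>j\<close> to \<open>t\<close>, since no
        node below \<open>j\<close> lies in \<open>C\<close>. As \<open>B\<close> is unreachable,
        \<open>t\<close> lies in \<open>A\<close>; a new walk starting at \<open>t\<close> climbs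
        back to \<open>j\<close> and arrives with flag \<open>False\<close>, so it may continue
        upwards to \<open>u\<close>.\<close>
      have "bayes_ball E C A t True \<or> t = j"
        using t(2)
      proof (induction rule: rtrancl_induct)
        case (step y z)
        then have "y \<notin> C" using b(2) by (auto simp: ancestors_def)
        then show ?case using step b(1) by (auto intro: bayes_ball.down)
      qed simp
      then have "t \<in> A" using t(1) noB b(1) by auto
      from t(2) b(2) have "bayes_ball E C A j False"
      proof (induction rule: converse_rtrancl_induct)
        case base
        show ?case using \<open>t \<in> A\<close> by (rule bayes_ball.start)
      next
        case (step y z)
        then have "z \<notin> ancestors E C" using ancestors_step by metis
        then show ?case using step ancestors_self by (metis bayes_ball.up)
      qed
      then have "bayes_ball E C A u False" using b u by (auto intro: bayes_ball.up)
      then show ?thesis using S u by blast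
    qed
  qed
  show ?thesis
  proof (rule that)
    show "A \<subseteq> S" using AC by (auto simp: S_def intro: bayes_ball.start)
    show "S \<inter> B = {}" using noB by (auto simp: S_def)
    show "S \<inter> C = {}" by (auto simp: S_def)
  next
    fix j assume jN: "j \<in> ancestors E (A \<union> B \<union> C)"
    show "insert j (parents E j) \<subseteq> S \<union> C \<or> insert j (parents E j) \<inter> S = {}"
    proof (rule disjCI)
      assume "insert j (parents E j) \<inter> S \<noteq> {}"
      then obtain x where x: "x \<in> S" "x = j \<or> (x, j) \<in> E" by (auto simp: parents_def)
      show "insert j (parents E j) \<subseteq> S \<union> C"
      proof (cases "j \<in> C")
        case False
        have "j \<in> S"
          using x False by (auto simp: S_def intro: bayes_ball.down)
        then show ?thesis using up[OF jN] by (auto simp: parents_def)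
      next
        \<comment> \<open>Here \<open>j\<close> is reached from its parent \<open>x\<close> and is a
          collider in \<open>C\<close>, so the walk bounces to every other parent of
          \<open>j\<close>.\<close>
        case True
        then have "(x, j) \<in> E" using x by (auto simp: S_def)
        then have "bayes_ball E C A j True" using x by (auto simp: S_def intro: bayes_ball.down)
        then have "bayes_ball E C A u False" if "(u, j) \<in> E" for u
          using that True by (auto intro: bayes_ball.bounce ancestors_self)
        then show ?thesis using True by (auto simp: parents_def S_def)
      qed
    qed
  qed
qed

text \<open>The parents of \<open>j\<close> are non-colliders on any path that starts at \<open>j\<close>, and such a path
  leaving \<open>j\<close> downwards stays below \<open>j\<close> until it meets a collider.\<close>

lemma d_separates_parents:
  assumes acyc: "acyclic E" and pa: "parents E j \<subseteq> C" "parents E j \<inter> B = {}"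
    and desc: "\<And>v. (j, v) \<in> E\<^sup>* \<Longrightarrow> v \<notin> C \<and> v \<notin> B"
  shows "d_separates E C {j} B"
  unfolding d_separates_def
proof (intro allI impI, elim conjE)
  fix vs assume vs: "is_path E vs" "hd vs \<in> {j}" "last vs \<in> B"
  show "blocked E C vs"
  proof (rule ccontr)
    assume nb: "\<not> blocked E C vs"
    define n where "n = length vs - 1"
    have ne: "vs \<noteq> []" using vs(1) by (simp add: is_path_def)
    have n: "length vs = Suc n" "vs ! n \<in> B" "vs ! 0 = j"
      using vs(2,3) ne by (simp_all add: n_def last_conv_nth hd_conv_nth)
    have edge: "(vs ! i, vs ! Suc i) \<in> E \<union> E\<inverse>" if "i < n" for i
      using vs(1) that n by (simp add: is_path_def)
    have "j \<notin> B" using desc by blast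
    then have "0 < n" using n by (metis gr0I)
    have "(vs ! 1, j) \<notin> E"
    proof
      assume e: "(vs ! 1, j) \<in> E"
      then have "vs ! 1 \<in> C" "vs ! 1 \<notin> B" using pa by (auto simp: parents_def)
      moreover from this have "1 < n" using n \<open>0 < n\<close> by (metis One_nat_def Suc_lessI)
      moreover have "(vs ! 0, vs ! 1) \<notin> E" using e n acyclic_asym[OF acyc] by auto
      ultimately show False using nb n unfolding blocked_def by fastforce
    qed
    have "(vs ! i, vs ! Suc i) \<in> E \<and> (j, vs ! Suc i) \<in> E\<^sup>*" if "i < n" for i
      using that
    proof (induction i)
      case 0
      then show ?case using edge[of 0] \<open>(vs ! 1, j) \<notin> E\<close> n by auto
    next
      case (Suc i)
      then have IH: "(vs ! i, vs ! Suc i) \<in> E" "(j, vs ! Suc i) \<in> E\<^sup>*" by auto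
      have "(vs ! Suc (Suc i), vs ! Suc i) \<notin> E"
      proof
        assume "(vs ! Suc (Suc i), vs ! Suc i) \<in> E"
        then have "\<exists>c\<in>C. (vs ! Suc i, c) \<in> E\<^sup>*"
          using nb IH(1) Suc.prems n unfolding blocked_def by fastforce
        then show False using IH(2) desc by (meson rtrancl_trans)
      qed
      then have "(vs ! Suc i, vs ! Suc (Suc i)) \<in> E" using edge[of "Suc i"] Suc.prems by auto
      with IH(2) show ?case by (auto intro: rtrancl_into_rtrancl)
    qed
    from this[of "n - 1"] have "(j, vs ! n) \<in> E\<^sup>*" using \<open>0 < n\<close> by simp
    then show False using desc n(2) by blast
  qed
qed

section \<open>Products of kernels\<close>

text \<open>Partial sums also run over outcomes of ancestral sets, hence the variable set of
  coordinates.\<close>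

definition exts :: "(nat \<Rightarrow> nat) \<Rightarrow> nat set \<Rightarrow> outcome \<Rightarrow> outcome set" where
  "exts d S u = {y \<in> outcomes d S. y |` dom u = u}"

lemma extending_eq_exts: "extending p d u = exts d {1..p} u"
  by (simp add: extending_def exts_def)

lemma outcomesD:
  assumes "x \<in> outcomes d S"
  shows "dom x = S" "i \<in> S \<Longrightarrow> the (x i) \<in> {1..d i}"
  using assms by (auto simp: outcomes_def)

lemma finite_outcomes:
  assumes "finite S"
  shows "finite (outcomes d S)"
proof (rule finite_subset)
  show "outcomes d S \<subseteq> {m. dom m = S \<and> ran m \<subseteq> (\<Union>i\<in>S. {1..d i})}"
    by (force simp: outcomes_def ran_def dom_def)
  show "finite {m. dom m = S \<and> ran m \<subseteq> (\<Union>i\<in>S. {1..d i})}"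
    by (rule finite_set_of_finite_maps) (use assms in auto)
qed

lemma finite_exts: "finite S \<Longrightarrow> finite (exts d S u)"
  by (simp add: exts_def finite_outcomes)

lemma outcomes_restrict: "x \<in> outcomes d S \<Longrightarrow> T \<subseteq> S \<Longrightarrow> x |` T \<in> outcomes d T"
  by (auto simp: outcomes_def)

lemma outcomes_add:
  "x \<in> outcomes d S \<Longrightarrow> y \<in> outcomes d T \<Longrightarrow> x ++ y \<in> outcomes d (S \<union> T)"
  by (force simp: outcomes_def map_add_def dom_def split: option.splits)

lemma outcomes_upd:
  "x \<in> outcomes d S \<Longrightarrow> k \<in> {1..d i} \<Longrightarrow> x(i \<mapsto> k) \<in> outcomes d (insert i S)"
  by (auto simp: outcomes_def)

lemma outcomes_empty [simp]: "outcomes d {} = {Map.empty}"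
  by (auto simp: outcomes_def)

lemma outcomes_nonempty:
  assumes "\<And>i. i \<in> S \<Longrightarrow> 1 \<le> d i"
  shows "(\<lambda>i. if i \<in> S then Some 1 else None) \<in> outcomes d S"
  using assms by (auto simp: outcomes_def dom_def)

lemma restrict_dom_self: "dom x \<subseteq> S \<Longrightarrow> x |` S = x"
  by (rule ext) (metis domIff restrict_map_def subset_iff)

lemma exts_self: "u \<in> outcomes d S \<Longrightarrow> exts d S u = {u}"
  by (auto simp: exts_def outcomesD restrict_dom_self dest: outcomesD(1))

lemma extsD:
  assumes "z \<in> exts d N u"
  shows "z \<in> outcomes d N" "dom z = N" "z |` dom u = u"
  using assms outcomesD(1)[of z d N] by (simp_all add: exts_def)

lemma sum_exts_split:
  assumes "finite S" "N \<subseteq> S" "dom u \<subseteq> N"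
  shows "sum f (exts d S u) = (\<Sum>z\<in>exts d N u. sum f (exts d S z))"
proof -
  have "sum f (exts d S u) = (\<Sum>z\<in>exts d N u. sum f {y \<in> exts d S u. y |` N = z})"
  proof (rule sum.group[symmetric])
    show "finite (exts d S u)" "finite (exts d N u)"
      using assms by (auto simp: finite_exts finite_subset)
    show "(\<lambda>y. y |` N) ` exts d S u \<subseteq> exts d N u"
      using assms by (auto simp: exts_def outcomes_restrict Int_absorb1)
  qed
  also have "\<dots> = (\<Sum>z\<in>exts d N u. sum f (exts d S z))"
  proof (rule sum.cong[OF refl], rule arg_cong[where f = "sum f"])
    fix z assume z: "z \<in> exts d N u"
    then have zN: "dom z = N" "z |` dom u = u" by (rule extsD)+
    have "y |` dom u = u" if "y |` N = z" for y
      using zN(2) assms(3) by (simp add: that[symmetric] Int_absorb1)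
    then show "{y \<in> exts d S u. y |` N = z} = exts d S z"
      by (auto simp: exts_def zN(1))
  qed
  finally show ?thesis .
qed

lemma exts_insert:
  assumes "u \<in> outcomes d N" "i \<notin> N"
  shows "exts d (insert i N) u = (\<lambda>k. u(i \<mapsto> k)) ` {1..d i}"
proof (intro equalityI subsetI)
  fix y assume y: "y \<in> exts d (insert i N) u"
  have du: "dom u = N" using assms(1) by (rule outcomesD)
  have "y = u(i \<mapsto> the (y i))"
  proof
    fix j
    from extsD[OF y] have "dom y = insert i N" "y |` N = u" by (simp_all add: du)
    then show "y j = (u(i \<mapsto> the (y i))) j"
      by (cases "j \<in> N"; cases "y j") (auto simp: restrict_map_def domIff)
  qed
  moreover have "the (y i) \<in> {1..d i}" using y by (auto simp: exts_def outcomes_def)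
  ultimately show "y \<in> (\<lambda>k. u(i \<mapsto> k)) ` {1..d i}" by blast
next
  fix y assume "y \<in> (\<lambda>k. u(i \<mapsto> k)) ` {1..d i}"
  then obtain k where k: "k \<in> {1..d i}" "y = u(i \<mapsto> k)" by blast
  have "y |` N = u"
    using assms by (auto simp: k(2) restrict_dom_self dest: outcomesD)
  then show "y \<in> exts d (insert i N) u"
    using assms(1) k outcomes_upd[OF assms(1) k(1)] by (auto simp: exts_def outcomesD)
qed

lemma sum_exts_insert:
  assumes "u \<in> outcomes d N" "i \<notin> N"
  shows "sum f (exts d (insert i N) u) = (\<Sum>k\<in>{1..d i}. f (u(i \<mapsto> k)))"
proof -
  have "inj_on (\<lambda>k. u(i \<mapsto> k)) {1..d i}"
    by (rule inj_onI) (metis fun_upd_same option.inject)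
  then show ?thesis
    by (simp add: exts_insert[OF assms] sum.reindex)
qed

text \<open>Since \<open>C \<subseteq> T\<close>, the outcome \<open>u\<close> fixes every summation
  variable on \<open>C\<close>. A pair of restrictions to \<open>A \<union> C\<close> and
  \<open>B \<union> C\<close> therefore agrees on the overlap and glues to exactly one outcome, and
  the sum becomes a sum over a product set.\<close>

lemma sum_exts_factor:
  fixes g h :: "outcome \<Rightarrow> 'b::comm_ring_1"
  assumes fin: "finite (A \<union> B \<union> C)" and disj: "A \<inter> B = {}" "A \<inter> C = {}" "B \<inter> C = {}"
    and u: "u \<in> outcomes d T" "C \<subseteq> T" "T \<subseteq> A \<union> B \<union> C"
    and g: "\<And>y. g y = g (y |` (A \<union> C))" and h: "\<And>y. h y = h (y |` (B \<union> C))"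
  shows "(\<Sum>y\<in>exts d (A \<union> B \<union> C) u. g y * h y) =
    (\<Sum>y\<in>exts d (A \<union> C) (u |` (A \<union> C)). g y) * (\<Sum>y\<in>exts d (B \<union> C) (u |` (B \<union> C)). h y)"
proof -
  let ?N = "A \<union> B \<union> C" and ?X = "exts d (A \<union> C) (u |` (A \<union> C))"
    and ?Y = "exts d (B \<union> C) (u |` (B \<union> C))"
  have du: "dom u = T" using u(1) by (rule outcomesD)
  have "(\<Sum>y\<in>?X. g y) * (\<Sum>y\<in>?Y. h y) = (\<Sum>(a, b)\<in>?X \<times> ?Y. g a * h b)"
    by (simp add: sum_product sum.cartesian_product)
  also have "\<dots> = (\<Sum>y\<in>exts d ?N u. g y * h y)"
  proof (rule sum.reindex_bij_witness[of _ "\<lambda>y. (y |` (A \<union> C), y |` (B \<union> C))" "\<lambda>(a, b). a ++ b"])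
    fix y assume y: "y \<in> exts d ?N u"
    from extsD[OF this] have yd: "dom y = ?N" "y |` T = u" "y \<in> outcomes d ?N" by (simp_all add: du)
    show "(case (y |` (A \<union> C), y |` (B \<union> C)) of (a, b) \<Rightarrow> a ++ b) = y"
      using yd(1) by (auto simp: fun_eq_iff map_add_def restrict_map_def domIff split: option.splits)
    have "y |` (A \<union> C) |` dom (u |` (A \<union> C)) = u |` (A \<union> C)"
      "y |` (B \<union> C) |` dom (u |` (B \<union> C)) = u |` (B \<union> C)"
      unfolding yd(2)[symmetric] by (auto simp: fun_eq_iff restrict_map_def)
    then show "(y |` (A \<union> C), y |` (B \<union> C)) \<in> ?X \<times> ?Y"
      using yd(3) by (auto simp: exts_def intro!: outcomes_restrict)
  next
    fix ab assume ab: "ab \<in> ?X \<times> ?Y"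
    then obtain a b where ab': "ab = (a, b)" "a \<in> ?X" "b \<in> ?Y" by auto
    have a: "dom a = A \<union> C" "a |` (T \<inter> (A \<union> C)) = u |` (A \<union> C)" "a \<in> outcomes d (A \<union> C)"
      and b: "dom b = B \<union> C" "b |` (T \<inter> (B \<union> C)) = u |` (B \<union> C)" "b \<in> outcomes d (B \<union> C)"
      using extsD[OF ab'(2)] extsD[OF ab'(3)] by (simp_all add: du)
    have au: "a i = u i" if "i \<in> T" "i \<in> A \<union> C" for i
      using fun_cong[OF a(2), of i] that by (auto simp: restrict_map_def split: if_splits)
    have bu: "b i = u i" if "i \<in> T" "i \<in> B \<union> C" for i
      using fun_cong[OF b(2), of i] that by (auto simp: restrict_map_def split: if_splits)
    have ra: "(a ++ b) |` (A \<union> C) = a"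
    proof
      fix i show "((a ++ b) |` (A \<union> C)) i = a i"
        using a(1) b(1) au[of i] bu[of i] disj u(2)
        by (cases "i \<in> A"; cases "i \<in> C") (auto simp: restrict_map_def map_add_def domIff split: option.splits)
    qed
    have rb: "(a ++ b) |` (B \<union> C) = b"
    proof
      fix i show "((a ++ b) |` (B \<union> C)) i = b i"
        using a(1) b(1) disj
        by (cases "i \<in> B \<union> C") (auto simp: restrict_map_def map_add_def domIff split: option.splits)
    qed
    show "((case ab of (a, b) \<Rightarrow> a ++ b) |` (A \<union> C), (case ab of (a, b) \<Rightarrow> a ++ b) |` (B \<union> C)) = ab"
      by (simp add: ab'(1) ra rb)
    have "(a ++ b) |` T = u"
    proof
      fix i show "((a ++ b) |` T) i = u i"
        using a(1) b(1) au[of i] bu[of i] disj u(2,3) du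
        by (cases "i \<in> T"; cases "i \<in> B \<union> C")
          (auto simp: restrict_map_def map_add_def domIff split: option.splits)
    qed
    moreover have "a ++ b \<in> outcomes d ?N"
      using outcomes_add[OF a(3) b(3)] by (simp add: Un_ac)
    ultimately show "(case ab of (a, b) \<Rightarrow> a ++ b) \<in> exts d ?N u"
      by (simp add: ab'(1) exts_def du)
    show "g (case ab of (a, b) \<Rightarrow> a ++ b) * h (case ab of (a, b) \<Rightarrow> a ++ b) =
      (case ab of (a, b) \<Rightarrow> g a * h b)"
      by (simp add: ab'(1)) (metis g h ra rb)
  qed
  finally show ?thesis by simp
qed

section \<open>Kernels along the graph and their marginals\<close>

locale interventional_dag =
  fixes p :: nat and d :: "nat \<Rightarrow> nat" and E :: "(nat \<times> nat) set"
    and \<I> :: "nat set set" and \<pi> :: "nat \<Rightarrow> nat"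
  assumes E_subset: "E \<subseteq> {1..p} \<times> {1..p}" and acyclic_E: "acyclic E"
    and linear: "linear_extension p E \<pi>"
    and d_pos: "\<And>k. k \<in> {1..p} \<Longrightarrow> 1 \<le> d k"
    and \<I>_subset: "\<I> \<subseteq> Pow {1..p}" and empty_in_\<I>: "{} \<in> \<I>"
begin

abbreviation pa :: "nat \<Rightarrow> nat set" where "pa \<equiv> parents E"

lemma pa_subset: "pa j \<subseteq> {1..p}"
  using E_subset by (auto simp: parents_def)

lemma finite_\<I>: "finite \<I>"
  using \<I>_subset finite_subset by blast

lemma I_subset: "I \<in> \<I> \<Longrightarrow> I \<subseteq> {1..p}"
  using \<I>_subset by blast

text \<open>The equations given by \<open>q_gens\<close>, for values in any commutative ring.
  Comparing with the target \<open>{}\<close> suffices: \<open>{}\<close> belongs to \<I>, and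
  equality is transitive.\<close>

definition kernel_system :: "(qindex \<Rightarrow> 'b::comm_ring_1) \<Rightarrow> bool" where
  "kernel_system q \<longleftrightarrow>
     (\<forall>I\<in>\<I>. \<forall>j\<in>{1..p}. \<forall>y\<in>outcomes d (pa j). (\<Sum>x\<in>{1..d j}. q (I, j, x, y)) = 1) \<and>
     (\<forall>I\<in>\<I>. \<forall>j\<in>{1..p} - I. \<forall>x\<in>{1..d j}. \<forall>y\<in>outcomes d (pa j). q (I, j, x, y) = q ({}, j, x, y))"

definition kern :: "(qindex \<Rightarrow> 'b) \<Rightarrow> nat set \<Rightarrow> nat \<Rightarrow> outcome \<Rightarrow> 'b" where
  "kern q I j x = q (I, j, the (x j), x |` pa j)"

definition mass :: "(qindex \<Rightarrow> 'b::comm_ring_1) \<Rightarrow> nat set \<Rightarrow> outcome \<Rightarrow> 'b" where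
  "mass q I u = (\<Sum>y\<in>extending p d u. factorization p E q (I, y))"

lemma kern_restrict: "insert j (pa j) \<subseteq> S \<Longrightarrow> kern q I j (x |` S) = kern q I j x"
  by (auto simp: kern_def Int_absorb1)

lemma kern_intervene:
  assumes "kernel_system q" "I \<in> \<I>" "j \<in> {1..p} - I" "x \<in> outcomes d S" "insert j (pa j) \<subseteq> S"
  shows "kern q I j x = kern q {} j x"
proof -
  have "the (x j) \<in> {1..d j}" using assms(4,5) by (auto dest: outcomesD(2))
  moreover have "x |` pa j \<in> outcomes d (pa j)"
    using outcomes_restrict[OF assms(4)] assms(5) by simp
  ultimately show ?thesis using assms(1-3) by (simp add: kernel_system_def kern_def)
qed

lemma factorization_eq:
  assumes "kernel_system q" "I \<in> \<I>" "x \<in> outcomes d {1..p}"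
  shows "factorization p E q (I, x) = (\<Prod>j\<in>{1..p}. kern q I j x)"
proof -
  have "(\<Prod>j\<in>{1..p} - I. q ({}, j, the (x j), x |` pa j)) = (\<Prod>j\<in>{1..p} - I. kern q I j x)"
    by (rule prod.cong[OF refl])
      (use kern_intervene[OF assms(1,2) _ assms(3)] pa_subset in \<open>auto simp: kern_def\<close>)
  then have "factorization p E q (I, x) = (\<Prod>j\<in>I. kern q I j x) * (\<Prod>j\<in>{1..p} - I. kern q I j x)"
    by (simp add: factorization_def kern_def)
  also have "\<dots> = (\<Prod>j\<in>{1..p}. kern q I j x)"
    using prod.subset_diff[of I "{1..p}" "\<lambda>j. kern q I j x"] I_subset[OF assms(2)]
    by (simp add: mult.commute)
  finally show ?thesis .
qed

text \<open>Nodes outside an ancestral set can be summed out because their kernels sum to 1. The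
  induction runs from the full set downwards: a minimal node \<open>i\<close> outside
  \<open>N\<close> has its parents in \<open>N\<close>, so \<open>insert i N\<close> is ancestral
  too, and summing over the value of \<open>i\<close> removes its factor.\<close>

lemma mass_ancestral:
  assumes q: "kernel_system q" and I: "I \<in> \<I>"
  shows "N \<subseteq> {1..p} \<Longrightarrow> (\<And>j. j \<in> N \<Longrightarrow> pa j \<subseteq> N) \<Longrightarrow> u \<in> outcomes d N \<Longrightarrow>
    mass q I u = (\<Prod>j\<in>N. kern q I j u)"
proof (induction "card ({1..p} - N)" arbitrary: N u)
  case 0
  then have "N = {1..p}" by auto
  with 0 show ?case
    by (simp add: mass_def extending_eq_exts exts_self factorization_eq[OF q I])
next
  case (Suc n)
  have "wf E"
    using finite_acyclic_wf[OF finite_subset[OF E_subset] acyclic_E] by simp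
  moreover have "{1..p} - N \<noteq> {}" using Suc.hyps(2) by (metis card.empty nat.simps(3))
  ultimately obtain i where i: "i \<in> {1..p} - N" "\<And>j. (j, i) \<in> E \<Longrightarrow> j \<notin> {1..p} - N"
    using wfE_min' by metis
  then have pai: "pa i \<subseteq> N" using pa_subset[of i] by (fastforce simp: parents_def)
  have fN: "finite N" using Suc.prems(1) finite_subset by blast
  have du: "dom u = N" using Suc.prems(3) by (rule outcomesD)
  have card: "n = card ({1..p} - insert i N)"
    using Suc.hyps(2) i(1) by (metis Diff_insert card_Diff_singleton diff_Suc_1)
  \<comment> \<open>As \<open>N\<close> is ancestral, \<open>i\<close> is a parent of no node of
    \<open>N\<close>, so the other kernels do not see its value.\<close>
  have same: "kern q I j (u(i \<mapsto> k)) = kern q I j u" if "j \<in> N" for j k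
  proof -
    have "i \<notin> pa j" using Suc.prems(2)[OF that] i(1) by auto
    then show ?thesis using that i(1) by (auto simp: kern_def)
  qed
  have "mass q I u = (\<Sum>z\<in>exts d (insert i N) u. mass q I z)"
    unfolding mass_def extending_eq_exts
    by (rule sum_exts_split) (use Suc.prems i du in auto)
  also have "\<dots> = (\<Sum>k\<in>{1..d i}. mass q I (u(i \<mapsto> k)))"
    by (rule sum_exts_insert) (use Suc.prems i in auto)
  also have "\<dots> = (\<Sum>k\<in>{1..d i}. \<Prod>j\<in>insert i N. kern q I j (u(i \<mapsto> k)))"
  proof (rule sum.cong[OF refl])
    fix k assume "k \<in> {1..d i}"
    then have "u(i \<mapsto> k) \<in> outcomes d (insert i N)" by (rule outcomes_upd[OF Suc.prems(3)])
    then show "mass q I (u(i \<mapsto> k)) = (\<Prod>j\<in>insert i N. kern q I j (u(i \<mapsto> k)))"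
      by (intro Suc.hyps(1)[OF card]) (use Suc.prems i pai in auto)
  qed
  also have "\<dots> = (\<Sum>k\<in>{1..d i}. kern q I i (u(i \<mapsto> k)) * (\<Prod>j\<in>N. kern q I j u))"
    using fN i(1) same by (simp cong: prod.cong)
  also have "\<dots> = (\<Sum>k\<in>{1..d i}. kern q I i (u(i \<mapsto> k))) * (\<Prod>j\<in>N. kern q I j u)"
    by (simp add: sum_distrib_right)
  also have "(\<Sum>k\<in>{1..d i}. kern q I i (u(i \<mapsto> k))) = (\<Sum>k\<in>{1..d i}. q (I, i, k, u |` pa i))"
  proof (rule sum.cong[OF refl])
    fix k
    have "i \<notin> pa i" using pai i(1) by auto
    then show "kern q I i (u(i \<mapsto> k)) = q (I, i, k, u |` pa i)" by (simp add: kern_def)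
  qed
  also have "\<dots> = 1"
    using q I i(1) outcomes_restrict[OF Suc.prems(3) pai] by (auto simp: kernel_system_def)
  finally show ?case by simp
qed

text \<open>The marginal over the ancestral set \<open>N\<close> is a sum of products over families.
  The families in \<open>J\<close> see only \<open>S \<union> C\<close> and the others only
  \<open>N - S\<close>, so \<open>sum_exts_factor\<close> applies with the blocks \<open>S\<close>
  and \<open>N - S - C\<close>.\<close>

lemma mass_split:
  assumes q: "kernel_system q" and I: "I \<in> \<I>"
    and N: "N \<subseteq> {1..p}" "\<And>j. j \<in> N \<Longrightarrow> pa j \<subseteq> N" and S: "S \<subseteq> N" "S \<inter> C = {}" and C: "C \<subseteq> N"
    and J: "J \<subseteq> N" "\<And>j. j \<in> J \<Longrightarrow> insert j (pa j) \<subseteq> S \<union> C"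
      "\<And>j. j \<in> N - J \<Longrightarrow> insert j (pa j) \<inter> S = {}"
    and u: "u \<in> outcomes d T" "C \<subseteq> T" "T \<subseteq> N"
  shows "mass q I u = (\<Sum>y\<in>exts d (S \<union> C) (u |` (S \<union> C)). \<Prod>j\<in>J. kern q I j y) *
    (\<Sum>y\<in>exts d (N - S) (u |` (N - S)). \<Prod>j\<in>N - J. kern q I j y)"
proof -
  have fN: "finite N" using N(1) finite_subset by blast
  have du: "dom u = T" using u(1) by (rule outcomesD)
  have eqN: "S \<union> (N - S - C) \<union> C = N" and eqB: "N - S - C \<union> C = N - S" using S C by auto
  have "mass q I u = (\<Sum>z\<in>exts d N u. mass q I z)"
    unfolding mass_def extending_eq_exts
    by (rule sum_exts_split) (use u du N in auto)
  also have "\<dots> = (\<Sum>z\<in>exts d N u. \<Prod>j\<in>N. kern q I j z)"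
    by (rule sum.cong[OF refl]) (rule mass_ancestral[OF q I N], auto simp: exts_def)
  also have "\<dots> = (\<Sum>z\<in>exts d N u. (\<Prod>j\<in>J. kern q I j z) * (\<Prod>j\<in>N - J. kern q I j z))"
    by (simp add: prod.subset_diff[OF J(1) fN] mult.commute)
  also have "\<dots> = (\<Sum>y\<in>exts d (S \<union> C) (u |` (S \<union> C)). \<Prod>j\<in>J. kern q I j y) *
    (\<Sum>y\<in>exts d (N - S) (u |` (N - S)). \<Prod>j\<in>N - J. kern q I j y)"
  proof (rule sum_exts_factor[of S "N - S - C" C u d T, unfolded eqN eqB])
    fix y
    show "(\<Prod>j\<in>J. kern q I j y) = (\<Prod>j\<in>J. kern q I j (y |` (S \<union> C)))"
      by (rule prod.cong[OF refl], rule kern_restrict[symmetric]) (use J in auto)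
    show "(\<Prod>j\<in>N - J. kern q I j y) = (\<Prod>j\<in>N - J. kern q I j (y |` (N - S)))"
      by (rule prod.cong[OF refl], rule kern_restrict[symmetric]) (use J(3) N(2) in auto)
  qed (use fN u S in auto)
  finally show ?thesis .
qed

lemma ancestors_closed: "j \<in> ancestors E X \<Longrightarrow> pa j \<subseteq> ancestors E X"
  by (auto simp: parents_def intro: ancestors_step)

lemma ancestors_subset: "X \<subseteq> {1..p} \<Longrightarrow> ancestors E X \<subseteq> {1..p}"
  using E_subset by (force simp: ancestors_def elim: converse_rtranclE)

text \<open>Over the ancestral set of \<open>A \<union> B \<union> C\<close> the marginal has the
  form \<open>G (a ++ c) * H (b ++ c)\<close>. Exchanging \<open>b\<close> with \<open>b'\<close>
  only permutes the four factors of the two products, so no division by the marginal of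
  \<open>c\<close> is involved.\<close>

lemma mass_global:
  assumes q: "kernel_system q" and I: "I \<in> \<I>"
    and sub: "A \<subseteq> {1..p}" "B \<subseteq> {1..p}" "C \<subseteq> {1..p}"
    and disj: "A \<inter> B = {}" "A \<inter> C = {}" "B \<inter> C = {}" and sep: "d_separates E C A B"
    and a: "a \<in> outcomes d A" "a' \<in> outcomes d A" and b: "b \<in> outcomes d B" "b' \<in> outcomes d B"
    and c: "c \<in> outcomes d C"
  shows "mass q I (a ++ b ++ c) * mass q I (a' ++ b' ++ c) =
    mass q I (a ++ b' ++ c) * mass q I (a' ++ b ++ c)"
proof -
  define N where "N = ancestors E (A \<union> B \<union> C)"
  obtain S' where S': "A \<subseteq> S'" "S' \<inter> B = {}" "S' \<inter> C = {}"
    "\<And>j. j \<in> N \<Longrightarrow> insert j (pa j) \<subseteq> S' \<union> C \<or> insert j (pa j) \<inter> S' = {}"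
    using d_separates_partition[OF sep acyclic_E disj(2,3)] unfolding N_def by metis
  have N: "N \<subseteq> {1..p}" "\<And>j. j \<in> N \<Longrightarrow> pa j \<subseteq> N" "A \<union> B \<union> C \<subseteq> N"
    using sub ancestors_closed ancestors_subset[of "A \<union> B \<union> C"] by (auto simp: N_def ancestors_self)
  \<comment> \<open>\<open>S'\<close> may contain nodes outside \<open>N\<close>, whose families are
    not controlled. Families of nodes of \<open>N\<close> stay in \<open>N\<close>, so intersecting
    with \<open>N\<close> preserves the dichotomy.\<close>
  define S where "S = S' \<inter> N"
  have fam: "insert j (pa j) \<subseteq> S \<union> C \<or> insert j (pa j) \<inter> S = {}" if "j \<in> N" for j
    using S'(4)[OF that] N(2)[OF that] that by (auto simp: S_def)
  define J where "J = {j \<in> N. insert j (pa j) \<subseteq> S \<union> C}"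
  define G where "G u = (\<Sum>y\<in>exts d (S \<union> C) u. \<Prod>j\<in>J. kern q I j y)" for u
  define H where "H u = (\<Sum>y\<in>exts d (N - S) u. \<Prod>j\<in>N - J. kern q I j y)" for u
  have *: "mass q I (a ++ b ++ c) = G (a ++ c) * H (b ++ c)"
    if a: "a \<in> outcomes d A" and b: "b \<in> outcomes d B" for a b
  proof -
    have u: "a ++ b ++ c \<in> outcomes d (A \<union> B \<union> C)"
      using that c by (intro outcomes_add)
    note dom = outcomesD(1)[OF a] outcomesD(1)[OF b] outcomesD(1)[OF c]
    have "(a ++ b ++ c) |` (S \<union> C) = a ++ c" "(a ++ b ++ c) |` (N - S) = b ++ c"
      using dom S' N(3) disj
      by (auto simp: fun_eq_iff restrict_map_def map_add_def S_def domIff split: option.splits)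
        (metis disjoint_iff domIff option.distinct(1) subsetD)+
    moreover have "S \<subseteq> N" "S \<inter> C = {}" "C \<subseteq> N"
      using S'(3) N(3) by (auto simp: S_def)
    moreover have "J \<subseteq> N" "\<And>j. j \<in> J \<Longrightarrow> insert j (pa j) \<subseteq> S \<union> C"
      "\<And>j. j \<in> N - J \<Longrightarrow> insert j (pa j) \<inter> S = {}"
      using fam by (auto simp: J_def)
    ultimately show ?thesis
      using mass_split[OF q I N(1,2) _ _ _ _ _ _ u, of S C J] N(3) by (simp add: G_def H_def)
  qed
  show ?thesis using a b by (simp add: * mult_ac)
qed

text \<open>The intervention nodes are sources, so they are ranked below all observed nodes, and
  these are ordered by \<open>E\<close>.\<close>

lemma acyclic_idag: "acyclic (idag E \<I>)"
proof -
  have "wf E"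
    using finite_acyclic_wf[OF finite_subset[OF E_subset] acyclic_E] by simp
  then have "wf (inv_image (less_than <*lex*> E)
    (\<lambda>v. case v of Interv _ \<Rightarrow> (0::nat, 0) | Obs j \<Rightarrow> (1, j)))"
    by (auto intro!: wf_inv_image wf_lex_prod)
  then have "wf (idag E \<I>)"
    by (rule wf_subset) (auto simp: idag_def)
  then show ?thesis by (rule wf_acyclic)
qed

text \<open>Intervention nodes have no parents, so adding them to the conditioning set adds no
  observed ancestors.\<close>

lemma idag_ancestors_Obs:
  "Obs i \<in> ancestors (idag E \<I>) (Obs ` X \<union> Interv ` Y) \<longleftrightarrow> i \<in> ancestors E X"
proof -
  have 1: "(Obs i, Obs j) \<in> (idag E \<I>)\<^sup>*" if "(i, j) \<in> E\<^sup>*" for i j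
    using that by induction (auto simp: idag_def intro: rtrancl_into_rtrancl)
  have 2: "\<exists>j. v = Obs j \<and> (i, j) \<in> E\<^sup>*" if "(Obs i, v) \<in> (idag E \<I>)\<^sup>*" for v
    using that by induction (auto simp: idag_def intro: rtrancl_into_rtrancl)
  show ?thesis
    unfolding ancestors_def using 1 2 by (fastforce simp: image_iff)
qed

text \<open>The partition of the extended graph puts \<open>A\<close> on the side away from
  \<open>Interv I\<close>. The kernels on that side are the same for \<open>I\<close> and
  \<open>{}\<close>, which gives a common factor \<open>G\<close>; the factor \<open>H\<close>,
  which may change with the target, depends only on the values on \<open>C\<close>. The two cross
  products consist of the same four factors.\<close>

lemma mass_intervention:
  assumes q: "kernel_system q" and I: "I \<in> \<I> - {{}}"
    and sub: "A \<subseteq> {1..p}" "C \<subseteq> {1..p}" and disj: "A \<inter> C = {}"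
    and sep: "d_separates (idag E \<I>) (Obs ` C \<union> W (\<I> - {I})) (Obs ` A) {Interv I}"
    and x: "x \<in> outcomes d {1..p}"
  shows "mass q I (x |` A ++ x |` C) * mass q {} (x |` C) =
    mass q {} (x |` A ++ x |` C) * mass q I (x |` C)"
proof -
  define N where "N = ancestors E (A \<union> C)"
  let ?C = "Obs ` C \<union> W (\<I> - {I})"
  have AC: "Obs ` A \<inter> ?C = {}" "{Interv I} \<inter> ?C = {}" using disj by (auto simp: W_def)
  obtain S' where S': "Obs ` A \<subseteq> S'" "S' \<inter> {Interv I} = {}" "S' \<inter> ?C = {}"
    "\<And>j. j \<in> ancestors (idag E \<I>) (Obs ` A \<union> {Interv I} \<union> ?C) \<Longrightarrow>
       insert j (parents (idag E \<I>) j) \<subseteq> S' \<union> ?C \<or> insert j (parents (idag E \<I>) j) \<inter> S' = {}"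
    using d_separates_partition[OF sep acyclic_idag AC] by metis
  have eq: "Obs ` A \<union> {Interv I} \<union> ?C = Obs ` (A \<union> C) \<union> Interv ` (insert I (\<I> - {I} - {{}}))"
    by (auto simp: W_def)
  have N: "N \<subseteq> {1..p}" "\<And>j. j \<in> N \<Longrightarrow> pa j \<subseteq> N" "A \<union> C \<subseteq> N"
    using sub ancestors_closed ancestors_subset[of "A \<union> C"] by (auto simp: N_def ancestors_self)
  define S where "S = {j \<in> N. Obs j \<in> S'}"
  have paO: "i \<in> pa j \<Longrightarrow> Obs i \<in> parents (idag E \<I>) (Obs j)" for i j
    by (auto simp: parents_def idag_def)
  have fam': "insert (Obs j) (parents (idag E \<I>) (Obs j)) \<subseteq> S' \<union> ?C \<or>
      insert (Obs j) (parents (idag E \<I>) (Obs j)) \<inter> S' = {}" if "j \<in> N" for j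
    using S'(4)[of "Obs j"] that unfolding eq idag_ancestors_Obs by (simp add: N_def)
  define J where "J = {j \<in> N. insert (Obs j) (parents (idag E \<I>) (Obs j)) \<subseteq> S' \<union> ?C}"
  \<comment> \<open>If \<open>j\<close> were a target, \<open>Interv I\<close> would belong to its
    family, but it lies neither in \<open>S'\<close> nor in the conditioning set.\<close>
  have JI: "j \<notin> I" if "j \<in> J" for j
  proof
    assume "j \<in> I"
    then have "Interv I \<in> parents (idag E \<I>) (Obs j)" using I by (auto simp: parents_def idag_def)
    then show False using that S'(2) by (auto simp: J_def W_def)
  qed
  have J: "J \<subseteq> N" "\<And>j. j \<in> J \<Longrightarrow> insert j (pa j) \<subseteq> S \<union> C"
      "\<And>j. j \<in> N - J \<Longrightarrow> insert j (pa j) \<inter> S = {}"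
  proof -
    show "J \<subseteq> N" by (auto simp: J_def)
  next
    fix j assume j: "j \<in> J"
    have "i \<in> S \<union> C" if "i \<in> insert j (pa j)" for i
    proof -
      have "Obs i \<in> S' \<union> ?C" "i \<in> N" using j that paO[of i j] N(2)[of j] by (auto simp: J_def)
      then show ?thesis by (auto simp: S_def W_def)
    qed
    then show "insert j (pa j) \<subseteq> S \<union> C" by blast
  next
    fix j assume "j \<in> N - J"
    then have "insert (Obs j) (parents (idag E \<I>) (Obs j)) \<inter> S' = {}" using fam' by (auto simp: J_def)
    then show "insert j (pa j) \<inter> S = {}" using paO by (auto simp: S_def)
  qed
  define G where "G u = (\<Sum>y\<in>exts d (S \<union> C) u. \<Prod>j\<in>J. kern q {} j y)" for u
  define H where "H I u = (\<Sum>y\<in>exts d (N - S) u. \<Prod>j\<in>N - J. kern q I j y)" for I u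
  have *: "mass q K u = G (u |` (S \<union> C)) * H K (u |` (N - S))"
    if K: "K \<in> {I, {}}" and u: "u \<in> outcomes d T" "C \<subseteq> T" "T \<subseteq> N" for K u T
  proof -
    have KI: "K \<in> \<I>" using K I empty_in_\<I> by auto
    have "(\<Sum>y\<in>exts d (S \<union> C) v. \<Prod>j\<in>J. kern q K j y) = G v" for v
      unfolding G_def
    proof (intro sum.cong prod.cong refl)
      fix y j assume y: "y \<in> exts d (S \<union> C) v" and j: "j \<in> J"
      show "kern q K j y = kern q {} j y"
        by (rule kern_intervene[OF q KI _ extsD(1)[OF y] J(2)[OF j]]) (use j K JI J(1) N(1) in auto)
    qed
    moreover have "S \<subseteq> N" "S \<inter> C = {}" "C \<subseteq> N"
      using S'(3) N(3) by (auto simp: S_def)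
    ultimately show ?thesis
      using mass_split[OF q KI N(1,2) _ _ _ J u] by (simp add: H_def)
  qed
  have dx: "dom x = {1..p}" using x by (rule outcomesD)
  have x1: "x |` A ++ x |` C \<in> outcomes d (A \<union> C)" "x |` C \<in> outcomes d C"
    using x sub by (auto intro!: outcomes_add outcomes_restrict)
  have x2: "(x |` A ++ x |` C) |` (S \<union> C) = x |` A ++ x |` C" "(x |` A ++ x |` C) |` (N - S) = x |` C"
    "x |` C |` (S \<union> C) = x |` C" "x |` C |` (N - S) = x |` C"
    using dx S' N(3) disj
    by (auto simp: fun_eq_iff restrict_map_def map_add_def S_def W_def split: option.splits)
  show ?thesis
    using *[OF _ x1(1), of I, unfolded x2] *[OF _ x1(1), of "{}", unfolded x2]
      *[OF _ x1(2), of I, unfolded x2] *[OF _ x1(2), of "{}", unfolded x2] N(3)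
    by (simp add: mult_ac)
qed

section \<open>The factorization ideal\<close>

lemma U_iff:
  "(I, j, x, y) \<in> U p d E \<I> \<longleftrightarrow> I \<in> \<I> \<and> j \<in> {1..p} \<and> x \<in> {1..d j} \<and> y \<in> outcomes d (pa j)"
  by (simp add: U_def)

lemma vars_q_gens:
  assumes "g \<in> q_gens p d E \<I>"
  shows "vars g \<subseteq> U p d E \<I>"
proof -
  from assms consider
      I j y where "g = (\<Sum>x\<in>{1..d j}. Var (I, j, x, y)) - 1" "I \<in> \<I>" "j \<in> {1..p}"
        "y \<in> outcomes d (pa j)"
    | I J j x y where "g = Var (I, j, x, y) - Var (J, j, x, y)" "I \<in> \<I>" "J \<in> \<I>"
        "j \<in> {1..p} - (I \<union> J)" "x \<in> {1..d j}" "y \<in> outcomes d (pa j)"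
    unfolding q_gens_def by blast
  then show ?thesis
  proof cases
    case 1
    show ?thesis
      unfolding 1(1) by (rule vars_diff_subset[OF vars_sum_subset]) (use 1 in \<open>auto simp: U_iff\<close>)
  next
    case 2
    show ?thesis
      unfolding 2(1) by (rule vars_diff_subset) (use 2 in \<open>auto simp: U_iff\<close>)
  qed
qed

lemma q_gens_zero_iff:
  assumes "coeff_hom c"
  shows "(\<forall>g\<in>q_gens p d E \<I>. poly_subst c q g = 0) \<longleftrightarrow> kernel_system q"
proof -
  interpret c: coeff_hom c by fact
  show ?thesis
  proof
    assume z: "\<forall>g\<in>q_gens p d E \<I>. poly_subst c q g = 0"
    show "kernel_system q"
      unfolding kernel_system_def
    proof (intro conjI ballI)
      fix I j y assume "I \<in> \<I>" "j \<in> {1..p}" "y \<in> outcomes d (pa j)"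
      then have "(\<Sum>x\<in>{1..d j}. Var (I, j, x, y)) - 1 \<in> q_gens p d E \<I>"
        unfolding q_gens_def by blast
      with z show "(\<Sum>x\<in>{1..d j}. q (I, j, x, y)) = 1"
        by (auto simp: c.poly_subst_hom dest!: bspec)
    next
      fix I j x y assume "I \<in> \<I>" "j \<in> {1..p} - I" "x \<in> {1..d j}" "y \<in> outcomes d (pa j)"
      then have "Var (I, j, x, y) - Var ({}, j, x, y) \<in> q_gens p d E \<I>"
        unfolding q_gens_def using empty_in_\<I> by fastforce
      with z show "q (I, j, x, y) = q ({}, j, x, y)"
        by (auto simp: c.poly_subst_hom dest!: bspec)
    qed
  next
    assume q: "kernel_system q"
    show "\<forall>g\<in>q_gens p d E \<I>. poly_subst c q g = 0"
      using q unfolding q_gens_def kernel_system_def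
      by (auto simp: c.poly_subst_hom simp del: One_nat_def)
  qed
qed

lemma q_ideal_subst:
  assumes "coeff_hom c" "kernel_system q" "g \<in> q_ideal p d E \<I>"
  shows "poly_subst c q g = 0"
proof -
  have "q_ideal p d E \<I> \<subseteq> {P. vars P \<subseteq> U p d E \<I> \<and> poly_subst c q P = 0}"
    unfolding q_ideal_def
    by (rule genideal_poly_ring(3)[OF vars_q_gens ideal_poly_subst_kernel[OF assms(1)]])
      (use q_gens_zero_iff[OF assms(1)] assms(2) vars_q_gens in auto)
  with assms(3) show ?thesis by blast
qed

text \<open>The generators of \<open>q_ideal\<close> can be solved for the indeterminates with
  \<open>j \<notin> I\<close>, \<open>I \<noteq> {}\<close>, and for those with \<open>x = d j\<close>; the quotient is a polynomial ring in the rest.\<close>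

definition solved :: "qindex \<Rightarrow> qindex mpoly" where
  "solved = (\<lambda>(I, j, x, y). let K = if j \<in> I then I else {} in
     if x = d j then 1 - (\<Sum>k\<in>{1..<d j}. Var (K, j, k, y)) else Var (K, j, x, y))"

lemma kernel_system_solved: "kernel_system solved"
proof -
  have "(\<Sum>x\<in>{1..d j}. solved (I, j, x, y)) = 1" if "j \<in> {1..p}" for I j y
  proof -
    have "{1..d j} = insert (d j) {1..<d j}" using d_pos[OF that] by auto
    then show ?thesis by (simp add: solved_def Let_def)
  qed
  then show ?thesis by (auto simp: kernel_system_def solved_def)
qed

lemma ideal_q_ideal: "ideal (q_ideal p d E \<I>) (poly_ring (U p d E \<I>))"
  unfolding q_ideal_def by (rule genideal_poly_ring(1)[OF vars_q_gens])

lemma q_gens_in_q_ideal: "g \<in> q_gens p d E \<I> \<Longrightarrow> g \<in> q_ideal p d E \<I>"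
  unfolding q_ideal_def using genideal_poly_ring(2)[OF vars_q_gens] by blast

text \<open>Modulo the ideal each indeterminate is congruent to its \<open>solved\<close>
  polynomial, hence every \<open>g\<close> to its substitution, and \<open>g\<close> lies in the
  ideal if the substitution is 0. The converse holds because \<open>solved\<close> is itself a
  kernel system.\<close>

lemma q_ideal_iff:
  "g \<in> q_ideal p d E \<I> \<longleftrightarrow> vars g \<subseteq> U p d E \<I> \<and> poly_subst Const solved g = 0"
proof
  show "g \<in> q_ideal p d E \<I> \<Longrightarrow> vars g \<subseteq> U p d E \<I> \<and> poly_subst Const solved g = 0"
    using q_ideal_subst[OF coeff_hom_Const kernel_system_solved]
      ideal_poly_ringD(1)[OF ideal_q_ideal] by blast
next
  interpret C: coeff_hom Const by (rule coeff_hom_Const)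
  note J = ideal_poly_ringD[OF ideal_q_ideal]
  have sU: "vars (solved v) \<subseteq> U p d E \<I>" if "v \<in> U p d E \<I>" for v
  proof -
    obtain I j x y where v: "v = (I, j, x, y)" by (metis prod_cases4)
    have "vars (1 - (\<Sum>k\<in>{1..<d j}. Var (K, j, k, y))) \<subseteq> U p d E \<I>" if "K \<in> \<I>" for K
      by (rule vars_diff_subset[OF _ vars_sum_subset])
        (use \<open>v \<in> U p d E \<I>\<close> that in \<open>simp_all add: v U_iff\<close>)
    then show ?thesis
      using that empty_in_\<I> by (simp add: v solved_def Let_def U_iff)
  qed
  have same: "Var (I, j, x, y) - Var (if j \<in> I then I else {}, j, x, y) \<in> q_ideal p d E \<I>"
    if v: "(I, j, x, y) \<in> U p d E \<I>" for I j x y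
  proof (cases "j \<in> I")
    case True
    then show ?thesis using J(2) by simp
  next
    case False
    then have "Var (I, j, x, y) - Var ({}, j, x, y) \<in> q_gens p d E \<I>"
      using v empty_in_\<I> unfolding q_gens_def U_def by fastforce
    with False show ?thesis using q_gens_in_q_ideal by simp
  qed
  have gen: "Var v - solved v \<in> q_ideal p d E \<I>" if v: "v \<in> U p d E \<I>" for v
  proof -
    obtain I j x y where v': "v = (I, j, x, y)" by (metis prod_cases4)
    let ?K = "if j \<in> I then I else {}"
    show ?thesis
    proof (cases "x = d j")
      case True
      have *: "{1..d j} = insert (d j) {1..<d j}" using d_pos[of j] v v' by (auto simp: U_def)
      have "(\<Sum>k\<in>{1..d j}. Var (?K, j, k, y)) - 1 \<in> q_gens p d E \<I>"
        using v v' empty_in_\<I> unfolding q_gens_def U_def by (cases "j \<in> I") auto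
      then have "(\<Sum>k\<in>{1..d j}. Var (?K, j, k, y)) - 1 \<in> q_ideal p d E \<I>"
        by (rule q_gens_in_q_ideal)
      moreover have eq: "Var v - solved v = (Var (I, j, x, y) - Var (?K, j, x, y)) +
          ((\<Sum>k\<in>{1..d j}. Var (?K, j, k, y)) - 1)"
        unfolding * using True by (simp add: v' solved_def Let_def)
      moreover have "Var (I, j, x, y) - Var (?K, j, x, y) \<in> q_ideal p d E \<I>"
        using same v v' by blast
      ultimately show ?thesis unfolding eq by (intro J(3))
    next
      case False
      then show ?thesis using same v v' by (simp add: solved_def Let_def)
    qed
  qed
  assume g: "vars g \<subseteq> U p d E \<I> \<and> poly_subst Const solved g = 0"
  then have "vars g \<subseteq> U p d E \<I>" ..
  then have "g - poly_subst Const solved g \<in> q_ideal p d E \<I>"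
  proof (induction g rule: mpoly_induct)
    case (Const c)
    then show ?case using J(2) by simp
  next
    case (Var v)
    then show ?case using gen by simp
  next
    case (add P P')
    then show ?case using J(3) by (fastforce simp: C.poly_subst_hom algebra_simps)
  next
    case (mult P P')
    have "vars (poly_subst Const solved P) \<subseteq> U p d E \<I>"
      by (rule vars_poly_subst[OF mult(1) sU])
    then have "(P - poly_subst Const solved P) * P' +
        poly_subst Const solved P * (P' - poly_subst Const solved P') \<in> q_ideal p d E \<I>"
      by (intro J(3)[OF J(5)[OF mult(3,2)] J(4)[OF mult(4)]])
    then show ?case by (simp add: C.poly_subst_hom algebra_simps)
  qed
  then show "g \<in> q_ideal p d E \<I>" using g by simp
qed

lemma vars_factorization_Var:
  assumes "v \<in> D p d \<I>"
  shows "vars (factorization p E Var v) \<subseteq> U p d E \<I>"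
proof -
  obtain I x where v: "v = (I, x)" "I \<in> \<I>" "x \<in> outcomes d {1..p}"
    using assms by (auto simp: D_def)
  have "(K, j, the (x j), x |` pa j) \<in> U p d E \<I>" if "K \<in> \<I>" "j \<in> {1..p}" for K j
    using that outcomesD(2)[OF v(3) that(2)] outcomes_restrict[OF v(3) pa_subset] by (simp add: U_iff)
  then show ?thesis
    unfolding v(1) factorization_def prod.case
    by (intro vars_mult_subset vars_prod_subset)
      (use I_subset[OF v(2)] v(2) empty_in_\<I> in auto)
qed

lemma poly_subst_factorization:
  assumes "coeff_hom c"
  shows "poly_subst c q (factorization p E Var v) = factorization p E q v"
proof -
  interpret c: coeff_hom c by fact
  show ?thesis by (cases v) (simp add: factorization_def c.poly_subst_hom)
qed

lemma vars_subst_factorization: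
  "vars P \<subseteq> D p d \<I> \<Longrightarrow> vars (poly_subst Const (factorization p E Var) P) \<subseteq> U p d E \<I>"
  by (rule vars_poly_subst[OF _ vars_factorization_Var])

lemma poly_subst_subst_factorization:
  assumes "coeff_hom c"
  shows "poly_subst c q (poly_subst Const (factorization p E Var) P) =
    poly_subst c (factorization p E q) P"
  unfolding poly_subst_poly_subst[OF assms] poly_subst_factorization[OF assms] ..

text \<open>The zero of the quotient ring is the ideal itself, and a coset equals it exactly when
  its representative lies in it.\<close>

lemma factorization_ideal_eq:
  "factorization_ideal p d E \<I> =
     {P. vars P \<subseteq> D p d \<I> \<and> poly_subst Const (factorization p E Var) P \<in> q_ideal p d E \<I>}"
proof -
  let ?R = "poly_ring (U p d E \<I>)" and ?Q = "q_ideal p d E \<I>"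
  interpret Q: ideal ?Q ?R by (rule ideal_q_ideal)
  have *: "?Q +>\<^bsub>?R\<^esub> X = ?Q \<longleftrightarrow> X \<in> ?Q" if "vars X \<subseteq> U p d E \<I>" for X
    using that Q.a_rcos_self[of X] Q.a_rcos_const[of X] by auto
  have "\<zero>\<^bsub>?R Quot ?Q\<^esub> = ?Q" by (simp add: FactRing_def)
  then show ?thesis
    unfolding factorization_ideal_def a_kernel_def' Phi_def carrier_poly_ring mem_Collect_eq
    by (intro Collect_cong conj_cong refl) (simp only: * vars_subst_factorization)
qed

text \<open>\<open>factorization p E solved\<close> serves as a generic point of the model: a
  polynomial belongs to the ideal once it vanishes at this single kernel system. The values there
  are polynomials, which have no zero divisors.\<close>

lemma factorization_ideal_iff:
  "P \<in> factorization_ideal p d E \<I> \<longleftrightarrow>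
     vars P \<subseteq> D p d \<I> \<and> poly_subst Const (factorization p E solved) P = 0"
  unfolding factorization_ideal_eq q_ideal_iff
    poly_subst_subst_factorization[OF coeff_hom_Const] mem_Collect_eq
  using vars_subst_factorization by blast

lemma factorization_ideal_subst:
  assumes "coeff_hom c" "kernel_system q" "P \<in> factorization_ideal p d E \<I>"
  shows "poly_subst c (factorization p E q) P = 0"
  unfolding poly_subst_subst_factorization[OF assms(1), symmetric]
  by (rule q_ideal_subst[OF assms(1,2)]) (use assms(3) in \<open>simp add: factorization_ideal_eq\<close>)

lemma ideal_factorization_ideal: "ideal (factorization_ideal p d E \<I>) (poly_ring (D p d \<I>))"
  using ideal_poly_subst_kernel[OF coeff_hom_Const, of "D p d \<I>" "factorization p E solved"]
  by (simp add: factorization_ideal_iff[symmetric])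

section \<open>The conditional independence and normalization relations lie in the factorization
  ideal\<close>

lemma poly_subst_p_plus:
  assumes "coeff_hom c"
  shows "poly_subst c (factorization p E q) (p_plus p d I u) = mass q I u"
proof -
  interpret c: coeff_hom c by fact
  show ?thesis by (simp add: p_plus_def c.poly_subst_hom mass_def)
qed

lemma vars_p_plus: "I \<in> \<I> \<Longrightarrow> vars (p_plus p d I u) \<subseteq> D p d \<I>"
  unfolding p_plus_def by (rule vars_sum_subset) (simp add: D_def extending_def)

lemma vars_bold_p: "vars (bold_p p d \<I> \<pi>) \<subseteq> D p d \<I>"
  unfolding bold_p_def by (intro vars_prod_subset vars_p_plus)

lemma global_gens_vars:
  assumes "I \<in> \<I>"
  shows "vars (p_plus p d I a * p_plus p d I b - p_plus p d I a' * p_plus p d I b') \<subseteq> D p d \<I>"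
  by (intro vars_diff_subset vars_mult_subset vars_p_plus assms)

lemma inv_gens_vars:
  assumes "I \<in> \<I>"
  shows "vars (p_plus p d I a * p_plus p d {} b - p_plus p d {} a' * p_plus p d I b') \<subseteq> D p d \<I>"
  by (intro vars_diff_subset vars_mult_subset vars_p_plus assms empty_in_\<I>)

lemma ideal_global_ideal: "I \<in> \<I> \<Longrightarrow> ideal (global_ideal p d E \<I> I) (poly_ring (D p d \<I>))"
  unfolding global_ideal_def by (rule genideal_poly_ring(1)) (use global_gens_vars in blast)

lemma ideal_inv_ideal: "ideal (inv_ideal p d E \<I>) (poly_ring (D p d \<I>))"
  unfolding inv_ideal_def by (rule genideal_poly_ring(1)) (use inv_gens_vars in blast)

lemma ci_gens_vars:
  "P \<in> inv_ideal p d E \<I> \<union> (\<Union>I\<in>\<I>. global_ideal p d E \<I> I) \<Longrightarrow> vars P \<subseteq> D p d \<I>"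
  using ideal_poly_ringD(1)[OF ideal_inv_ideal] ideal_poly_ringD(1)[OF ideal_global_ideal] by blast

lemma ideal_ci_ideal: "ideal (ci_ideal p d E \<I>) (poly_ring (D p d \<I>))"
  unfolding ci_ideal_def by (rule genideal_poly_ring(1)) (rule ci_gens_vars)

lemma sigma_gens_vars: "P \<in> {p_plus p d I Map.empty - 1 |I. I \<in> \<I>} \<Longrightarrow> vars P \<subseteq> D p d \<I>"
  using vars_diff_subset[OF vars_p_plus, of _ 1] by auto

lemma ideal_sigma_ideal: "ideal (sigma_ideal p d \<I>) (poly_ring (D p d \<I>))"
  unfolding sigma_ideal_def by (rule genideal_poly_ring(1)) (rule sigma_gens_vars)

lemma ci_ideal_subset: "ci_ideal p d E \<I> \<subseteq> factorization_ideal p d E \<I>"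
proof -
  interpret C: coeff_hom Const by (rule coeff_hom_Const)
  note q = kernel_system_solved
  note F = ideal_factorization_ideal
  have "p_plus p d I (x |` A ++ x |` C) * p_plus p d {} (x |` C)
      - p_plus p d {} (x |` A ++ x |` C) * p_plus p d I (x |` C) \<in> factorization_ideal p d E \<I>"
    if *: "I \<in> \<I> - {{}}" "A \<subseteq> {1..p}" "C \<subseteq> {1..p}" "A \<inter> C = {}"
      "d_separates (idag E \<I>) (Obs ` C \<union> W (\<I> - {I})) (Obs ` A) {Interv I}"
      "x \<in> outcomes d {1..p}" for I A C x
    using mass_intervention[OF q *] *(1)
    by (simp add: factorization_ideal_iff inv_gens_vars C.poly_subst_hom
        poly_subst_p_plus[OF coeff_hom_Const])
  note gen = this
  have "inv_ideal p d E \<I> \<subseteq> factorization_ideal p d E \<I>"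
    unfolding inv_ideal_def
    by (rule genideal_poly_ring(3)[OF _ F], elim CollectE exE conjE, hypsubst, erule DiffE, erule inv_gens_vars,
        rule subsetI, elim CollectE exE conjE, hypsubst, rule gen)
  moreover have "global_ideal p d E \<I> I \<subseteq> factorization_ideal p d E \<I>" if I: "I \<in> \<I>" for I
  proof -
    have "p_plus p d I (xA ++ xB ++ xC) * p_plus p d I (xA' ++ xB' ++ xC)
        - p_plus p d I (xA ++ xB' ++ xC) * p_plus p d I (xA' ++ xB ++ xC)
        \<in> factorization_ideal p d E \<I>"
      if "A \<subseteq> {1..p}" "B \<subseteq> {1..p}" "C \<subseteq> {1..p}" "A \<inter> B = {}" "A \<inter> C = {}" "B \<inter> C = {}"
        "d_separates E C A B" "xA \<in> outcomes d A" "xA' \<in> outcomes d A"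
        "xB \<in> outcomes d B" "xB' \<in> outcomes d B" "xC \<in> outcomes d C" for A B C xA xA' xB xB' xC
      using mass_global[OF q I that]
      by (simp add: factorization_ideal_iff global_gens_vars[OF I] C.poly_subst_hom
          poly_subst_p_plus[OF coeff_hom_Const])
    note gen = this
    show ?thesis
      unfolding global_ideal_def
      by (rule genideal_poly_ring(3)[OF _ F], elim CollectE exE conjE, hypsubst, rule global_gens_vars[OF I],
          rule subsetI, elim CollectE exE conjE, hypsubst, rule gen)
  qed
  ultimately show ?thesis
    unfolding ci_ideal_def by (intro genideal_poly_ring(3)[OF ci_gens_vars F]) auto
qed

lemma mass_empty: "kernel_system q \<Longrightarrow> I \<in> \<I> \<Longrightarrow> mass q I Map.empty = 1"
  using mass_ancestral[of q I "{}" Map.empty] by simp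

lemma sigma_ideal_subset: "sigma_ideal p d \<I> \<subseteq> factorization_ideal p d E \<I>"
proof -
  interpret C: coeff_hom Const by (rule coeff_hom_Const)
  show ?thesis
    unfolding sigma_ideal_def
  proof (rule genideal_poly_ring(3)[OF sigma_gens_vars ideal_factorization_ideal], assumption, clarify)
    fix I assume "I \<in> \<I>"
    then show "p_plus p d I Map.empty - 1 \<in> factorization_ideal p d E \<I>"
      using sigma_gens_vars
      by (auto simp only: factorization_ideal_iff C.poly_subst_hom poly_subst_p_plus[OF coeff_hom_Const]
          mass_empty[OF kernel_system_solved] C.poly_subst_1 diff_self)
  qed
qed

text \<open>The normalization must be part of the ideal. All generators of \<open>ci_ideal\<close>
  are homogeneous of degree 2 and \<open>bold_p\<close> is homogeneous; if
  \<open>p_plus p d I Map.empty - 1\<close> were in the saturation of \<open>ci_ideal\<close> alone,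
  a power of \<open>bold_p\<close> would be in \<open>ci_ideal\<close>, hence in the factorization
  ideal.\<close>

definition relations :: "pindex mpoly set" where
  "relations = ci_ideal p d E \<I> <+>\<^bsub>poly_ring (D p d \<I>)\<^esub> sigma_ideal p d \<I>"

lemma relations_iff:
  "P \<in> relations \<longleftrightarrow> (\<exists>A\<in>ci_ideal p d E \<I>. \<exists>B\<in>sigma_ideal p d \<I>. P = A + B)"
  by (auto simp: relations_def set_add_def')

lemma ideal_relations: "ideal relations (poly_ring (D p d \<I>))"
proof -
  interpret cring "poly_ring (D p d \<I>)" by (rule cring_poly_ring)
  show ?thesis
    unfolding relations_def by (rule add_ideals[OF ideal_ci_ideal ideal_sigma_ideal])
qed

lemma ci_ideal_relations: "ci_ideal p d E \<I> \<subseteq> relations"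
  using ideal_poly_ringD(2)[OF ideal_sigma_ideal] by (force simp: relations_iff)

lemma sigma_ideal_relations: "sigma_ideal p d \<I> \<subseteq> relations"
  using ideal_poly_ringD(2)[OF ideal_ci_ideal] by (force simp: relations_iff)

lemma relations_subset: "relations \<subseteq> factorization_ideal p d E \<I>"
  using ci_ideal_subset sigma_ideal_subset ideal_poly_ringD(3)[OF ideal_factorization_ideal]
  unfolding relations_iff subset_iff by metis

section \<open>Positivity of marginals, and primality\<close>

lemma extending_nonempty:
  assumes "u \<in> outcomes d N" "N \<subseteq> {1..p}"
  shows "extending p d u \<noteq> {}"
proof -
  have "(\<lambda>i. if i \<in> {1..p} then Some 1 else None) \<in> outcomes d {1..p}"
    by (rule outcomes_nonempty) (rule d_pos)
  from outcomes_add[OF this assms(1)]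
  have "(\<lambda>i. if i \<in> {1..p} then Some 1 else None) ++ u \<in> outcomes d {1..p}"
    using assms(2) by (simp add: Un_absorb2)
  then have "(\<lambda>i. if i \<in> {1..p} then Some 1 else None) ++ u \<in> extending p d u"
    by (auto simp: extending_def fun_eq_iff restrict_map_def domIff map_add_def split: option.splits)
  then show ?thesis by blast
qed

lemma finite_extending: "finite (extending p d u)"
  by (simp add: extending_eq_exts finite_exts)

lemma mass_pos:
  fixes q :: "qindex \<Rightarrow> real"
  assumes "\<And>v. v \<in> U p d E \<I> \<Longrightarrow> 0 < q v" "I \<in> \<I>" "u \<in> outcomes d N" "N \<subseteq> {1..p}"
  shows "0 < mass q I u"
  unfolding mass_def
proof (rule sum_pos[OF finite_extending extending_nonempty[OF assms(3,4)]])
  fix y assume "y \<in> extending p d u"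
  then have y: "y \<in> outcomes d {1..p}" by (simp add: extending_def)
  have "0 < q (K, j, the (y j), y |` pa j)" if "j \<in> {1..p}" "K \<in> \<I>" for j K
    using that outcomesD(2)[OF y that(1)] outcomes_restrict[OF y pa_subset]
    by (intro assms(1)) (auto simp: U_def)
  then show "0 < factorization p E q (I, y)"
    using I_subset[OF assms(2)] assms(2) empty_in_\<I>
    by (auto simp: factorization_def intro!: mult_pos_pos prod_pos)
qed

lemma \<pi>_permutes: "\<pi> permutes {1..p}"
  using linear by (simp add: linear_extension_def)

lemma \<pi>_prefix: "k \<in> {1..p} \<Longrightarrow> \<pi> ` {1..k} \<subseteq> {1..p}"
  using permutes_image[OF \<pi>_permutes] by (metis atLeastAtMost_iff atLeastatMost_subset_iff image_mono order_refl)

lemma bold_p_notin: "bold_p p d \<I> \<pi> \<notin> factorization_ideal p d E \<I>"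
proof
  interpret e: coeff_hom "\<lambda>c::real. c" by (rule coeff_hom_id)
  \<comment> \<open>The uniform kernels: a real kernel system at which every marginal is positive,
    so that \<open>bold_p\<close> does not vanish.\<close>
  define q :: "qindex \<Rightarrow> real" where "q = (\<lambda>(I, j, x, y). 1 / real (d j))"
  assume "bold_p p d \<I> \<pi> \<in> factorization_ideal p d E \<I>"
  moreover have "kernel_system q"
    using d_pos by (fastforce simp: kernel_system_def q_def)
  ultimately have "poly_subst (\<lambda>c. c) (factorization p E q) (bold_p p d \<I> \<pi>) = 0"
    using factorization_ideal_subst[OF coeff_hom_id] by blast
  moreover have "0 < poly_subst (\<lambda>c. c) (factorization p E q) (bold_p p d \<I> \<pi>)"
    unfolding bold_p_def e.poly_subst_prod poly_subst_p_plus[OF coeff_hom_id]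
  proof (intro prod_pos)
    fix I x assume I: "I \<in> \<I>" and "x \<in> (\<Union>k\<in>{1..p}. outcomes d (\<pi> ` {1..k}))"
    then obtain k where k: "k \<in> {1..p}" "x \<in> outcomes d (\<pi> ` {1..k})" by blast
    show "0 < mass q I x"
      by (rule mass_pos[OF _ I k(2) \<pi>_prefix[OF k(1)]])
        (use d_pos in \<open>fastforce simp: q_def U_def\<close>)
  qed
  ultimately show False by simp
qed

lemma primeideal_factorization_ideal:
  "primeideal (factorization_ideal p d E \<I>) (poly_ring (D p d \<I>))"
proof (rule primeidealI[OF ideal_factorization_ideal cring_poly_ring])
  interpret C: coeff_hom Const by (rule coeff_hom_Const)
  show "carrier (poly_ring (D p d \<I>)) \<noteq> factorization_ideal p d E \<I>"
    using bold_p_notin vars_bold_p by auto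
  show "a \<in> factorization_ideal p d E \<I> \<or> b \<in> factorization_ideal p d E \<I>"
    if "a \<in> carrier (poly_ring (D p d \<I>))" "b \<in> carrier (poly_ring (D p d \<I>))"
      "a \<otimes>\<^bsub>poly_ring (D p d \<I>)\<^esub> b \<in> factorization_ideal p d E \<I>" for a b
    using that by (simp add: factorization_ideal_iff C.poly_subst_hom mpoly_mult_eq_0_iff)
qed

section \<open>Factorization modulo the relations\<close>

definition position :: "nat \<Rightarrow> nat" where
  "position j = inv_into UNIV \<pi> j"

definition before :: "nat \<Rightarrow> nat set" where
  "before j = \<pi> ` {1..<position j}"

lemma \<pi>_position [simp]: "\<pi> (position j) = j" and position_\<pi> [simp]: "position (\<pi> k) = k"
  using permutes_inverses[OF \<pi>_permutes] by (simp_all add: position_def)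

lemma position_in: "j \<in> {1..p} \<Longrightarrow> position j \<in> {1..p}"
  using permutes_in_image[OF permutes_inv[OF \<pi>_permutes]] by (simp add: position_def)

lemma before_iff: "i \<in> before j \<longleftrightarrow> i \<in> {1..p} \<and> position i < position j" if "j \<in> {1..p}"
proof
  assume "i \<in> before j"
  then obtain k where k: "i = \<pi> k" "1 \<le> k" "k < position j" by (auto simp: before_def)
  then have "k \<in> {1..p}" using position_in[OF that] by auto
  then have "i \<in> {1..p}" using k(1) permutes_in_image[OF \<pi>_permutes, of k] by simp
  then show "i \<in> {1..p} \<and> position i < position j" using k by simp
next
  assume "i \<in> {1..p} \<and> position i < position j"
  then show "i \<in> before j" unfolding before_def using position_in[of i]
    by (intro image_eqI[of _ _ "position i"]) auto
qed

lemma before_subset: "j \<in> {1..p} \<Longrightarrow> before j \<subseteq> {1..p}"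
  by (auto simp: before_iff)

lemma before_irrefl: "j \<in> {1..p} \<Longrightarrow> j \<notin> before j"
  by (simp add: before_iff)

lemma before_prefix:
  assumes "j \<in> {1..p}"
  shows "before j = \<pi> ` {1..position j - 1}" "insert j (before j) = \<pi> ` {1..position j}"
proof -
  have k: "1 \<le> position j" using position_in[OF assms] by simp
  then show "before j = \<pi> ` {1..position j - 1}"
    unfolding before_def by (intro arg_cong[where f = "image \<pi>"]) auto
  have "{1..position j} = insert (position j) {1..<position j}" using k by auto
  then show "insert j (before j) = \<pi> ` {1..position j}" by (simp add: before_def)
qed

lemma edge_position: "(i, j) \<in> E \<Longrightarrow> position i < position j"
  using linear by (auto simp: linear_extension_def position_def)

lemma path_position: "(i, j) \<in> E\<^sup>* \<Longrightarrow> position i \<le> position j"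
  by (induction rule: rtrancl_induct) (auto dest: edge_position)

lemma pa_before: "j \<in> {1..p} \<Longrightarrow> pa j \<subseteq> before j"
  using pa_subset[of j] edge_position unfolding parents_def by (blast intro: before_iff[THEN iffD2])

lemma descendant_not_before: "j \<in> {1..p} \<Longrightarrow> (j, v) \<in> E\<^sup>* \<Longrightarrow> v \<notin> before j"
  by (auto simp: before_iff dest: path_position)

text \<open>The ordered local Markov property: every predecessor of \<open>j\<close> is a
  non-descendant.\<close>

lemma d_separates_before:
  assumes "j \<in> {1..p}"
  shows "d_separates E (pa j) {j} (before j - pa j)"
  by (rule d_separates_parents[OF acyclic_E])
    (use descendant_not_before[OF assms] pa_before[OF assms] in auto)

lemma idag_descendant: "(Obs j, v) \<in> (idag E \<I>)\<^sup>* \<Longrightarrow> \<exists>i. v = Obs i \<and> (j, i) \<in> E\<^sup>*"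
  by (induction rule: rtrancl_induct) (auto simp: idag_def intro: rtrancl_into_rtrancl)

text \<open>The parents of \<open>Obs j\<close> in the extended graph are earlier observed nodes and
  intervention nodes whose target contains \<open>j\<close>; as \<open>j \<notin> I\<close>, all of
  them are conditioned on.\<close>

lemma d_separates_intervention:
  assumes "j \<in> {1..p}" "j \<notin> I"
  shows "d_separates (idag E \<I>) (Obs ` before j \<union> W (\<I> - {I})) (Obs ` {j}) {Interv I}"
  unfolding image_insert image_empty
proof (rule d_separates_parents[OF acyclic_idag])
  show "parents (idag E \<I>) (Obs j) \<subseteq> Obs ` before j \<union> W (\<I> - {I})"
    "parents (idag E \<I>) (Obs j) \<inter> {Interv I} = {}"
    using pa_before[OF assms(1)] assms(2) by (auto simp: parents_def idag_def W_def)
  show "v \<notin> Obs ` before j \<union> W (\<I> - {I}) \<and> v \<notin> {Interv I}" if "(Obs j, v) \<in> (idag E \<I>)\<^sup>*" for v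
    using idag_descendant[OF that] descendant_not_before[OF assms(1)] by (auto simp: W_def)
qed

section \<open>The two families of relations that suffice for the factorization\<close>

lemma sum_extending_upd:
  assumes "u \<in> outcomes d N" "i \<in> {1..p} - N" "N \<subseteq> {1..p}"
  shows "sum f (extending p d u) = (\<Sum>k\<in>{1..d i}. sum f (extending p d (u(i \<mapsto> k))))"
proof -
  have "sum f (extending p d u) = (\<Sum>z\<in>exts d (insert i N) u. sum f (extending p d z))"
    unfolding extending_eq_exts
    by (rule sum_exts_split) (use assms outcomesD(1)[OF assms(1)] in auto)
  also have "\<dots> = (\<Sum>k\<in>{1..d i}. sum f (extending p d (u(i \<mapsto> k))))"
    by (rule sum_exts_insert) (use assms in auto)
  finally show ?thesis .
qed

lemma p_plus_split:
  assumes "u \<in> outcomes d N" "i \<in> {1..p} - N" "N \<subseteq> {1..p}"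
  shows "p_plus p d I u = (\<Sum>k\<in>{1..d i}. p_plus p d I (u(i \<mapsto> k)))"
  unfolding p_plus_def by (rule sum_extending_upd[OF assms])

lemma global_gens_in_relations:
  assumes I: "I \<in> \<I>" and *: "A \<subseteq> {1..p}" "B \<subseteq> {1..p}" "C \<subseteq> {1..p}"
    "A \<inter> B = {}" "A \<inter> C = {}" "B \<inter> C = {}" "A \<noteq> {}" "B \<noteq> {}" "d_separates E C A B"
    "xA \<in> outcomes d A" "xA' \<in> outcomes d A" "xB \<in> outcomes d B" "xB' \<in> outcomes d B"
    "xC \<in> outcomes d C"
  shows "p_plus p d I (xA ++ xB ++ xC) * p_plus p d I (xA' ++ xB' ++ xC)
        - p_plus p d I (xA ++ xB' ++ xC) * p_plus p d I (xA' ++ xB ++ xC) \<in> relations" (is "?P \<in> _")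
proof -
  have "?P \<in> global_ideal p d E \<I> I"
    unfolding global_ideal_def
  proof (rule subsetD[OF genideal_poly_ring(2)], elim CollectE exE conjE, hypsubst,
      rule global_gens_vars[OF I], rule CollectI)
    show "\<exists>A B C yA yA' yB yB' yC.
      ?P = p_plus p d I (yA ++ yB ++ yC) * p_plus p d I (yA' ++ yB' ++ yC)
        - p_plus p d I (yA ++ yB' ++ yC) * p_plus p d I (yA' ++ yB ++ yC) \<and>
      A \<subseteq> {1..p} \<and> B \<subseteq> {1..p} \<and> C \<subseteq> {1..p} \<and>
      A \<inter> B = {} \<and> A \<inter> C = {} \<and> B \<inter> C = {} \<and> A \<noteq> {} \<and> B \<noteq> {} \<and> d_separates E C A B \<and>
      yA \<in> outcomes d A \<and> yA' \<in> outcomes d A \<and> yB \<in> outcomes d B \<and> yB' \<in> outcomes d B \<and>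
      yC \<in> outcomes d C"
      by (rule exI[of _ A], rule exI[of _ B], rule exI[of _ C], rule exI[of _ xA],
          rule exI[of _ xA'], rule exI[of _ xB], rule exI[of _ xB'], rule exI[of _ xC])
        (intro conjI refl *)
  qed
  then have "?P \<in> ci_ideal p d E \<I>"
    unfolding ci_ideal_def using genideal_poly_ring(2)[OF ci_gens_vars] I by blast
  then show ?thesis using ci_ideal_relations by blast
qed

lemma inv_gens_in_relations:
  assumes I: "I \<in> \<I> - {{}}" and *: "A \<subseteq> {1..p}" "C \<subseteq> {1..p}" "A \<inter> C = {}"
    "d_separates (idag E \<I>) (Obs ` C \<union> W (\<I> - {I})) (Obs ` A) {Interv I}"
    "x \<in> outcomes d {1..p}"
  shows "p_plus p d I (x |` A ++ x |` C) * p_plus p d {} (x |` C)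
        - p_plus p d {} (x |` A ++ x |` C) * p_plus p d I (x |` C) \<in> relations" (is "?P \<in> _")
proof -
  have "?P \<in> inv_ideal p d E \<I>"
    unfolding inv_ideal_def
  proof (rule subsetD[OF genideal_poly_ring(2)], elim CollectE exE conjE, hypsubst, erule DiffE,
      erule inv_gens_vars, rule CollectI)
    show "\<exists>I A C y.
      ?P = p_plus p d I (y |` A ++ y |` C) * p_plus p d {} (y |` C)
        - p_plus p d {} (y |` A ++ y |` C) * p_plus p d I (y |` C) \<and>
      I \<in> \<I> - {{}} \<and> A \<subseteq> {1..p} \<and> C \<subseteq> {1..p} \<and> A \<inter> C = {} \<and>
      d_separates (idag E \<I>) (Obs ` C \<union> W (\<I> - {I})) (Obs ` A) {Interv I} \<and>
      y \<in> outcomes d {1..p}"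
      by (rule exI[of _ I], rule exI[of _ A], rule exI[of _ C], rule exI[of _ x])
        (intro conjI refl I *)
  qed
  then have "?P \<in> ci_ideal p d E \<I>"
    unfolding ci_ideal_def using genideal_poly_ring(2)[OF ci_gens_vars] by blast
  then show ?thesis using ci_ideal_relations by blast
qed

text \<open>The generators for \<open>{j}\<close> and \<open>before j - pa j\<close> given
  \<open>pa j\<close> compare only outcomes that assign a value to \<open>j\<close>. Summing them
  over the second value \<open>k\<close> of \<open>j\<close> turns the factors with \<open>k\<close>
  into the marginals of \<open>z'\<close> and \<open>z\<close>.\<close>

lemma global_relation:
  assumes I: "I \<in> \<I>" and j: "j \<in> {1..p}" and x: "x \<in> {1..d j}"
    and z: "z \<in> outcomes d (before j)" and z': "z' \<in> outcomes d (before j)"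
    and eq: "z |` pa j = z' |` pa j"
  shows "p_plus p d I (z(j \<mapsto> x)) * p_plus p d I z' -
    p_plus p d I (z'(j \<mapsto> x)) * p_plus p d I z \<in> relations"
proof (cases "before j \<subseteq> pa j")
  \<comment> \<open>No generator exists here, since the second set would be empty; but
    \<open>z\<close> and \<open>z'\<close> then coincide.\<close>
  case True
  then have "z = z'"
    using eq outcomesD(1)[OF z] outcomesD(1)[OF z'] by (metis restrict_dom_self)
  then show ?thesis using ideal_poly_ringD(2)[OF ideal_relations] by simp
next
  case False
  note K = ideal_poly_ringD[OF ideal_relations]
  let ?B = "before j - pa j" and ?C = "pa j"
  have dz: "dom z = before j" "dom z' = before j" using z z' by (auto dest: outcomesD(1))
  have cat: "[j \<mapsto> k] ++ w |` ?B ++ z |` ?C = w(j \<mapsto> k)"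
    if "w \<in> {z, z'}" for w k
  proof -
    have dw: "dom w = before j" and wC: "w |` ?C = z |` ?C" using that dz eq by auto
    have "w |` ?B ++ w |` ?C = w"
      using dw pa_before[OF j]
      by (auto simp: fun_eq_iff map_add_def restrict_map_def domIff split: option.splits)
    moreover have "[j \<mapsto> k] ++ w = w(j \<mapsto> k)"
      using dw before_irrefl[OF j]
      by (auto simp: fun_eq_iff map_add_def domIff split: option.splits)
    ultimately show ?thesis by (metis map_add_assoc wC)
  qed
  have 1: "p_plus p d I (z(j \<mapsto> x)) * p_plus p d I (z'(j \<mapsto> k)) -
    p_plus p d I (z'(j \<mapsto> x)) * p_plus p d I (z(j \<mapsto> k)) \<in> relations" if k: "k \<in> {1..d j}" for k
  proof -
    have out: "[j \<mapsto> k] \<in> outcomes d {j}" "[j \<mapsto> x] \<in> outcomes d {j}" using k x by (auto simp: outcomes_def)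
    have "p_plus p d I ([j \<mapsto> x] ++ z |` ?B ++ z |` ?C) * p_plus p d I ([j \<mapsto> k] ++ z' |` ?B ++ z |` ?C) -
      p_plus p d I ([j \<mapsto> x] ++ z' |` ?B ++ z |` ?C) * p_plus p d I ([j \<mapsto> k] ++ z |` ?B ++ z |` ?C)
      \<in> relations"
      using False before_subset[OF j] pa_subset before_irrefl[OF j] pa_before[OF j] j
      by (intro global_gens_in_relations[OF I _ _ _ _ _ _ _ _ d_separates_before[OF j]] out
          outcomes_restrict[OF z] outcomes_restrict[OF z']) auto
    then show ?thesis by (simp add: cat)
  qed
  have "(\<Sum>k\<in>{1..d j}. p_plus p d I (z(j \<mapsto> x)) * p_plus p d I (z'(j \<mapsto> k)) -
    p_plus p d I (z'(j \<mapsto> x)) * p_plus p d I (z(j \<mapsto> k))) \<in> relations"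
    by (rule ideal_poly_ring_sum[OF ideal_relations 1])
  then show ?thesis
    using p_plus_split[OF z, of j I] p_plus_split[OF z', of j I] j before_irrefl[OF j] before_subset[OF j]
    by (simp add: sum_subtractf sum_distrib_left)
qed

text \<open>This is the generator for \<open>{j}\<close> given \<open>before j\<close>. Generators
  of \<open>inv_ideal\<close> are indexed by full outcomes, so \<open>z(j \<mapsto> x)\<close> is
  extended to an arbitrary full outcome \<open>y\<close>.\<close>

lemma intervention_relation:
  assumes I: "I \<in> \<I>" and j: "j \<in> {1..p} - I" and x: "x \<in> {1..d j}"
    and z: "z \<in> outcomes d (before j)"
  shows "p_plus p d I (z(j \<mapsto> x)) * p_plus p d {} z -
    p_plus p d {} (z(j \<mapsto> x)) * p_plus p d I z \<in> relations"
proof (cases "I = {}")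
  case True
  then show ?thesis using ideal_poly_ringD(2)[OF ideal_relations] by simp
next
  case False
  from j have j': "j \<in> {1..p}" "j \<notin> I" by auto
  have u: "z(j \<mapsto> x) \<in> outcomes d (insert j (before j))" using outcomes_upd[OF z x] .
  have "extending p d (z(j \<mapsto> x)) \<noteq> {}"
    by (rule extending_nonempty[OF u]) (use j' before_subset in auto)
  then obtain y where "y \<in> extending p d (z(j \<mapsto> x))" by blast
  then have y: "y \<in> outcomes d {1..p}" "y |` insert j (before j) = z(j \<mapsto> x)"
    using extsD[of y d "{1..p}" "z(j \<mapsto> x)"] outcomesD(1)[OF z] by (auto simp: extending_eq_exts)
  have yj: "y |` {j} ++ y |` before j = z(j \<mapsto> x)"
    unfolding y(2)[symmetric] using before_irrefl[OF j'(1)] outcomesD(1)[OF y(1)] j' before_subset[OF j'(1)]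
    by (auto simp: fun_eq_iff map_add_def restrict_map_def split: option.splits)
  have "y |` before j = (y |` insert j (before j)) |` before j" by (simp add: Int_absorb1 subset_insertI)
  also have "\<dots> = z" unfolding y(2) using before_irrefl[OF j'(1)] outcomesD(1)[OF z]
    by (simp add: restrict_dom_self)
  finally have yb: "y |` before j = z" .
  have "p_plus p d I (y |` {j} ++ y |` before j) * p_plus p d {} (y |` before j) -
    p_plus p d {} (y |` {j} ++ y |` before j) * p_plus p d I (y |` before j) \<in> relations"
    using I False j' before_subset[OF j'(1)] before_irrefl[OF j'(1)]
    by (intro inv_gens_in_relations[OF _ _ _ _ d_separates_intervention[OF j'] y(1)]) auto
  then show ?thesis by (simp only: yb yj[unfolded yb])
qed

section \<open>Quotients of prefix marginals over the denominator \<open>bp\<close>\<close>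

abbreviation bp :: "pindex mpoly" where
  "bp \<equiv> bold_p p d \<I> \<pi>"

definition sat :: "pindex mpoly set" where
  "sat = saturation (poly_ring (D p d \<I>)) relations bp"

lemma sat_iff: "P \<in> sat \<longleftrightarrow> vars P \<subseteq> D p d \<I> \<and> (\<exists>n. bp ^ n * P \<in> relations)"
  by (simp add: sat_def saturation_def)

lemma ideal_sat: "ideal sat (poly_ring (D p d \<I>))"
proof (rule ideal_poly_ringI)
  note K = ideal_poly_ringD[OF ideal_relations]
  have up: "bp ^ (n + m) * P \<in> relations" if "bp ^ n * P \<in> relations" for n m P
    using K(4)[OF that vars_power_subset[OF vars_bold_p, of m]]
    by (simp add: power_add mult_ac)
  show "0 \<in> sat" using K(2) by (simp add: sat_iff)
  show "P \<in> sat \<Longrightarrow> vars P \<subseteq> D p d \<I>" for P by (simp add: sat_iff)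
  show "P + Q \<in> sat" if "P \<in> sat" "Q \<in> sat" for P Q
  proof -
    from that obtain n m where "bp ^ n * P \<in> relations" "bp ^ m * Q \<in> relations" by (auto simp: sat_iff)
    then have "bp ^ (n + m) * P + bp ^ (m + n) * Q \<in> relations" by (intro K(3) up)
    then have "bp ^ (n + m) * (P + Q) \<in> relations" by (simp add: algebra_simps)
    with that show ?thesis unfolding sat_iff using vars_add_subset by blast
  qed
  show "Q * P \<in> sat" if P: "P \<in> sat" and Q: "vars Q \<subseteq> D p d \<I>" for P Q
  proof -
    from P obtain n where "bp ^ n * P \<in> relations" by (auto simp: sat_iff)
    from K(4)[OF this Q] have "bp ^ n * (Q * P) \<in> relations" by (simp add: mult_ac)
    with P Q show ?thesis unfolding sat_iff using vars_mult_subset by blast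
  qed
qed

lemmas satD = ideal_poly_ringD[OF ideal_sat]

lemma relations_sat: "P \<in> relations \<Longrightarrow> P \<in> sat"
  using ideal_poly_ringD(1)[OF ideal_relations] unfolding sat_iff
  by (metis mult_1 power_0)

lemma sat_cancel:
  assumes "bp ^ n * P \<in> sat" "vars P \<subseteq> D p d \<I>"
  shows "P \<in> sat"
proof -
  from assms(1) obtain m where "bp ^ m * (bp ^ n * P) \<in> relations" by (auto simp: sat_iff)
  then have "bp ^ (m + n) * P \<in> relations" by (simp add: power_add mult_ac)
  with assms(2) show ?thesis unfolding sat_iff by blast
qed

text \<open>A substitute for \<open>bp\<close> divided by the marginal of \<open>z\<close>. It is
  required only modulo \<open>relations\<close> so that the empty prefix, which contributes no
  factor to \<open>bp\<close>, is covered as well.\<close>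

definition cof :: "nat set \<Rightarrow> outcome \<Rightarrow> pindex mpoly" where
  "cof I z = (SOME c. vars c \<subseteq> D p d \<I> \<and> c * p_plus p d I z - bp \<in> relations)"

lemma p_plus_empty: "I \<in> \<I> \<Longrightarrow> p_plus p d I Map.empty - 1 \<in> relations"
  using sigma_ideal_relations genideal_poly_ring(2)[OF sigma_gens_vars]
  unfolding sigma_ideal_def by blast

lemma cof:
  assumes I: "I \<in> \<I>" and k: "k \<le> p" and z: "z \<in> outcomes d (\<pi> ` {1..k})"
  shows "vars (cof I z) \<subseteq> D p d \<I>" "cof I z * p_plus p d I z - bp \<in> relations"
proof -
  have "\<exists>c. vars c \<subseteq> D p d \<I> \<and> c * p_plus p d I z - bp \<in> relations"
  proof (cases "k = 0")
    \<comment> \<open>The total mass is congruent to 1 by \<open>sigma_ideal\<close>, so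
      \<open>bp\<close> is its own cofactor.\<close>
    case True
    then have "bp * (p_plus p d I z - 1) \<in> relations"
      using z ideal_poly_ringD(4)[OF ideal_relations p_plus_empty[OF I] vars_bold_p] by simp
    then show ?thesis using vars_bold_p by (intro exI[of _ bp]) (simp add: algebra_simps)
  next
    case False
    let ?X = "\<Union>k\<in>{1..p}. outcomes d (\<pi> ` {1..k})"
    have fin: "finite ?X" by (intro finite_UN_I finite_outcomes) auto
    have zX: "z \<in> ?X" using False k z by force
    define c where "c = (\<Prod>x\<in>?X - {z}. p_plus p d I x) * (\<Prod>J\<in>\<I> - {I}. \<Prod>x\<in>?X. p_plus p d J x)"
    have "bp = (\<Prod>x\<in>?X. p_plus p d I x) * (\<Prod>J\<in>\<I> - {I}. \<Prod>x\<in>?X. p_plus p d J x)"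
      unfolding bold_p_def using prod.remove[OF finite_\<I> I] by simp
    also have "(\<Prod>x\<in>?X. p_plus p d I x) = p_plus p d I z * (\<Prod>x\<in>?X - {z}. p_plus p d I x)"
      by (rule prod.remove[OF fin zX])
    finally have "c * p_plus p d I z = bp" by (simp add: c_def mult_ac)
    moreover have "vars c \<subseteq> D p d \<I>"
      unfolding c_def by (intro vars_mult_subset vars_prod_subset vars_p_plus I) auto
    ultimately show ?thesis using ideal_poly_ringD(2)[OF ideal_relations] by (intro exI[of _ c]) simp
  qed
  from someI_ex[OF this, folded cof_def]
  show "vars (cof I z) \<subseteq> D p d \<I>" "cof I z * p_plus p d I z - bp \<in> relations" by blast+
qed

lemma cof_before:
  assumes "I \<in> \<I>" "j \<in> {1..p}" "z \<in> outcomes d (before j)"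
  shows "vars (cof I z) \<subseteq> D p d \<I>" "cof I z * p_plus p d I z - bp \<in> relations"
proof -
  have "position j - 1 \<le> p" using position_in[OF assms(2)] by auto
  from cof[OF assms(1) this assms(3)[unfolded before_prefix(1)[OF assms(2)]]]
  show "vars (cof I z) \<subseteq> D p d \<I>" "cof I z * p_plus p d I z - bp \<in> relations" by blast+
qed

text \<open>The relation \<open>a / w = a' / w'\<close>, with \<open>1 / w\<close> replaced by \<open>c / bp\<close>.\<close>

lemma sat_ratio:
  assumes rel: "a * w' - a' * w \<in> relations" and c: "c * w - bp \<in> relations" "c' * w' - bp \<in> relations"
    and vars: "vars a \<subseteq> D p d \<I>" "vars a' \<subseteq> D p d \<I>" "vars c \<subseteq> D p d \<I>" "vars c' \<subseteq> D p d \<I>"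
  shows "a * c - a' * c' \<in> sat"
proof -
  note K = ideal_poly_ringD[OF ideal_relations]
  \<comment> \<open>The relation is multiplied by \<open>c * c'\<close>, after which
    \<open>c * w\<close> and \<open>c' * w'\<close> are each replaced by \<open>bp\<close>.\<close>
  have "c * c' * (a * w' - a' * w) - a * c * (c' * w' - bp) + a' * c' * (c * w - bp) \<in> relations"
    by (intro K(3,4,7) rel c vars_mult_subset vars)
  moreover have "c * c' * (a * w' - a' * w) - a * c * (c' * w' - bp) + a' * c' * (c * w - bp) =
    bp ^ 1 * (a * c - a' * c')"
    by (simp add: algebra_simps)
  ultimately show ?thesis
    using vars_diff_subset[OF vars_mult_subset[OF vars(1,3)] vars_mult_subset[OF vars(2,4)]]
    unfolding sat_iff by metis
qed

text \<open>\<open>cond_num I j x z / bp\<close> stands for the conditional probability of \<open>X\<^sub>j = x\<close> given the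
  values \<open>z\<close> of the variables before \<open>j\<close>.\<close>

definition cond_num :: "nat set \<Rightarrow> nat \<Rightarrow> nat \<Rightarrow> outcome \<Rightarrow> pindex mpoly" where
  "cond_num I j x z = p_plus p d I (z(j \<mapsto> x)) * cof I z"

lemma vars_cond_num:
  "I \<in> \<I> \<Longrightarrow> j \<in> {1..p} \<Longrightarrow> z \<in> outcomes d (before j) \<Longrightarrow> vars (cond_num I j x z) \<subseteq> D p d \<I>"
  unfolding cond_num_def by (intro vars_mult_subset vars_p_plus cof_before)

lemma cond_num_parents:
  assumes "I \<in> \<I>" "j \<in> {1..p}" "x \<in> {1..d j}" "z \<in> outcomes d (before j)" "z' \<in> outcomes d (before j)"
    and "z |` pa j = z' |` pa j"
  shows "cond_num I j x z - cond_num I j x z' \<in> sat"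
  unfolding cond_num_def
  by (rule sat_ratio[OF global_relation[OF assms]])
    (rule cof_before[OF assms(1,2)] vars_p_plus assms)+

lemma cond_num_intervention:
  assumes "I \<in> \<I>" "j \<in> {1..p} - I" "x \<in> {1..d j}" "z \<in> outcomes d (before j)"
  shows "cond_num I j x z - cond_num {} j x z \<in> sat"
  unfolding cond_num_def
  by (rule sat_ratio[OF intervention_relation[OF assms]])
    (use assms empty_in_\<I> cof_before vars_p_plus in auto)

lemma cond_num_sum:
  assumes "I \<in> \<I>" "j \<in> {1..p}" "z \<in> outcomes d (before j)"
  shows "(\<Sum>x\<in>{1..d j}. cond_num I j x z) - bp \<in> sat"
proof -
  have "p_plus p d I z = (\<Sum>x\<in>{1..d j}. p_plus p d I (z(j \<mapsto> x)))"
    by (rule p_plus_split[OF assms(3)]) (use assms before_irrefl before_subset in auto)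
  then have "(\<Sum>x\<in>{1..d j}. cond_num I j x z) = cof I z * p_plus p d I z"
    by (simp add: cond_num_def sum_distrib_left mult.commute)
  then show ?thesis using cof_before(2)[OF assms] relations_sat by simp
qed

text \<open>A telescoping product along \<open>\<pi>\<close>: each cofactor cancels the marginal of
  the preceding prefix and leaves one \<open>bp\<close>, which gives \<open>bp ^ p\<close> after all
  nodes. The product begins at the empty prefix, whose marginal is congruent to 1.\<close>

lemma cond_num_prod:
  assumes I: "I \<in> \<I>" and x: "x \<in> outcomes d {1..p}"
  shows "(\<Prod>j\<in>{1..p}. cond_num I j (the (x j)) (x |` before j)) - Var (I, x) * bp ^ p \<in> sat"
proof -
  let ?P = "\<lambda>k. p_plus p d I (x |` (\<pi> ` {1..k}))" and ?c = "\<lambda>k. cof I (x |` (\<pi> ` {1..k}))"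
  have z: "x |` (\<pi> ` {1..k}) \<in> outcomes d (\<pi> ` {1..k})" if "k \<le> p" for k
    by (rule outcomes_restrict[OF x]) (use that \<pi>_prefix[of k] in \<open>cases "k = 0"; auto\<close>)
  have "(\<Prod>k\<in>{1..m}. ?P k * ?c (k - 1)) - ?P m * bp ^ m \<in> sat" if "m \<le> p" for m
    using that
  proof (induction m)
    case 0
    have "- (p_plus p d I Map.empty - 1) \<in> sat"
      by (intro satD(6) relations_sat p_plus_empty I)
    then show ?case by simp
  next
    case (Suc m)
    note c = cof[OF I _ z, of m]
    \<comment> \<open>The first summand is the induction hypothesis times the next factor; the
      second replaces \<open>?c m * ?P m\<close> by \<open>bp\<close>.\<close>
    have "((\<Prod>k\<in>{1..m}. ?P k * ?c (k - 1)) - ?P m * bp ^ m) * (?P (Suc m) * ?c m) +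
        ?P (Suc m) * bp ^ m * (?c m * ?P m - bp) \<in> sat"
    proof (rule satD(3))
      show "((\<Prod>k\<in>{1..m}. ?P k * ?c (k - 1)) - ?P m * bp ^ m) * (?P (Suc m) * ?c m) \<in> sat"
        by (rule satD(5)[OF _ vars_mult_subset[OF vars_p_plus[OF I] c(1)]]) (use Suc in auto)
      show "?P (Suc m) * bp ^ m * (?c m * ?P m - bp) \<in> sat"
        by (intro satD(4) relations_sat c vars_mult_subset vars_p_plus vars_power_subset vars_bold_p I)
          (use Suc in auto)
    qed
    then show ?case by (simp add: algebra_simps)
  qed
  from this[OF order_refl] have main: "(\<Prod>k\<in>{1..p}. ?P k * ?c (k - 1)) - ?P p * bp ^ p \<in> sat" .
  have dx: "dom x = {1..p}" using x by (rule outcomesD)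
  have "x |` (\<pi> ` {1..p}) = x" using permutes_image[OF \<pi>_permutes] dx by (simp add: restrict_dom_self)
  then have "?P p = Var (I, x)" using exts_self[OF x] by (simp add: p_plus_def extending_eq_exts)
  moreover have "(\<Prod>k\<in>{1..p}. ?P k * ?c (k - 1)) =
      (\<Prod>j\<in>{1..p}. cond_num I j (the (x j)) (x |` before j))"
  proof (rule prod.reindex_bij_witness[of _ position \<pi>])
    show "\<pi> k \<in> {1..p}" if "k \<in> {1..p}" for k using that permutes_in_image[OF \<pi>_permutes] by blast
    fix k assume k: "k \<in> {1..p}"
    then have j: "\<pi> k \<in> {1..p}" using permutes_in_image[OF \<pi>_permutes] by blast
    have "(x |` before (\<pi> k))(\<pi> k \<mapsto> the (x (\<pi> k))) = x |` insert (\<pi> k) (before (\<pi> k))"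
      using dx j by (auto simp: fun_eq_iff restrict_map_def) (metis atLeastAtMost_iff One_nat_def domIff option.collapse)+
    then show "cond_num I (\<pi> k) (the (x (\<pi> k))) (x |` before (\<pi> k)) = ?P k * ?c (k - 1)"
      using before_prefix[OF j] by (simp add: cond_num_def)
  qed (rule \<pi>_position position_\<pi> position_in; assumption?)+
  ultimately show ?thesis using main by simp
qed

text \<open>A quotient is attached to a parent outcome by giving the remaining predecessors the
  value 1. By \<open>cond_num_parents\<close> any other choice gives the same element modulo
  \<open>sat\<close>.\<close>

definition completion :: "nat \<Rightarrow> outcome \<Rightarrow> outcome" where
  "completion j y = (\<lambda>i. if i \<in> before j then Some 1 else None) ++ y"

lemma completion:
  assumes "j \<in> {1..p}" "y \<in> outcomes d (pa j)"
  shows "completion j y \<in> outcomes d (before j)" "completion j y |` pa j = y"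
proof -
  have "(\<lambda>i. if i \<in> before j then Some 1 else None) \<in> outcomes d (before j)"
    by (rule outcomes_nonempty) (use d_pos before_subset[OF assms(1)] in blast)
  from outcomes_add[OF this assms(2)] show "completion j y \<in> outcomes d (before j)"
    using pa_before[OF assms(1)] by (simp add: completion_def Un_absorb2)
  show "completion j y |` pa j = y"
    using outcomesD(1)[OF assms(2)]
    by (auto simp: completion_def fun_eq_iff restrict_map_def map_add_def domIff split: option.splits)
qed

definition qnum :: "qindex \<Rightarrow> pindex mpoly" where
  "qnum = (\<lambda>(I, j, x, y). cond_num I j x (completion j y))"

lemma vars_qnum: "v \<in> U p d E \<I> \<Longrightarrow> vars (qnum v) \<subseteq> D p d \<I>"
  by (cases v) (simp add: qnum_def U_iff vars_cond_num completion(1))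

lemma qnum_sum:
  assumes "I \<in> \<I>" "j \<in> {1..p}" "y \<in> outcomes d (pa j)"
  shows "(\<Sum>x\<in>{1..d j}. qnum (I, j, x, y)) - bp \<in> sat"
  unfolding qnum_def prod.case using assms by (intro cond_num_sum completion)

lemma qnum_intervention:
  assumes "I \<in> \<I>" "j \<in> {1..p} - I" "x \<in> {1..d j}" "y \<in> outcomes d (pa j)"
  shows "qnum (I, j, x, y) - qnum ({}, j, x, y) \<in> sat"
  unfolding qnum_def prod.case using assms by (intro cond_num_intervention completion) auto

text \<open>Factor by factor, \<open>cond_num_parents\<close> replaces the completed outcome by the
  actual predecessors in \<open>x\<close>, and \<open>cond_num_intervention\<close> replaces
  \<open>{}\<close> by \<open>I\<close> at the nodes outside \<open>I\<close>. The product is then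
  that of \<open>cond_num_prod\<close>.\<close>

lemma qnum_factorization:
  assumes I: "I \<in> \<I>" and x: "x \<in> outcomes d {1..p}"
  shows "factorization p E qnum (I, x) - Var (I, x) * bp ^ p \<in> sat"
proof -
  let ?K = "\<lambda>j. if j \<in> I then I else {}"
  let ?f = "\<lambda>j. qnum (?K j, j, the (x j), x |` pa j)"
    and ?g = "\<lambda>j. cond_num I j (the (x j)) (x |` before j)"
  have "factorization p E qnum (I, x) = (\<Prod>j\<in>I. ?f j) * (\<Prod>j\<in>{1..p} - I. ?f j)"
    unfolding factorization_def prod.case by (intro arg_cong2[where f = times] prod.cong) auto
  also have "\<dots> = (\<Prod>j\<in>{1..p}. ?f j)"
    using prod.subset_diff[of I "{1..p}" ?f] I_subset[OF I] by (simp add: mult.commute)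
  finally have eq: "factorization p E qnum (I, x) = (\<Prod>j\<in>{1..p}. ?f j)" .
  have "(\<Prod>j\<in>{1..p}. ?f j) - (\<Prod>j\<in>{1..p}. ?g j) \<in> sat"
  proof (rule ideal_poly_ring_prod_cong[OF ideal_sat])
    fix j assume j: "j \<in> {1..p}"
    have K: "?K j \<in> \<I>" using I empty_in_\<I> by simp
    have xj: "the (x j) \<in> {1..d j}" using outcomesD(2)[OF x j] .
    have xp: "x |` pa j \<in> outcomes d (pa j)" by (rule outcomes_restrict[OF x pa_subset])
    have xb: "x |` before j \<in> outcomes d (before j)" by (rule outcomes_restrict[OF x before_subset[OF j]])
    show "vars (?f j) \<subseteq> D p d \<I>"
      by (rule vars_qnum) (use K j xj xp in \<open>simp add: U_iff\<close>)
    show "vars (?g j) \<subseteq> D p d \<I>"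
      by (rule vars_cond_num[OF I j xb])
    have 1: "?f j - cond_num (?K j) j (the (x j)) (x |` before j) \<in> sat"
      unfolding qnum_def prod.case
      by (rule cond_num_parents[OF K j xj completion(1)[OF j xp] xb])
        (simp add: completion(2)[OF j xp] pa_before[OF j] Int_absorb1)
    have 2: "cond_num I j (the (x j)) (x |` before j) -
        cond_num (?K j) j (the (x j)) (x |` before j) \<in> sat"
      using cond_num_intervention[OF I _ xj xb] j satD(2) by simp
    from satD(7)[OF 1 2] show "?f j - ?g j \<in> sat" by simp
  qed
  from satD(3)[OF this cond_num_prod[OF I x]] show ?thesis by (simp add: eq)
qed

section \<open>The saturation\<close>

text \<open>\<open>homog n P\<close> is \<open>bp ^ n * P(1 / bp)\<close>, so \<open>vanishing P\<close> says that \<open>P(1 / bp)\<close> is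
  zero in the localization at \<open>bp\<close> of the quotient by \<open>relations\<close>.\<close>

definition homog :: "nat \<Rightarrow> pindex mpoly poly \<Rightarrow> pindex mpoly" where
  "homog n P = (\<Sum>i\<le>n. coeff P i * bp ^ (n - i))"

definition vanishing :: "pindex mpoly poly \<Rightarrow> bool" where
  "vanishing P \<longleftrightarrow> (\<exists>N. \<forall>n\<ge>N. homog n P \<in> sat)"

lemma homog_pCons: "homog (Suc n) (pCons a P) = a * bp ^ Suc n + homog n P"
  unfolding homog_def by (subst sum.atMost_Suc_shift) (simp add: coeff_pCons)

lemma homog_0 [simp]: "homog n 0 = 0"
  by (simp add: homog_def)

lemma homog_const: "homog n [:b:] = b * bp ^ n"
  by (cases n) (simp_all add: homog_pCons, simp add: homog_def)

text \<open>Below the degree, \<open>homog\<close> drops terms. Hence the bound here, and hence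
  \<open>vanishing\<close> asks only for all sufficiently large \<open>n\<close>.\<close>

lemma homog_monom: "k \<le> n \<Longrightarrow> homog n (monom a k) = a * bp ^ (n - k)"
  unfolding homog_def by (subst sum.remove[of _ k]) (auto simp: intro!: sum.neutral)

lemma homog_add: "homog n (P + Q) = homog n P + homog n Q"
  by (simp add: homog_def algebra_simps sum.distrib)

lemma homog_diff: "homog n (P - Q) = homog n P - homog n Q"
  by (simp add: homog_def algebra_simps sum_subtractf)

lemma homog_smult: "homog n (smult a P) = a * homog n P"
  by (simp add: homog_def sum_distrib_left mult.assoc)

lemma vanishing_0: "vanishing 0"
  using satD(2) by (simp add: vanishing_def)

lemma vanishing_add:
  assumes "vanishing P" "vanishing Q"
  shows "vanishing (P + Q)"
proof -
  from assms obtain N M where "\<forall>n\<ge>N. homog n P \<in> sat" "\<forall>n\<ge>M. homog n Q \<in> sat"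
    by (auto simp: vanishing_def)
  then have "\<forall>n\<ge>max N M. homog n (P + Q) \<in> sat" by (simp add: homog_add satD(3))
  then show ?thesis unfolding vanishing_def by blast
qed

lemma vanishing_smult: "vanishing P \<Longrightarrow> vars a \<subseteq> D p d \<I> \<Longrightarrow> vanishing (smult a P)"
  unfolding vanishing_def by (auto simp: homog_smult intro: satD(4))

lemma vanishing_pCons: "vanishing P \<Longrightarrow> vanishing (pCons 0 P)"
proof -
  assume "vanishing P"
  then obtain N where N: "\<forall>n\<ge>N. homog n P \<in> sat" by (auto simp: vanishing_def)
  have "homog n (pCons 0 P) \<in> sat" if "n \<ge> Suc N" for n
    using that N by (cases n) (auto simp: homog_pCons)
  then show ?thesis unfolding vanishing_def by blast
qed

text \<open>The hypothesis is the equation \<open>a / bp ^ k = b\<close> with its denominator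
  cleared.\<close>

lemma vanishing_monom_diff:
  assumes "a - b * bp ^ k \<in> sat"
  shows "vanishing (monom a k - [:b:])"
  unfolding vanishing_def
proof (intro exI allI impI)
  fix n assume n: "k \<le> n"
  have "bp ^ n = bp ^ k * bp ^ (n - k)" using n by (simp flip: power_add)
  then have "homog n (monom a k - [:b:]) = (a - b * bp ^ k) * bp ^ (n - k)"
    using n by (simp add: homog_diff homog_monom homog_const algebra_simps)
  also have "\<dots> \<in> sat" by (rule satD(5)[OF assms vars_power_subset[OF vars_bold_p]])
  finally show "homog n (monom a k - [:b:]) \<in> sat" .
qed

lemma vanishing_const:
  assumes "vanishing [:b:]" "vars b \<subseteq> D p d \<I>"
  shows "b \<in> sat"
proof -
  from assms obtain N where "\<forall>n\<ge>N. homog n [:b:] \<in> sat" by (auto simp: vanishing_def)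
  then have "bp ^ N * b \<in> sat" by (simp add: homog_const mult.commute)
  then show ?thesis using assms(2) by (rule sat_cancel)
qed

text \<open>The candidate inverse of the parametrization: \<open>q\<close> goes to
  \<open>qnum\<close> times the variable that stands for \<open>1 / bp\<close>.\<close>

definition lift_q :: "qindex mpoly \<Rightarrow> pindex mpoly poly" where
  "lift_q = poly_subst (\<lambda>c. [:Const c:]) (\<lambda>v. [:0, qnum v:])"

sublocale lift: coeff_hom "\<lambda>c. [:Const c :: pindex mpoly:]"
  by (rule coeff_hom_poly_Const)

text \<open>A constant scales \<open>homog\<close>; a lifted indeterminate scales it and shifts
  \<open>n\<close> by one. This gives the closure under multiples needed to pass from
  \<open>q_gens\<close> to \<open>q_ideal\<close>.\<close>

lemma vanishing_lift_mult:
  assumes "vars g \<subseteq> U p d E \<I>" "vanishing P"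
  shows "vanishing (lift_q g * P)"
  using assms
proof (induction g arbitrary: P rule: mpoly_induct)
  case (Const c)
  then show ?case by (simp add: lift_q_def vanishing_smult)
next
  case (Var v)
  then show ?case by (simp add: lift_q_def vanishing_smult vanishing_pCons vars_qnum)
next
  case (add g g')
  then show ?case by (simp add: lift_q_def lift.poly_subst_hom distrib_right vanishing_add)
next
  case (mult g g')
  then show ?case by (simp add: lift_q_def lift.poly_subst_hom mult.assoc)
qed

lemma vanishing_q_gens:
  assumes "g \<in> q_gens p d E \<I>"
  shows "vanishing (lift_q g)"
proof -
  from assms consider
      I j y where "g = (\<Sum>x\<in>{1..d j}. Var (I, j, x, y)) - 1" "I \<in> \<I>" "j \<in> {1..p}"
        "y \<in> outcomes d (pa j)"
    | I J j x y where "g = Var (I, j, x, y) - Var (J, j, x, y)" "I \<in> \<I>" "J \<in> \<I>"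
        "j \<in> {1..p} - (I \<union> J)" "x \<in> {1..d j}" "y \<in> outcomes d (pa j)"
    unfolding q_gens_def by blast
  then show ?thesis
  proof cases
    case 1
    have "lift_q g = monom (\<Sum>x\<in>{1..d j}. qnum (I, j, x, y)) 1 - [:1:]"
      unfolding 1(1) lift_q_def
      by (simp only: lift.poly_subst_hom lift.poly_subst_Var lift.poly_subst_1 sum_linear_poly)
        (simp add: monom_Suc monom_0 one_pCons)
    then show ?thesis
      using vanishing_monom_diff[of _ 1 1] qnum_sum[OF 1(2-4)] by simp
  next
    case 2
    have "qnum (I, j, x, y) - qnum ({}, j, x, y) - (qnum (J, j, x, y) - qnum ({}, j, x, y)) \<in> sat"
      by (rule satD(7)[OF qnum_intervention qnum_intervention]) (use 2 in auto)
    then have "qnum (I, j, x, y) - qnum (J, j, x, y) - 0 * bp ^ 1 \<in> sat" by simp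
    moreover have "lift_q g = monom (qnum (I, j, x, y) - qnum (J, j, x, y)) 1 - [:0:]"
      unfolding 2(1) lift_q_def by (simp add: lift.poly_subst_hom monom_Suc monom_0)
    ultimately show ?thesis using vanishing_monom_diff by metis
  qed
qed

lemma vanishing_q_ideal:
  assumes "g \<in> q_ideal p d E \<I>"
  shows "vanishing (lift_q g)"
proof -
  have J: "ideal {g. vars g \<subseteq> U p d E \<I> \<and> vanishing (lift_q g)} (poly_ring (U p d E \<I>))"
  proof (rule ideal_poly_ringI)
    fix P Q assume *: "P \<in> {g. vars g \<subseteq> U p d E \<I> \<and> vanishing (lift_q g)}"
    show "Q * P \<in> {g. vars g \<subseteq> U p d E \<I> \<and> vanishing (lift_q g)}" if "vars Q \<subseteq> U p d E \<I>"
      using * vanishing_lift_mult[OF that, of "lift_q P"] vars_mult_subset[OF that, of P]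
      by (simp add: lift_q_def lift.poly_subst_mult)
    show "P + Q \<in> {g. vars g \<subseteq> U p d E \<I> \<and> vanishing (lift_q g)}"
      if "Q \<in> {g. vars g \<subseteq> U p d E \<I> \<and> vanishing (lift_q g)}"
      using * that vanishing_add by (simp add: lift_q_def lift.poly_subst_add vars_add_subset)
  qed (auto simp: lift_q_def vanishing_0)
  have "q_ideal p d E \<I> \<subseteq> {g. vars g \<subseteq> U p d E \<I> \<and> vanishing (lift_q g)}"
    unfolding q_ideal_def
    by (rule genideal_poly_ring(3)[OF vars_q_gens J]) (use vars_q_gens vanishing_q_gens in auto)
  with assms show ?thesis by blast
qed

text \<open>There is one kernel for each of the \<open>p\<close> nodes, so the power of the
  denominator is the same for every target.\<close>

lemma factorization_linear_poly:
  fixes q :: "qindex \<Rightarrow> 'b::comm_ring_1"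
  assumes "I \<in> \<I>"
  shows "factorization p E (\<lambda>v. [:0, q v:]) (I, x) = monom (factorization p E q (I, x)) p"
proof -
  have fin: "finite I" using finite_subset[OF I_subset[OF assms]] by simp
  have "card I + card ({1..p} - I) = p"
    using I_subset[OF assms] card_mono[OF _ I_subset[OF assms]] by (simp add: card_Diff_subset fin)
  then show ?thesis
    by (simp add: factorization_def prod_linear_poly fin mult_monom)
qed

text \<open>Parametrizing and lifting back is the identity at \<open>1 / bp\<close>. For an
  indeterminate this is \<open>qnum_factorization\<close>, and it extends to polynomials because
  both sides are ring homomorphisms.\<close>

lemma vanishing_lift_factorization:
  assumes "vars f \<subseteq> D p d \<I>"
  shows "vanishing (lift_q (poly_subst Const (factorization p E Var) f) - [:f:])"
  using assms
proof (induction f rule: mpoly_induct)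
  case (Const c)
  then show ?case by (simp add: lift_q_def coeff_hom.poly_subst_Const[OF coeff_hom_Const] vanishing_0)
next
  case (Var v)
  then obtain I x where v: "v = (I, x)" "I \<in> \<I>" "x \<in> outcomes d {1..p}" by (auto simp: D_def)
  have "lift_q (factorization p E Var v) = monom (factorization p E qnum (I, x)) p"
    unfolding lift_q_def poly_subst_factorization[OF coeff_hom_poly_Const]
    by (simp add: v factorization_linear_poly)
  then show ?case
    using vanishing_monom_diff[OF qnum_factorization[OF v(2,3)]]
    by (simp add: coeff_hom.poly_subst_Var[OF coeff_hom_Const] v(1))
next
  case (add P P')
  from vanishing_add[OF add.IH] show ?case
    by (simp add: lift_q_def lift.poly_subst_hom coeff_hom.poly_subst_hom[OF coeff_hom_Const] algebra_simps)
next
  case (mult P P')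
  let ?L = "\<lambda>f. lift_q (poly_subst Const (factorization p E Var) f)"
  have "vanishing (?L P * (?L P' - [:P':]) + smult P' (?L P - [:P:]))"
    by (intro vanishing_add vanishing_smult vanishing_lift_mult mult vars_subst_factorization)
  moreover have "?L P * (?L P' - [:P':]) + smult P' (?L P - [:P:]) = ?L (P * P') - [:P * P':]"
    by (simp add: lift_q_def lift.poly_subst_hom coeff_hom.poly_subst_hom[OF coeff_hom_Const]
        algebra_simps smult_diff_right)
  ultimately show ?case by simp
qed

lemma factorization_ideal_sat: "factorization_ideal p d E \<I> \<subseteq> sat"
proof
  fix f assume f: "f \<in> factorization_ideal p d E \<I>"
  let ?g = "poly_subst Const (factorization p E Var) f"
  from f have *: "vars f \<subseteq> D p d \<I>" "?g \<in> q_ideal p d E \<I>" by (auto simp: factorization_ideal_eq)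
  \<comment> \<open>The constant \<open>[:f:]\<close> is the lift of \<open>?g\<close> minus the
    discrepancy between the two, and both vanish.\<close>
  have "vanishing (lift_q ?g + smult (- 1) (lift_q ?g - [:f:]))"
    using vanishing_q_ideal[OF *(2)] vanishing_lift_factorization[OF *(1)]
    by (intro vanishing_add vanishing_smult) (simp_all add: vars_uminus)
  then have "vanishing [:f:]" by (simp add: algebra_simps)
  then show "f \<in> sat" using *(1) by (rule vanishing_const)
qed

lemma sat_eq: "sat = factorization_ideal p d E \<I>"
proof (rule antisym[OF subsetI factorization_ideal_sat])
  interpret C: coeff_hom "Const :: real \<Rightarrow> qindex mpoly" by (rule coeff_hom_Const)
  fix f assume "f \<in> sat"
  then obtain n where "vars f \<subseteq> D p d \<I>" "bp ^ n * f \<in> factorization_ideal p d E \<I>"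
    using relations_subset by (auto simp: sat_iff)
  moreover have "poly_subst Const (factorization p E solved) bp \<noteq> 0"
    using bold_p_notin vars_bold_p by (simp add: factorization_ideal_iff)
  then have "poly_subst Const (factorization p E solved) bp ^ n \<noteq> 0" for n
    by (induction n) (simp_all add: mpoly_mult_eq_0_iff)
  ultimately show "f \<in> factorization_ideal p d E \<I>"
    by (simp add: factorization_ideal_iff C.poly_subst_hom mpoly_mult_eq_0_iff)
qed

text \<open>A prime below the factorization ideal omits \<open>bp\<close>, so \<open>bp\<close> can
  be cancelled in it; if it contains \<open>relations\<close>, it contains their saturation.\<close>

lemma minimal_prime_factorization_ideal:
  "minimal_prime (poly_ring (D p d \<I>)) relations (factorization_ideal p d E \<I>)"
  unfolding minimal_prime_def
proof (intro conjI allI impI)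
  show "primeideal (factorization_ideal p d E \<I>) (poly_ring (D p d \<I>))"
    by (rule primeideal_factorization_ideal)
  show "relations \<subseteq> factorization_ideal p d E \<I>" by (rule relations_subset)
  fix Q assume *: "primeideal Q (poly_ring (D p d \<I>)) \<and> relations \<subseteq> Q \<and>
    Q \<subseteq> factorization_ideal p d E \<I>"
  then interpret Q: primeideal Q "poly_ring (D p d \<I>)" by blast
  have bpQ: "bp \<notin> Q" using * bold_p_notin by blast
  have cancel: "f \<in> Q" if "bp ^ n * f \<in> Q" "vars f \<subseteq> D p d \<I>" for n f
    using that(1)
  proof (induction n)
    case (Suc n)
    have "bp * (bp ^ n * f) \<in> Q" using Suc.prems by (simp add: mult.assoc)
    then have "bp \<in> Q \<or> bp ^ n * f \<in> Q"
      using Q.I_prime[of bp "bp ^ n * f"] vars_bold_p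
        vars_mult_subset[OF vars_power_subset[OF vars_bold_p] that(2)] by simp
    then show ?case using bpQ Suc.IH by blast
  qed simp
  have "factorization_ideal p d E \<I> \<subseteq> Q"
    using * cancel unfolding sat_eq[symmetric] sat_iff subset_iff by blast
  then show "Q = factorization_ideal p d E \<I>" using * by blast
qed

section \<open>Positive points\<close>

lemma q_gens_eval_iff: "(\<forall>g\<in>q_gens p d E \<I>. eval_at q g = 0) \<longleftrightarrow> kernel_system q"
  unfolding eval_at_def by (rule q_gens_zero_iff[OF coeff_hom_id])

lemma factorization_cong:
  assumes "\<And>v. v \<in> U p d E \<I> \<Longrightarrow> q v = q' v" "I \<in> \<I>" "x \<in> outcomes d {1..p}"
  shows "factorization p E q (I, x) = factorization p E q' (I, x)"
proof -
  have "q (K, j, the (x j), x |` pa j) = q' (K, j, the (x j), x |` pa j)"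
    if "K \<in> \<I>" "j \<in> {1..p}" for K j
    using that outcomesD(2)[OF assms(3) that(2)] outcomes_restrict[OF assms(3) pa_subset]
    by (intro assms(1)) (simp add: U_iff)
  then show ?thesis
    unfolding factorization_def prod.case
    using I_subset[OF assms(2)] assms(2) empty_in_\<I>
    by (intro arg_cong2[where f = times] prod.cong) auto
qed

lemma kernel_system_cong:
  assumes "\<And>v. v \<in> U p d E \<I> \<Longrightarrow> q v = q' v"
  shows "kernel_system q \<longleftrightarrow> kernel_system q'"
  unfolding kernel_system_def using assms empty_in_\<I> by (simp add: U_iff)

lemma simplex_product_pos:
  assumes "a \<in> simplex_product p d \<I>" "I \<in> \<I>" "x \<in> outcomes d {1..p}"
  shows "0 < a (I, x)"
proof -
  have "component p d a I \<in> open_simplex (outcomes d {1..p})"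
    using assms by (simp add: simplex_product_def)
  then have "component p d a I x \<in> {0<..<1}"
    using assms(3) unfolding open_simplex_def by blast
  then show ?thesis using assms(3) by (simp add: component_def)
qed

lemma factorization_ideal_image:
  assumes "a \<in> image_phi p d E \<I>" "P \<in> factorization_ideal p d E \<I>"
  shows "eval_at a P = 0"
proof -
  from assms(1) obtain q where q: "kernel_system q" "a = phi p d E \<I> q"
    unfolding image_phi_def q_gens_eval_iff by blast
  have "vars P \<subseteq> D p d \<I>" using assms(2) by (simp add: factorization_ideal_iff)
  then have "eval_at a P = poly_subst (\<lambda>c. c) (factorization p E q) P"
    unfolding eval_at_def by (rule poly_subst_cong[OF coeff_hom_id]) (simp add: q(2) phi_def)
  also have "\<dots> = 0" by (rule factorization_ideal_subst[OF coeff_hom_id q(1) assms(2)])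
  finally show ?thesis .
qed

text \<open>\<open>bp\<close> is positive at \<open>a\<close>, so \<open>a\<close> is a zero of
  \<open>sat\<close> as well, and each congruence for \<open>qnum\<close> becomes an equation for
  the quotients by the value of \<open>bp\<close>. These quotients are the parameters of
  \<open>a\<close>.\<close>

lemma relations_image:
  assumes S: "a \<in> simplex_product p d \<I>" and a: "\<And>P. P \<in> relations \<Longrightarrow> eval_at a P = 0"
  shows "a \<in> image_phi p d E \<I>"
proof -
  interpret e: coeff_hom "\<lambda>c::real. c" by (rule coeff_hom_id)
  note e_simps = e.poly_subst_hom[where f = a, folded eval_at_def]
    e.poly_subst_Var[where f = a, folded eval_at_def]
    e.poly_subst_1[where f = a, folded eval_at_def]
  have pp: "0 < eval_at a (p_plus p d I u)" if "I \<in> \<I>" "u \<in> outcomes d N" "N \<subseteq> {1..p}" for I u N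
    unfolding p_plus_def e_simps
    by (rule sum_pos[OF finite_extending extending_nonempty[OF that(2,3)]])
      (use simplex_product_pos[OF S that(1)] in \<open>simp add: extending_def\<close>)
  have b: "0 < eval_at a bp"
    unfolding bold_p_def e_simps
  proof (intro prod_pos)
    fix I x assume I: "I \<in> \<I>" and "x \<in> (\<Union>k\<in>{1..p}. outcomes d (\<pi> ` {1..k}))"
    then obtain k where k: "k \<in> {1..p}" "x \<in> outcomes d (\<pi> ` {1..k})" by blast
    show "0 < eval_at a (p_plus p d I x)" by (rule pp[OF I k(2) \<pi>_prefix[OF k(1)]])
  qed
  have sat: "eval_at a P = 0" if "P \<in> sat" for P
  proof -
    from that obtain n where "bp ^ n * P \<in> relations" by (auto simp: sat_iff)
    from a[OF this] b show ?thesis by (simp add: e_simps)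
  qed
  define r where "r v = eval_at a (qnum v) / eval_at a bp" for v
  define q where "q = restrict r (U p d E \<I>)"
  have qr: "q v = r v" if "v \<in> U p d E \<I>" for v using that by (simp add: q_def)
  have "kernel_system r"
    unfolding kernel_system_def
  proof (intro conjI ballI)
    fix I j y assume *: "I \<in> \<I>" "j \<in> {1..p}" "y \<in> outcomes d (pa j)"
    show "(\<Sum>x\<in>{1..d j}. r (I, j, x, y)) = 1"
      using sat[OF qnum_sum[OF *]] b by (simp add: r_def e_simps flip: sum_divide_distrib)
  next
    fix I j x y assume *: "I \<in> \<I>" "j \<in> {1..p} - I" "x \<in> {1..d j}" "y \<in> outcomes d (pa j)"
    show "r (I, j, x, y) = r ({}, j, x, y)"
      using sat[OF qnum_intervention[OF *]] by (simp add: r_def e_simps)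
  qed
  then have q: "kernel_system q" using kernel_system_cong[of q r, OF qr] by blast
  have pos: "0 < q v" if v: "v \<in> U p d E \<I>" for v
  proof -
    obtain I j x y where v': "v = (I, j, x, y)" by (metis prod_cases4)
    have *: "I \<in> \<I>" "j \<in> {1..p}" "x \<in> {1..d j}" "y \<in> outcomes d (pa j)"
      using v by (simp_all add: v' U_iff)
    let ?z = "completion j y"
    note z = completion(1)[OF *(2,4)]
    \<comment> \<open>The cofactor was chosen abstractly; its sign follows because its product with
      a positive marginal has the value of \<open>bp\<close>.\<close>
    have "eval_at a (cof I ?z * p_plus p d I ?z - bp) = 0"
      by (rule a[OF cof_before(2)[OF *(1,2) z]])
    then have "0 < eval_at a (cof I ?z) * eval_at a (p_plus p d I ?z)"
      using b by (simp add: e_simps)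
    then have "0 < eval_at a (cof I ?z)"
      using pp[OF *(1) z before_subset[OF *(2)]] by (simp add: zero_less_mult_iff)
    moreover have "0 < eval_at a (p_plus p d I (?z(j \<mapsto> x)))"
      by (rule pp[OF *(1) outcomes_upd[OF z *(3)]]) (use before_subset[OF *(2)] *(2) in auto)
    ultimately show ?thesis
      unfolding qr[OF v] using b by (simp add: r_def v' qnum_def cond_num_def e_simps)
  qed
  have "a v = phi p d E \<I> q v" for v
  proof (cases "v \<in> D p d \<I>")
    case True
    then obtain I x where v: "v = (I, x)" "I \<in> \<I>" "x \<in> outcomes d {1..p}" by (auto simp: D_def)
    have fin: "finite I" using finite_subset[OF I_subset[OF v(2)]] by simp
    have card: "card I + card ({1..p} - I) = p"
      using I_subset[OF v(2)] card_mono[OF _ I_subset[OF v(2)]] by (simp add: card_Diff_subset fin)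
    have "eval_at a (factorization p E qnum (I, x)) = a (I, x) * eval_at a bp ^ p"
      using sat[OF qnum_factorization[OF v(2,3)]] by (simp add: e_simps)
    moreover have "factorization p E r (I, x) =
        eval_at a (factorization p E qnum (I, x)) / eval_at a bp ^ (card I + card ({1..p} - I))"
      by (simp add: factorization_def r_def e_simps prod_dividef power_add)
    ultimately have "factorization p E r (I, x) = a (I, x)"
      using b unfolding card by simp
    then show ?thesis
      using True factorization_cong[of q r, OF qr v(2,3)] by (simp add: phi_def v(1))
  next
    case False
    then show ?thesis using S by (auto simp: phi_def simplex_product_def)
  qed
  then have "a = phi p d E \<I> q" by (rule ext)
  then show ?thesis
    unfolding image_phi_def q_gens_eval_iff using q pos by (auto simp: q_def)
qed

text \<open>Inside the simplices the zeros of \<open>relations\<close> are in the image, the image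
  consists of zeros of the factorization ideal, and these are zeros of \<open>relations\<close>. The
  intersection removes boundary zeros; from the image it removes points only if there is just one
  outcome, whose probability is 1.\<close>

lemma V_nonneg_relations:
  "V_nonneg (D p d \<I>) relations \<inter> simplex_product p d \<I> = image_phi p d E \<I> \<inter> simplex_product p d \<I>"
  "V_nonneg (D p d \<I>) (factorization_ideal p d E \<I>) \<inter> simplex_product p d \<I> =
    image_phi p d E \<I> \<inter> simplex_product p d \<I>"
proof -
  have nonneg: "a \<in> D p d \<I> \<rightarrow>\<^sub>E {0..}" if a: "a \<in> simplex_product p d \<I>" for a
  proof (rule PiE_I)
    show "a v \<in> {0..}" if "v \<in> D p d \<I>" for v
      using that simplex_product_pos[OF a] by (auto simp: D_def intro: less_imp_le)
    show "a v = undefined" if "v \<notin> D p d \<I>" for v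
      using that a by (auto simp: simplex_product_def)
  qed
  have "a \<in> V_nonneg (D p d \<I>) relations \<longleftrightarrow> a \<in> image_phi p d E \<I>"
    "a \<in> V_nonneg (D p d \<I>) (factorization_ideal p d E \<I>) \<longleftrightarrow> a \<in> image_phi p d E \<I>"
    if "a \<in> simplex_product p d \<I>" for a
    using nonneg[OF that] relations_image[OF that] factorization_ideal_image[of a] relations_subset
    by (auto simp: V_nonneg_def)
  then show "V_nonneg (D p d \<I>) relations \<inter> simplex_product p d \<I> =
      image_phi p d E \<I> \<inter> simplex_product p d \<I>"
    "V_nonneg (D p d \<I>) (factorization_ideal p d E \<I>) \<inter> simplex_product p d \<I> =
      image_phi p d E \<I> \<inter> simplex_product p d \<I>"
    by blast+
qed

section \<open>The image of the parametrization is the interventional model\<close>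

lemma before_closed: "j \<in> {1..p} \<Longrightarrow> i \<in> before j \<Longrightarrow> pa i \<subseteq> before j"
  using pa_before[of i] by (force simp: before_iff)

text \<open>The conditional probability given the parents is the kernel, without division. Since
  \<open>pa j\<close> need not be ancestral, the marginal is summed over the extensions of
  \<open>y\<close> to the ancestral set \<open>before j\<close>, on which the kernel of
  \<open>j\<close> is constant.\<close>

lemma mass_family:
  assumes q: "kernel_system q" and I: "I \<in> \<I>" and j: "j \<in> {1..p}" and k: "k \<in> {1..d j}"
    and y: "y \<in> outcomes d (pa j)"
  shows "mass q I (y(j \<mapsto> k)) = q (I, j, k, y) * mass q I y"
proof -
  let ?B = "before j"
  have jB: "j \<notin> ?B" "?B \<subseteq> {1..p}" "pa j \<subseteq> ?B" using before_irrefl before_subset pa_before j by auto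
  have dy: "dom y = pa j" using y by (rule outcomesD)
  have split: "mass q I u = (\<Sum>z\<in>exts d N u. mass q I z)" if "dom u \<subseteq> N" "N \<subseteq> {1..p}" for u N
    unfolding mass_def extending_eq_exts by (rule sum_exts_split) (use that in auto)
  have step: "mass q I (z(j \<mapsto> k)) = q (I, j, k, y) * mass q I z" if z: "z \<in> exts d ?B y" for z
  proof -
    have zB: "z \<in> outcomes d ?B" "z |` pa j = y" using extsD[OF z] by (simp_all add: dy)
    have "kern q I i (z(j \<mapsto> k)) = kern q I i z" if "i \<in> ?B" for i
      using that jB before_closed[OF j that] by (auto simp: kern_def)
    moreover have "j \<notin> pa j" using jB by blast
    then have "kern q I j (z(j \<mapsto> k)) = q (I, j, k, y)" by (simp add: kern_def zB(2))
    moreover have "mass q I (z(j \<mapsto> k)) = (\<Prod>i\<in>insert j ?B. kern q I i (z(j \<mapsto> k)))"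
      by (rule mass_ancestral[OF q I _ _ outcomes_upd[OF zB(1) k]]) (use jB j before_closed[OF j] in auto)
    moreover have "mass q I z = (\<Prod>i\<in>?B. kern q I i z)"
      by (rule mass_ancestral[OF q I jB(2) before_closed[OF j] zB(1)])
    ultimately show ?thesis
      using jB finite_subset[OF jB(2)] by simp
  qed
  have "mass q I (y(j \<mapsto> k)) = (\<Sum>z\<in>exts d (insert j ?B) (y(j \<mapsto> k)). mass q I z)"
    by (rule split) (use dy jB j in auto)
  also have "\<dots> = (\<Sum>z\<in>exts d ?B y. mass q I (z(j \<mapsto> k)))"
  proof (rule sum.reindex_bij_witness[of _ "\<lambda>z. z(j \<mapsto> k)" "\<lambda>z. z |` ?B"])
    fix z assume z: "z \<in> exts d (insert j ?B) (y(j \<mapsto> k))"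
    have zo: "z \<in> outcomes d (insert j ?B)" "dom z = insert j ?B" "z |` insert j (pa j) = y(j \<mapsto> k)"
      using extsD[OF z] by (simp_all add: dy)
    have "z j = Some k" using fun_cong[OF zo(3), of j] by simp
    then show *: "(z |` ?B)(j \<mapsto> k) = z"
      using zo(2) by (auto simp: fun_eq_iff restrict_map_def domIff)
    show "mass q I ((z |` ?B)(j \<mapsto> k)) = mass q I z" by (simp only: *)
    have "z |` pa j = (z |` insert j (pa j)) |` pa j" by (simp add: Int_absorb1 subset_insertI)
    also have "\<dots> = y" unfolding zo(3) using jB dy by (auto simp: restrict_dom_self)
    finally have "z |` pa j = y" .
    then show "z |` ?B \<in> exts d ?B y"
      using outcomes_restrict[OF zo(1), of ?B] jB by (auto simp: exts_def dy Int_absorb1)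
  next
    fix z assume z: "z \<in> exts d ?B y"
    have zB: "z \<in> outcomes d ?B" "dom z = ?B" "z |` pa j = y" using extsD[OF z] by (simp_all add: dy)
    show "z(j \<mapsto> k) |` ?B = z" using jB zB(2) by (simp add: restrict_dom_self)
    have "z(j \<mapsto> k) |` insert j (pa j) = (z |` pa j)(j \<mapsto> k)"
      by (auto simp: fun_eq_iff restrict_map_def)
    then show "z(j \<mapsto> k) \<in> exts d (insert j ?B) (y(j \<mapsto> k))"
      using outcomes_upd[OF zB(1) k] by (simp add: exts_def dy zB(3))
  qed
  also have "\<dots> = q (I, j, k, y) * (\<Sum>z\<in>exts d ?B y. mass q I z)"
    by (simp add: step sum_distrib_left)
  also have "(\<Sum>z\<in>exts d ?B y. mass q I z) = mass q I y"
    by (rule split[symmetric]) (use dy jB in auto)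
  finally show ?thesis .
qed

lemma family_outcome:
  assumes "j \<in> {1..p}" "x \<in> outcomes d {1..p}"
  shows "x |` {j} ++ x |` pa j = (x |` pa j)(j \<mapsto> the (x j))"
    and "x |` {j} = [j \<mapsto> the (x j)]"
proof -
  have "j \<in> dom x" using outcomesD(1)[OF assms(2)] assms(1) by simp
  then have xj: "x j = Some (the (x j))" by auto
  then show *: "x |` {j} = [j \<mapsto> the (x j)]" by (auto simp: fun_eq_iff restrict_map_def)
  have "j \<notin> pa j" using before_irrefl[OF assms(1)] pa_before[OF assms(1)] by blast
  then show "x |` {j} ++ x |` pa j = (x |` pa j)(j \<mapsto> the (x j))"
    unfolding * by (auto simp: fun_eq_iff restrict_map_def map_add_def split: option.splits)
qed

text \<open>As all marginals are positive, \<open>mass_family\<close> identifies the conditional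
  probabilities with the kernels. The Markov factorization is then \<open>factorization_eq\<close>,
  and invariance is \<open>kern_intervene\<close>.\<close>

lemma image_phi_subset_model:
  assumes "a \<in> image_phi p d E \<I>" "a \<in> simplex_product p d \<I>"
  shows "a \<in> interventional_model p d E \<I>"
proof -
  from assms(1) obtain q where q: "kernel_system q" "\<And>v. v \<in> U p d E \<I> \<Longrightarrow> 0 < q v"
      "a = phi p d E \<I> q"
    unfolding image_phi_def q_gens_eval_iff by blast
  have comp: "component p d a I x = factorization p E q (I, x)"
    if "I \<in> \<I>" "x \<in> outcomes d {1..p}" for I x
    using that by (simp add: component_def q(3) phi_def D_def)
  have marg: "marginal p d (component p d a I) u = mass q I u" if "I \<in> \<I>" for I u
    unfolding marginal_def mass_def by (rule sum.cong) (use comp that in \<open>auto simp: extending_def\<close>)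
  have cond: "cond_prob p d (component p d a I) (x |` {j}) (x |` pa j) = kern q I j x"
    if I: "I \<in> \<I>" and j: "j \<in> {1..p}" and x: "x \<in> outcomes d {1..p}" for I j x
  proof -
    have y: "x |` pa j \<in> outcomes d (pa j)" by (rule outcomes_restrict[OF x pa_subset])
    have "0 < mass q I (x |` pa j)" by (rule mass_pos[OF q(2) I y pa_subset])
    then show ?thesis
      unfolding cond_prob_def marg[OF I] family_outcome(1)[OF j x]
        mass_family[OF q(1) I j outcomesD(2)[OF x j] y]
      by (simp add: kern_def)
  qed
  have "component p d a I x = (\<Prod>j\<in>{1..p}. cond_prob p d (component p d a I) (x |` {j}) (x |` pa j))"
    if "I \<in> \<I>" "x \<in> outcomes d {1..p}" for I x
    unfolding comp[OF that] factorization_eq[OF q(1) that]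
    by (rule prod.cong[OF refl]) (rule cond[OF that(1) _ that(2), symmetric])
  then have "component p d a I \<in> dag_model p d E" if "I \<in> \<I>" for I
    using assms(2) that unfolding dag_model_def simplex_product_def by blast
  moreover have "cond_prob p d (component p d a I) (x |` {j}) (x |` pa j) =
      cond_prob p d (component p d a J) (x |` {j}) (x |` pa j)"
    if "I \<in> \<I>" "J \<in> \<I>" "j \<in> {1..p} - (I \<union> J)" "x \<in> outcomes d {1..p}" for I J j x
  proof -
    have "j \<in> {1..p}" "insert j (pa j) \<subseteq> {1..p}" using that(3) pa_subset[of j] by auto
    then show ?thesis
      unfolding cond[OF that(1) \<open>j \<in> {1..p}\<close> that(4)] cond[OF that(2) \<open>j \<in> {1..p}\<close> that(4)]
      using kern_intervene[OF q(1) that(1) _ that(4)] kern_intervene[OF q(1) that(2) _ that(4)] that(3)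
      by (metis Diff_iff UnCI)
  qed
  ultimately show ?thesis
    using assms(2) unfolding interventional_model_def simplex_product_def by blast
qed

text \<open>The parameters are the conditional probabilities given the parents: they sum to 1 by
  splitting a marginal, are shared by the invariance condition, and multiply to the point by the
  Markov property.\<close>

lemma model_subset_image_phi:
  assumes "a \<in> interventional_model p d E \<I>"
  shows "a \<in> image_phi p d E \<I>" "a \<in> simplex_product p d \<I>"
proof -
  have dag: "component p d a I \<in> dag_model p d E" if "I \<in> \<I>" for I
    using assms that by (auto simp: interventional_model_def)
  have a_ext: "a \<in> D p d \<I> \<rightarrow>\<^sub>E UNIV" using assms by (simp add: interventional_model_def)
  show S: "a \<in> simplex_product p d \<I>"
    using dag a_ext by (simp add: simplex_product_def dag_model_def)
  let ?f = "\<lambda>I. component p d a I"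
  have pos: "0 < marginal p d (?f I) u" if "I \<in> \<I>" "u \<in> outcomes d N" "N \<subseteq> {1..p}" for I u N
    unfolding marginal_def
    by (rule sum_pos[OF finite_extending extending_nonempty[OF that(2,3)]])
      (use simplex_product_pos[OF S that(1)] in \<open>simp add: extending_def component_def\<close>)
  define r where "r = (\<lambda>(I, j, x, y). cond_prob p d (?f I) [j \<mapsto> x] y)"
  define q where "q = restrict r (U p d E \<I>)"
  have qr: "q v = r v" if "v \<in> U p d E \<I>" for v using that by (simp add: q_def)
  have upd: "[j \<mapsto> x] ++ y = y(j \<mapsto> x)" "y(j \<mapsto> x) \<in> outcomes d (insert j (pa j))" "j \<notin> pa j"
    if "j \<in> {1..p}" "x \<in> {1..d j}" "y \<in> outcomes d (pa j)" for j x y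
  proof -
    show "j \<notin> pa j" using pa_before[OF that(1)] before_irrefl[OF that(1)] by blast
    then show "[j \<mapsto> x] ++ y = y(j \<mapsto> x)"
      using outcomesD(1)[OF that(3)]
      by (auto simp: fun_eq_iff map_add_def domIff split: option.splits)
    show "y(j \<mapsto> x) \<in> outcomes d (insert j (pa j))" by (rule outcomes_upd[OF that(3,2)])
  qed
  have "kernel_system r"
    unfolding kernel_system_def
  proof (intro conjI ballI)
    fix I j y assume *: "I \<in> \<I>" "j \<in> {1..p}" "y \<in> outcomes d (pa j)"
    have "j \<notin> pa j" using pa_before[OF *(2)] before_irrefl[OF *(2)] by blast
    then have "marginal p d (?f I) y = (\<Sum>x\<in>{1..d j}. marginal p d (?f I) (y(j \<mapsto> x)))"
      unfolding marginal_def using * pa_subset by (intro sum_extending_upd) auto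
    also have "\<dots> = (\<Sum>x\<in>{1..d j}. marginal p d (?f I) ([j \<mapsto> x] ++ y))"
      using * by (intro sum.cong) (simp_all only: upd(1))
    finally show "(\<Sum>x\<in>{1..d j}. r (I, j, x, y)) = 1"
      using pos[OF *(1,3) pa_subset] by (simp add: r_def cond_prob_def flip: sum_divide_distrib)
  next
    fix I j x y assume *: "I \<in> \<I>" "j \<in> {1..p} - I" "x \<in> {1..d j}" "y \<in> outcomes d (pa j)"
    have j: "j \<in> {1..p}" using * by blast
    \<comment> \<open>The model states invariance at full outcomes, so the outcome of the family of
      \<open>j\<close> is extended to one.\<close>
    have "extending p d (y(j \<mapsto> x)) \<noteq> {}"
      by (rule extending_nonempty[OF upd(2)[OF j *(3,4)]]) (use pa_subset j in auto)
    then obtain w where "w \<in> extending p d (y(j \<mapsto> x))" by blast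
    then have w: "w \<in> outcomes d {1..p}" "w |` insert j (pa j) = y(j \<mapsto> x)"
      using outcomesD(1)[OF *(4)] by (auto simp: extending_def)
    have "w j = Some x" using fun_cong[OF w(2), of j] by simp
    moreover have "w |` pa j = (w |` insert j (pa j)) |` pa j" by (simp add: Int_absorb1 subset_insertI)
    then have "w |` pa j = y"
      unfolding w(2) using upd(3)[OF j *(3,4)] outcomesD(1)[OF *(4)] by (simp add: restrict_dom_self)
    moreover have "cond_prob p d (?f I) (w |` {j}) (w |` pa j) = cond_prob p d (?f {}) (w |` {j}) (w |` pa j)"
      using assms *(1,2) w(1) empty_in_\<I> unfolding interventional_model_def by fastforce
    ultimately show "r (I, j, x, y) = r ({}, j, x, y)"
      using family_outcome(2)[OF j w(1)] by (simp add: r_def)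
  qed
  then have q: "kernel_system q" using kernel_system_cong[of q r, OF qr] by blast
  have posq: "0 < q v" if v: "v \<in> U p d E \<I>" for v
  proof -
    obtain I j x y where v': "v = (I, j, x, y)" by (metis prod_cases4)
    have *: "I \<in> \<I>" "j \<in> {1..p}" "x \<in> {1..d j}" "y \<in> outcomes d (pa j)"
      using v by (simp_all add: v' U_iff)
    have "insert j (pa j) \<subseteq> {1..p}" using pa_subset *(2) by blast
    then show ?thesis
      unfolding qr[OF v] using pos[OF *(1) upd(2)[OF *(2-4)]] pos[OF *(1,4) pa_subset]
      by (simp add: v' r_def cond_prob_def upd(1)[OF *(2-4)])
  qed
  have "a v = phi p d E \<I> q v" for v
  proof (cases "v \<in> D p d \<I>")
    case True
    then obtain I x where v: "v = (I, x)" "I \<in> \<I>" "x \<in> outcomes d {1..p}" by (auto simp: D_def)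
    have "a (I, x) = ?f I x" using v by (simp add: component_def)
    also have "\<dots> = (\<Prod>j\<in>{1..p}. cond_prob p d (?f I) (x |` {j}) (x |` pa j))"
      using dag[OF v(2)] v(3) by (simp add: dag_model_def)
    also have "\<dots> = (\<Prod>j\<in>{1..p}. kern r I j x)"
      by (rule prod.cong) (simp_all add: r_def kern_def family_outcome(2)[OF _ v(3)])
    also have "\<dots> = factorization p E r (I, x)"
      by (rule factorization_eq[OF \<open>kernel_system r\<close> v(2,3), symmetric])
    finally show ?thesis
      using True factorization_cong[of q r, OF qr v(2,3)] by (simp add: phi_def v(1))
  next
    case False
    then show ?thesis using a_ext by (auto simp: phi_def)
  qed
  then have "a = phi p d E \<I> q" by (rule ext)
  then show "a \<in> image_phi p d E \<I>"
    unfolding image_phi_def q_gens_eval_iff using q posq by (auto simp: q_def)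
qed

end

theorem theorem3p2:
  fixes p :: nat and d :: "nat \<Rightarrow> nat" and E :: "(nat \<times> nat) set"
    and \<I> :: "nat set set" and \<pi> :: "nat \<Rightarrow> nat"
  assumes "E \<subseteq> {1..p} \<times> {1..p}" and "acyclic E"
    and "linear_extension p E \<pi>"
    and "\<And>k. k \<in> {1..p} \<Longrightarrow> 1 \<le> d k"
    and "\<I> \<subseteq> Pow {1..p}" and "{} \<in> \<I>"
  defines "R \<equiv> poly_ring (D p d \<I>)"
    and "CI \<equiv> ci_ideal p d E \<I>"
    and "Sig \<equiv> sigma_ideal p d \<I>"
    and "F \<equiv> factorization_ideal p d E \<I>"
    and "S \<equiv> simplex_product p d \<I>"
  shows
    "(CI \<subseteq> F \<and> saturation R (CI <+>\<^bsub>R\<^esub> Sig) (bold_p p d \<I> \<pi>) = F) \<and>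
     minimal_prime R (CI <+>\<^bsub>R\<^esub> Sig) F \<and>
     (V_nonneg (D p d \<I>) (CI <+>\<^bsub>R\<^esub> Sig) \<inter> S = V_nonneg (D p d \<I>) F \<inter> S \<and>
      V_nonneg (D p d \<I>) F \<inter> S = image_phi p d E \<I> \<inter> S \<and>
      image_phi p d E \<I> \<inter> S = interventional_model p d E \<I>)"
proof -
  interpret interventional_dag p d E \<I> \<pi>
    by unfold_locales (use assms(1-6) in auto)
  have "image_phi p d E \<I> \<inter> simplex_product p d \<I> = interventional_model p d E \<I>"
    using image_phi_subset_model model_subset_image_phi by blast
  then show ?thesis
    using ci_ideal_subset sat_eq minimal_prime_factorization_ideal V_nonneg_relations
    by (simp add: R_def CI_def Sig_def F_def S_def relations_def sat_def)
qed

end
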